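(* Let $T\in(0,\infty)$, let $p,q$ be real constants with $0<q<\infty$ and $-q<p<\infty$, and let $(W(t))_{t\in\mathbf{R}}$ be a one-dimensional (two-sided) Brownian motion with $W(0)=0$ on a complete probability space. Define $$V(t)=W(t)-\int_0^t\left(\int_{-\infty}^s p e^{-(q+p)(s-u)}\,dW(u)\right)ds\qquad(t\in\mathbf{R}).$$ Put $$k(t,s)=p(2q+p)\frac{(2q+p)e^{qs}-pe^{-qs}}{(2q+p)^2e^{qt}-p^2e^{-qt}}\qquad(0\le s\le t\le T),$$ and let $l(t,s)$, $0\le s\le t\le T$, be the resolvent of $k$, i.e. the square-integrable Volterra kernel satisfying, for almost every $0\le s\le t\le T$, $$l(t,s)-k(t,s)+\int_s^t l(t,u)k(u,s)\,du=0,\qquad l(t,s)-k(t,s)+\int_s^t k(t,u)l(u,s)\,du=0 .$$ Then $$l(t,s)=pe^{-(p+q)(t-s)}\left\{1-\frac{2pq}{(2q+p)^2e^{2qs}-p^2}\right\}\qquad(0\le s\le t\le T),$$ and, with this $l$, there exists a one-dimensional Brownian motion $(B(t))_{0\le t\le T}$ such that $\mathcal{F}^B(t)=\mathcal{F}^V(t)$ for $0\le t\le T$ and $$V(t)=B(t)-\int_0^t\left(\int_0^s l(s,u)\,dB(u)\right)ds\qquad(0\le t\le T).$$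
   Context: For a process $(A(t))_{0\le t\le T}$, $\mathcal{F}^A(t)$ denotes the $\mathbb{P}$-augmentation (by null sets) of $\sigma(A(s):0\le s\le t)$, $0\le t\le T$. The integral $\int_{-\infty}^s\cdots dW(u)$ is a Wiener integral, and for $t<0$, $\int_0^t=-\int_t^0$. The kernel $l$ is determined up to almost everywhere equality, and the formula for $l$ is understood for that version. *)

theory Defs
  imports "HOL-Probability.Probability"
begin

text \<open>
  The index set \<open>I\<close> is an interval containing 0: \<open>UNIV\<close> for a two-sided Brownian motion,
  \<open>{0..T}\<close> for a Brownian motion on a finite horizon.
\<close>

locale brownian_motion = prob_space M
  for M :: "'a measure" and I :: "real set" and W :: "real \<Rightarrow> 'a \<Rightarrow> real" +
  assumes rv: "t \<in> I \<Longrightarrow> W t \<in> borel_measurable M"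
    and start: "AE \<omega> in M. W 0 \<omega> = 0"
    and increments_normal:
      "s \<in> I \<Longrightarrow> t \<in> I \<Longrightarrow> s < t \<Longrightarrow>
        distributed M lborel (\<lambda>\<omega>. W t \<omega> - W s \<omega>) (normal_density 0 (sqrt (t - s)))"
    and increments_indep:
      "(\<And>i. i \<le> n \<Longrightarrow> \<tau> i \<in> I) \<Longrightarrow> (\<And>i. i < n \<Longrightarrow> \<tau> i < \<tau> (Suc i)) \<Longrightarrow>
        indep_vars (\<lambda>_. borel) (\<lambda>i \<omega>. W (\<tau> (Suc i)) \<omega> - W (\<tau> i) \<omega>) {..<(n::nat)}"
    and paths_continuous: "AE \<omega> in M. continuous_on I (\<lambda>t. W t \<omega>)"

definition augmented_filtration :: "'a measure \<Rightarrow> (real \<Rightarrow> 'a \<Rightarrow> real) \<Rightarrow> real \<Rightarrow> 'a set set"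
  where "augmented_filtration M A t =
    sigma_sets (space M)
      ({A s -` E \<inter> space M | s E. 0 \<le> s \<and> s \<le> t \<and> E \<in> sets borel} \<union> null_sets M)"

text \<open>
  A list of triples \<open>(c, a, b)\<close> encodes the step function taking the sum of the
  \<open>c * indicator {a<..b}\<close>.
\<close>

definition step_function :: "(real \<times> real \<times> real) list \<Rightarrow> real \<Rightarrow> real"
  where "step_function xs u = (\<Sum>(c, a, b)\<leftarrow>xs. c * indicator {a<..b} u)"

definition step_integral ::
    "(real \<Rightarrow> 'a \<Rightarrow> real) \<Rightarrow> (real \<times> real \<times> real) list \<Rightarrow> 'a \<Rightarrow> real"
  where "step_integral W xs \<omega> = (\<Sum>(c, a, b)\<leftarrow>xs. c * (W b \<omega> - W a \<omega>))"

text \<open>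
  \<open>X\<close> is (a version of) the Wiener integral of \<open>f\<close> with respect to \<open>W\<close> over the interval \<open>A\<close>:
  the \<open>L\<^sup>2(M)\<close>-limit of the integrals of step functions on \<open>A\<close> which converge to \<open>f\<close> in \<open>L\<^sup>2(A)\<close>.
  By the Wiener isometry this determines \<open>X\<close> up to almost sure equality. The \<open>L\<^sup>2\<close>-distances are
  \<open>ennreal\<close>-valued integrals, so no separate integrability condition is needed.
\<close>

definition is_wiener_integral ::
    "'a measure \<Rightarrow> (real \<Rightarrow> 'a \<Rightarrow> real) \<Rightarrow> real set \<Rightarrow> (real \<Rightarrow> real) \<Rightarrow> ('a \<Rightarrow> real) \<Rightarrow> bool"
  where "is_wiener_integral M W A f X \<longleftrightarrow>
    f \<in> borel_measurable (lebesgue_on A) \<and> X \<in> borel_measurable M \<and>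
    (\<exists>\<phi>. (\<forall>n. \<forall>(c, a, b)\<in>set (\<phi> n). a \<in> A \<and> b \<in> A \<and> a \<le> b) \<and>
      (\<lambda>n. \<integral>\<^sup>+u. ennreal ((f u - step_function (\<phi> n) u)\<^sup>2) \<partial>lebesgue_on A) \<longlonglongrightarrow> 0 \<and>
      (\<lambda>n. \<integral>\<^sup>+\<omega>. ennreal ((X \<omega> - step_integral W (\<phi> n) \<omega>)\<^sup>2) \<partial>M) \<longlonglongrightarrow> 0)"

text \<open>
  \<open>Y s\<close> is a version of the Wiener integral of \<open>g s\<close> over \<open>A s\<close> for each time \<open>s\<close> in \<open>S\<close>. Joint
  measurability is what gives a meaning to the pathwise integrals \<open>\<integral> Y s \<omega> ds\<close>; any two such
  processes yield indistinguishable integral processes.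
\<close>

definition is_wiener_integral_process ::
    "'a measure \<Rightarrow> (real \<Rightarrow> 'a \<Rightarrow> real) \<Rightarrow> real set \<Rightarrow> (real \<Rightarrow> real set) \<Rightarrow>
      (real \<Rightarrow> real \<Rightarrow> real) \<Rightarrow> (real \<Rightarrow> 'a \<Rightarrow> real) \<Rightarrow> bool"
  where "is_wiener_integral_process M W S A g Y \<longleftrightarrow>
    (\<lambda>(s, \<omega>). Y s \<omega>) \<in> borel_measurable (restrict_space lborel S \<Otimes>\<^sub>M M) \<and>
    (\<forall>s\<in>S. is_wiener_integral M W (A s) (g s) (Y s))"

definition volterra_triangle :: "real \<Rightarrow> (real \<times> real) set"
  where "volterra_triangle T = {(t, s). 0 \<le> s \<and> s \<le> t \<and> t \<le> T}"

definition square_integrable_volterra_kernel :: "real \<Rightarrow> (real \<Rightarrow> real \<Rightarrow> real) \<Rightarrow> bool"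
  where "square_integrable_volterra_kernel T l \<longleftrightarrow>
    (\<lambda>(t, s). l t s) \<in> borel_measurable (lebesgue_on (volterra_triangle T)) \<and>
    integrable (lebesgue_on (volterra_triangle T)) (\<lambda>(t, s). (l t s)\<^sup>2)"

definition is_resolvent :: "real \<Rightarrow> (real \<Rightarrow> real \<Rightarrow> real) \<Rightarrow> (real \<Rightarrow> real \<Rightarrow> real) \<Rightarrow> bool"
  where "is_resolvent T k l \<longleftrightarrow>
    square_integrable_volterra_kernel T l \<and>
    (AE (t, s) in lebesgue_on (volterra_triangle T).
      l t s - k t s + (LINT u|lebesgue_on {s..t}. l t u * k u s) = 0 \<and>
      l t s - k t s + (LINT u|lebesgue_on {s..t}. k t u * l u s) = 0)"

definition kernel_k :: "real \<Rightarrow> real \<Rightarrow> real \<Rightarrow> real \<Rightarrow> real"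
  where "kernel_k p q t s =
    p * (2 * q + p) * (((2 * q + p) * exp (q * s) - p * exp (- q * s)) /
      ((2 * q + p)\<^sup>2 * exp (q * t) - p\<^sup>2 * exp (- q * t)))"

definition kernel_l :: "real \<Rightarrow> real \<Rightarrow> real \<Rightarrow> real \<Rightarrow> real"
  where "kernel_l p q t s =
    p * exp (- (p + q) * (t - s)) *
      (1 - 2 * p * q / ((2 * q + p)\<^sup>2 * exp (2 * q * s) - p\<^sup>2))"

end

theory Submission
  imports Defs
begin

text \<open>
  Write \<open>\<rho> = p + q\<close>, \<open>r = 2 q + p\<close>, \<open>ka s = r exp(q s) - p exp(-q s)\<close>, \<open>kb t = r\<^sup>2 exp(q t) - p\<^sup>2 exp(-q t)\<close>.
  Then \<open>k(t,s) = p r ka(s) / kb(t)\<close> and \<open>l(t,s) = p r exp(-\<rho>(t-s)) ka(s) / kb(s)\<close>, and both resolvent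
  equations are the identity \<open>kb' = \<rho> kb - p r ka\<close> in disguise.

  The stationary process \<open>y(s) = p \<integral> exp(-\<rho>(s-u)) dW(u)\<close> over \<open>u \<le> s\<close> is a pathwise functional
  of \<open>y(0)\<close> and \<open>W\<close>. Put \<open>m(s) = \<integral>\<^sub>0\<^sup>s k(s,u) dV(u)\<close> and \<open>B = V + \<integral> m\<close>. All these integrals have smooth integrands,
  so integration by parts turns them into functionals of continuous paths; on this level
  \<open>m(s) = \<integral>\<^sub>0\<^sup>s l(s,u) dB(u)\<close>, which expresses \<open>V\<close> by \<open>B\<close> and yields the equality of filtrations. As in
  Kalman filtering, \<open>d(kb (y - m)) = kh dW\<close> with \<open>kh = p kb - p r ka\<close>; hence \<open>B(t)\<close> is the Wiener
  integral over \<open>u \<le> t\<close> of an explicit function, and the covariance of \<open>B\<close> turns out to be \<open>min s t\<close>.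
  Characteristic functions show that Wiener integrals of orthogonal functions are independent,
  so \<open>B\<close> is a Brownian motion.
\<close>

section \<open>Independence from characteristic functions\<close>

text \<open>The constants come from the Kalman filter with signal dy = -\<rho> y ds + p dW and
  observation dV = dW - y ds. The error variance P solves P' = -2 q P - P^2 with the stationary
  start P(0) = p^2 / (2 \<rho>); the solution is \<open>kh / kb\<close>. The error obeys dg = -(q +
  P) g ds + P dW, whose integrating factor is \<open>kb\<close>, and the filter obeys dm = -\<rho> m
  ds + (p - P) dB. Hence l(s,u) = exp(-\<rho>(s-u)) (p - P(u)): p times the braces in the statement
  is p - P. This is only the origin of the formulas. In the proof m is defined by its kernel, no
  conditional expectation occurs, and the identities are checked by differentiation. Two obstacles
  shape the rest. Paths are only continuous, so each identity is arranged such that the terms in the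
  path itself cancel before anything is differentiated. And Y(s) is determined only up to a null set
  depending on s, whereas V needs one null set for all times; hence versions with everywhere
  continuous paths are used, and Fubini and completeness lead back to V.\<close>

lemma (in prob_space) real_weight_zero_if_char_zero:
  fixes w X :: "'a \<Rightarrow> real"
  assumes w[measurable]: "w \<in> borel_measurable M" and X[measurable]: "X \<in> borel_measurable M"
    and bound: "\<And>\<omega>. \<bar>w \<omega>\<bar> \<le> C" and C: "0 < C"
    and zero: "\<And>l::real. (CLINT \<omega>|M. of_real (w \<omega>) * iexp (l * X \<omega>)) = 0"
    and A[measurable]: "A \<in> sets borel"
  shows "expectation (\<lambda>\<omega>. w \<omega> * indicator A (X \<omega>)) = 0"
proof -
  \<comment> \<open>\<open>u\<close> is a probability density: it is nonnegative because the weight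
    is bounded by \<open>C\<close>, and the hypothesis at l = 0 gives it mean 1. The other values of
    l say that reweighting by \<open>u\<close> leaves the characteristic function of
    \<open>X\<close> unchanged, so by Levy's uniqueness theorem \<open>X\<close> has the same law
    with and without the weight.\<close>
  define u where "u \<omega> = 1 + w \<omega> / C" for \<omega>
  have u[measurable]: "u \<in> borel_measurable M" unfolding u_def by measurable
  have u0: "0 \<le> u \<omega>" for \<omega> using bound[of \<omega>] C unfolding u_def by (simp add: field_simps abs_le_iff)
  have u2: "u \<omega> \<le> 2" for \<omega> using bound[of \<omega>] C unfolding u_def by (simp add: field_simps abs_le_iff)
  have int_w: "integrable M (\<lambda>\<omega>. w \<omega>)"
    by (rule integrable_const_bound[of _ C]) (use bound in auto)
  have int_u: "integrable M u"
    by (rule integrable_const_bound[of _ 2]) (use u0 u2 in \<open>auto simp: abs_le_iff\<close>)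
  have "complex_of_real (expectation w) = 0"
    using zero[of 0] by simp
  hence Ew: "expectation w = 0" by simp
  have Eu: "expectation u = 1"
    unfolding u_def using int_w Ew by (simp add: prob_space)
  define N1 where "N1 = distr (density M (\<lambda>\<omega>. ennreal (u \<omega>))) borel X"
  define N2 where "N2 = distr M borel X"
  have eu: "(\<integral>\<^sup>+\<omega>. ennreal (u \<omega>) \<partial>M) = 1"
    using nn_integral_eq_integral[OF int_u] u0 Eu by simp
  interpret D: prob_space "density M (\<lambda>\<omega>. ennreal (u \<omega>))"
    by standard (simp add: emeasure_density eu)
  have r1: "real_distribution N1"
    unfolding N1_def by (rule D.real_distribution_distr) simp
  have r2: "real_distribution N2"
    unfolding N2_def by (rule real_distribution_distr) simp
  have "char N1 l = char N2 l" for l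
  proof -
    have i1: "integrable M (\<lambda>\<omega>. of_real (w \<omega> / C) * iexp (l * X \<omega>))"
      by (rule integrable_const_bound[of _ 1])
        (use bound C in \<open>auto simp: norm_mult norm_divide field_simps\<close>)
    have i2: "integrable M (\<lambda>\<omega>. iexp (l * X \<omega>))"
      by (rule integrable_const_bound[of _ 1]) auto
    have "char N1 l = (CLINT \<omega>|M. u \<omega> *\<^sub>R iexp (l * X \<omega>))"
      unfolding N1_def char_def using u0 by (simp add: integral_distr integral_density)
    also have "\<dots> = (CLINT \<omega>|M. iexp (l * X \<omega>) + of_real (w \<omega> / C) * iexp (l * X \<omega>))"
      by (simp add: u_def scaleR_conv_of_real algebra_simps)
    also have "\<dots> = (CLINT \<omega>|M. iexp (l * X \<omega>)) + (CLINT \<omega>|M. of_real (w \<omega> / C) * iexp (l * X \<omega>))"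
      by (rule Bochner_Integration.integral_add[OF i2 i1])
    also have "(CLINT \<omega>|M. of_real (w \<omega> / C) * iexp (l * X \<omega>)) = 0"
    proof -
      have "(CLINT \<omega>|M. of_real (w \<omega> / C) * iexp (l * X \<omega>))
          = (CLINT \<omega>|M. inverse (of_real C) * (of_real (w \<omega>) * iexp (l * X \<omega>)))"
        by (simp add: field_simps)
      also have "\<dots> = inverse (of_real C) * (CLINT \<omega>|M. of_real (w \<omega>) * iexp (l * X \<omega>))"
        by (rule integral_mult_right_zero)
      finally show ?thesis by (simp only: zero mult_zero_right)
    qed
    finally show ?thesis unfolding N2_def char_def by (simp add: integral_distr)
  qed
  hence "N1 = N2" using Levy_uniqueness[OF r1 r2] by auto
  hence "(\<integral>x. indicator A x \<partial>N1) = (\<integral>x. (indicator A x :: real) \<partial>N2)" by simp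
  moreover have "(\<integral>x. indicator A x \<partial>N1) = (\<integral>\<omega>. u \<omega> * indicator A (X \<omega>) \<partial>M)"
    unfolding N1_def using u0 by (subst integral_distr) (simp_all add: integral_density)
  moreover have "(\<integral>x. indicator A x \<partial>N2) = (\<integral>\<omega>. (indicator A (X \<omega>) :: real) \<partial>M)"
    unfolding N2_def by (subst integral_distr) simp_all
  ultimately have "(\<integral>\<omega>. u \<omega> * indicator A (X \<omega>) \<partial>M) = (\<integral>\<omega>. indicator A (X \<omega>) \<partial>M)"
    by simp
  moreover have "(\<integral>\<omega>. u \<omega> * indicator A (X \<omega>) \<partial>M) =
      (\<integral>\<omega>. indicator A (X \<omega>) \<partial>M) + (\<integral>\<omega>. w \<omega> * indicator A (X \<omega>) \<partial>M) / C"
  proof -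
    have i1: "integrable M (\<lambda>\<omega>. w \<omega> * indicator A (X \<omega>) / C)"
      by (rule integrable_const_bound[of _ 1])
        (use bound C in \<open>auto simp: indicator_def field_simps\<close>)
    have i2: "integrable M (\<lambda>\<omega>. indicator A (X \<omega>) :: real)"
      by (rule integrable_const_bound[of _ 1]) auto
    have "(\<integral>\<omega>. u \<omega> * indicator A (X \<omega>) \<partial>M) =
        (\<integral>\<omega>. indicator A (X \<omega>) + w \<omega> * indicator A (X \<omega>) / C \<partial>M)"
      unfolding u_def by (simp add: algebra_simps)
    also have "\<dots> = (\<integral>\<omega>. indicator A (X \<omega>) \<partial>M) + (\<integral>\<omega>. w \<omega> * indicator A (X \<omega>) / C \<partial>M)"
      by (rule Bochner_Integration.integral_add[OF i2 i1])
    finally show ?thesis by simp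
  qed
  ultimately show ?thesis using C by simp
qed

text \<open>Conjugating the hypothesis at -l shows that the conjugate weight has zero transform as
  well. The real and imaginary parts are combinations of the two, and the real case applies to
  each.\<close>

lemma (in prob_space) complex_weight_zero_if_char_zero:
  fixes w :: "'a \<Rightarrow> complex" and X :: "'a \<Rightarrow> real"
  assumes w[measurable]: "w \<in> borel_measurable M" and X[measurable]: "X \<in> borel_measurable M"
    and bound: "\<And>\<omega>. cmod (w \<omega>) \<le> C" and C: "0 < C"
    and zero: "\<And>l::real. (CLINT \<omega>|M. w \<omega> * iexp (l * X \<omega>)) = 0"
    and A[measurable]: "A \<in> sets borel"
  shows "(CLINT \<omega>|M. w \<omega> * indicator A (X \<omega>)) = 0"
proof -
  have int: "integrable M (\<lambda>\<omega>. w \<omega> * iexp (l * X \<omega>))" for l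
    by (rule integrable_const_bound[of _ C]) (use bound in \<open>auto simp: norm_mult\<close>)
  have [measurable]: "(\<lambda>\<omega>. cnj (w \<omega>)) \<in> borel_measurable M"
    by (rule borel_measurable_continuous_on[OF _ w]) (intro continuous_intros)
  have intc: "integrable M (\<lambda>\<omega>. cnj (w \<omega>) * iexp (l * X \<omega>))" for l
    by (rule integrable_const_bound[of _ C]) (use bound in \<open>auto simp: norm_mult\<close>)
  have zc: "(CLINT \<omega>|M. cnj (w \<omega>) * iexp (l * X \<omega>)) = 0" for l
  proof -
    have "(CLINT \<omega>|M. cnj (w \<omega> * iexp ((-l) * X \<omega>))) = cnj (CLINT \<omega>|M. w \<omega> * iexp ((-l) * X \<omega>))"
      by (rule integral_bounded_linear[OF bounded_linear_cnj int])
    also have "\<dots> = 0" by (simp only: zero complex_cnj_zero)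
    also have "(\<lambda>\<omega>. cnj (w \<omega> * iexp ((-l) * X \<omega>))) = (\<lambda>\<omega>. cnj (w \<omega>) * iexp (l * X \<omega>))"
      by (simp add: exp_cnj)
    finally show ?thesis .
  qed
  have Re0: "expectation (\<lambda>\<omega>. Re (w \<omega>) * indicator A (X \<omega>)) = 0"
  proof (rule real_weight_zero_if_char_zero[OF _ X _ C _ A])
    show "\<bar>Re (w \<omega>)\<bar> \<le> C" for \<omega> using bound[of \<omega>] abs_Re_le_cmod[of "w \<omega>"] by linarith
    fix l :: real
    have "(CLINT \<omega>|M. of_real (Re (w \<omega>)) * iexp (l * X \<omega>)) =
      (CLINT \<omega>|M. (1/2) * (w \<omega> * iexp (l * X \<omega>) + cnj (w \<omega>) * iexp (l * X \<omega>)))"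
      unfolding distrib_right[symmetric] left_diff_distrib[symmetric] complex_add_cnj complex_diff_cnj
      by (rule Bochner_Integration.integral_cong) simp_all
    also have "\<dots> = 0"
      using zero zc int intc by (subst integral_mult_right_zero) (simp add: Bochner_Integration.integral_add)
    finally show "(CLINT \<omega>|M. of_real (Re (w \<omega>)) * iexp (l * X \<omega>)) = 0" .
  qed simp
  have Im0: "expectation (\<lambda>\<omega>. Im (w \<omega>) * indicator A (X \<omega>)) = 0"
  proof (rule real_weight_zero_if_char_zero[OF _ X _ C _ A])
    show "\<bar>Im (w \<omega>)\<bar> \<le> C" for \<omega> using bound[of \<omega>] abs_Im_le_cmod[of "w \<omega>"] by linarith
    fix l :: real
    have "(CLINT \<omega>|M. of_real (Im (w \<omega>)) * iexp (l * X \<omega>)) =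
      (CLINT \<omega>|M. (-\<i>/2) * (w \<omega> * iexp (l * X \<omega>) - cnj (w \<omega>) * iexp (l * X \<omega>)))"
      unfolding distrib_right[symmetric] left_diff_distrib[symmetric] complex_add_cnj complex_diff_cnj
      by (rule Bochner_Integration.integral_cong) (simp_all add: mult.left_commute)
    also have "\<dots> = 0"
      using zero zc int intc by (subst integral_mult_right_zero) (simp add: Bochner_Integration.integral_diff)
    finally show "(CLINT \<omega>|M. of_real (Im (w \<omega>)) * iexp (l * X \<omega>)) = 0" .
  qed simp
  have i: "integrable M (\<lambda>\<omega>. w \<omega> * indicator A (X \<omega>))"
    by (rule integrable_const_bound[of _ C])
      (use bound C in \<open>auto simp: norm_mult indicator_def less_imp_le\<close>)
  have "Re (CLINT \<omega>|M. w \<omega> * indicator A (X \<omega>)) = 0"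
  proof -
    have "(\<lambda>\<omega>. Re (w \<omega> * indicator A (X \<omega>))) = (\<lambda>\<omega>. Re (w \<omega>) * indicator A (X \<omega>))"
      by (auto simp: indicator_def)
    thus ?thesis using Re0 integral_Re[OF i] by simp
  qed
  moreover have "Im (CLINT \<omega>|M. w \<omega> * indicator A (X \<omega>)) = 0"
  proof -
    have "(\<lambda>\<omega>. Im (w \<omega> * indicator A (X \<omega>))) = (\<lambda>\<omega>. Im (w \<omega>) * indicator A (X \<omega>))"
      by (auto simp: indicator_def)
    thus ?thesis using Im0 integral_Im[OF i] by simp
  qed
  ultimately show ?thesis by (simp add: complex_eq_iff)
qed

text \<open>The exponentials are traded for indicators one index at a time. The fact
  \<open>key\<close> interpolates: indices in \<open>J\<close> already carry indicators, the others
  still carry exponentials. At \<open>J = I\<close> it is the product formula for events.\<close>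

lemma (in prob_space) indep_vars_if_char_factorizes:
  fixes X :: "'i \<Rightarrow> 'a \<Rightarrow> real"
  assumes fin: "finite I" and X: "\<And>i. i \<in> I \<Longrightarrow> X i \<in> borel_measurable M"
    and factor: "\<And>c :: 'i \<Rightarrow> real. (CLINT \<omega>|M. (\<Prod>i\<in>I. iexp (c i * X i \<omega>))) =
      (\<Prod>i\<in>I. (CLINT \<omega>|M. iexp (c i * X i \<omega>)))"
  shows "indep_vars (\<lambda>_. borel) X I"
proof (cases "I = {}")
  case True
  then show ?thesis by (simp add: indep_vars_def2 indep_sets_def)
next
  case False
  have key: "(CLINT \<omega>|M. (\<Prod>i\<in>J. indicator (A i) (X i \<omega>)) * (\<Prod>i\<in>I - J. iexp (c i * X i \<omega>))) =
      (\<Prod>i\<in>J. (CLINT \<omega>|M. indicator (A i) (X i \<omega>))) * (\<Prod>i\<in>I - J. (CLINT \<omega>|M. iexp (c i * X i \<omega>)))"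
    if "J \<subseteq> I" "\<And>i. i \<in> I \<Longrightarrow> A i \<in> sets borel" for J A and c :: "'i \<Rightarrow> real"
    using finite_subset[OF that(1) fin] that(1)
  \<comment> \<open>The coefficients stay arbitrary because the induction hypothesis is needed for
    every value l of the coefficient of the index j that moves into \<open>J\<close>. It then says
    that \<open>w - K\<close> has zero transform with respect to \<open>X j\<close>.\<close>
  proof (induction J arbitrary: c)
    case empty
    then show ?case using factor by simp
  next
    case (insert j J)
    define w where "w \<omega> = (\<Prod>i\<in>J. indicator (A i) (X i \<omega>)) * (\<Prod>i\<in>I - insert j J. iexp (c i * X i \<omega>))" for \<omega>
    define K where "K = (\<Prod>i\<in>J. (CLINT \<omega>|M. indicator (A i) (X i \<omega>))) *
      (\<Prod>i\<in>I - insert j J. (CLINT \<omega>|M. iexp (c i * X i \<omega>)))"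
    have jI: "j \<in> I" and JI: "J \<subseteq> I" and jJ: "j \<notin> J" using insert by auto
    note Xj[measurable] = X[OF jI]
    have Aj[measurable]: "A j \<in> sets borel" using that(2) jI by auto
    have w1[measurable]: "(\<lambda>\<omega>. (\<Prod>i\<in>J. indicator (A i) (X i \<omega>) :: complex)) \<in> borel_measurable M"
    proof (rule borel_measurable_prod)
      fix i assume "i \<in> J"
      with JI X that(2) have [measurable]: "X i \<in> borel_measurable M" "A i \<in> sets borel" by auto
      show "(\<lambda>\<omega>. indicator (A i) (X i \<omega>) :: complex) \<in> borel_measurable M" by measurable
    qed
    have w2[measurable]: "(\<lambda>\<omega>. (\<Prod>i\<in>I - insert j J. iexp (c i * X i \<omega>))) \<in> borel_measurable M"
    proof (rule borel_measurable_prod)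
      fix i assume "i \<in> I - insert j J"
      with X have [measurable]: "X i \<in> borel_measurable M" by auto
      show "(\<lambda>\<omega>. iexp (c i * X i \<omega>)) \<in> borel_measurable M" by measurable
    qed
    have w[measurable]: "w \<in> borel_measurable M" unfolding w_def by measurable
    have n1: "cmod (w \<omega>) \<le> 1" for \<omega>
    proof -
      have "cmod (\<Prod>i\<in>J. indicator (A i) (X i \<omega>)) \<le> 1"
        unfolding prod_norm[symmetric] by (rule prod_le_1) (auto simp: indicator_def)
      moreover have "cmod (\<Prod>i\<in>I - insert j J. iexp (c i * X i \<omega>)) = 1"
        unfolding prod_norm[symmetric] by (rule prod.neutral) auto
      ultimately show ?thesis unfolding w_def norm_mult by simp
    qed
    have intw: "integrable M (\<lambda>\<omega>. w \<omega> * iexp (l * X j \<omega>))" for l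
      by (rule integrable_const_bound[of _ 1]) (use n1 in \<open>auto simp: norm_mult\<close>)
    have inte: "integrable M (\<lambda>\<omega>. iexp (l * X j \<omega>))" for l
      by (rule integrable_const_bound[of _ 1]) auto
    have split: "I - J = insert j (I - insert j J)" using jI jJ by auto
    have "(CLINT \<omega>|M. (w \<omega> - K) * indicator (A j) (X j \<omega>)) = 0"
    proof (rule complex_weight_zero_if_char_zero[OF _ Xj _ _ _ Aj, of _ "1 + cmod K"])
      show "cmod (w \<omega> - K) \<le> 1 + cmod K" for \<omega>
        using norm_triangle_ineq4[of "w \<omega>" K] n1[of \<omega>] by linarith
      show "0 < 1 + cmod K" by (simp add: add_pos_nonneg)
      fix l :: real
      have "(CLINT \<omega>|M. w \<omega> * iexp (l * X j \<omega>)) =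
          (CLINT \<omega>|M. (\<Prod>i\<in>J. indicator (A i) (X i \<omega>)) * (\<Prod>i\<in>I - J. iexp ((c(j := l)) i * X i \<omega>)))"
        unfolding split w_def using fin
        by (intro Bochner_Integration.integral_cong)
          (auto simp: algebra_simps intro!: prod.cong)
      also have "\<dots> = (\<Prod>i\<in>J. (CLINT \<omega>|M. indicator (A i) (X i \<omega>))) *
          (\<Prod>i\<in>I - J. (CLINT \<omega>|M. iexp ((c(j := l)) i * X i \<omega>)))"
        by (rule insert.IH[OF JI])
      also have "(\<Prod>i\<in>I - J. (CLINT \<omega>|M. iexp ((c(j := l)) i * X i \<omega>))) =
          (CLINT \<omega>|M. iexp (l * X j \<omega>)) * (\<Prod>i\<in>I - insert j J. (CLINT \<omega>|M. iexp (c i * X i \<omega>)))"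
        unfolding split using fin by (subst prod.insert) (auto intro!: prod.cong)
      finally have "(CLINT \<omega>|M. w \<omega> * iexp (l * X j \<omega>)) = K * (CLINT \<omega>|M. iexp (l * X j \<omega>))"
        unfolding K_def by (simp add: algebra_simps)
      thus "(CLINT \<omega>|M. (w \<omega> - K) * iexp (l * X j \<omega>)) = 0"
        unfolding left_diff_distrib
        by (subst Bochner_Integration.integral_diff) (use intw inte in auto)
    qed measurable
    moreover have "integrable M (\<lambda>\<omega>. w \<omega> * indicator (A j) (X j \<omega>))"
      by (rule integrable_const_bound[of _ 1]) (use n1 in \<open>auto simp: norm_mult indicator_def\<close>)
    moreover have "integrable M (\<lambda>\<omega>. indicator (A j) (X j \<omega>) :: complex)"
      by (rule integrable_const_bound[of _ 1]) (auto simp: indicator_def)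
    ultimately have "(CLINT \<omega>|M. w \<omega> * indicator (A j) (X j \<omega>)) = K * (CLINT \<omega>|M. indicator (A j) (X j \<omega>))"
      unfolding left_diff_distrib by (subst (asm) Bochner_Integration.integral_diff) auto
    then show ?case
      unfolding w_def K_def using insert.hyps by (simp add: algebra_simps)
  qed
  have complex_ind: "(CLINT \<omega>|M. indicator S \<omega>) = complex_of_real (prob S)" if "S \<in> events" for S
  proof -
    have "(CLINT \<omega>|M. indicator S \<omega>) = (CLINT \<omega>|M. complex_of_real (indicator S \<omega>))"
      by (rule Bochner_Integration.integral_cong) (simp_all add: indicator_def)
    also have "\<dots> = complex_of_real (expectation (indicator S))"
      by (rule integral_complex_of_real)
    also have "expectation (indicator S) = prob S"
      using that by simp
    finally show ?thesis .
  qed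
  show ?thesis
    unfolding indep_vars_def2
  proof (intro conjI ballI)
    show "random_variable borel (X i)" if "i \<in> I" for i using X that by auto
    show "indep_sets (\<lambda>i. {X i -` A \<inter> space M |A. A \<in> sets borel}) I"
    \<comment> \<open>Each family contains the whole space, as the preimage of \<open>UNIV\<close>,
      so the product formula over the full index set yields the one over all subsets.\<close>
    proof (subst indep_sets_finite[OF False fin], goal_cases)
      case (1 i)
      then show ?case using X by (auto intro: measurable_sets)
    next
      case (2 i)
      show ?case by (auto intro!: exI[of _ UNIV])
    next
      case 3
      show ?case
      proof
        fix S assume "S \<in> (\<Pi> i\<in>I. {X i -` A \<inter> space M |A. A \<in> sets borel})"
        hence "\<forall>i\<in>I. \<exists>A. S i = X i -` A \<inter> space M \<and> A \<in> sets borel" by auto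
        then obtain A where A: "\<And>i. i \<in> I \<Longrightarrow> S i = X i -` A i \<inter> space M"
            "\<And>i. i \<in> I \<Longrightarrow> A i \<in> sets borel"
          by metis
        have ev: "S i \<in> events" if "i \<in> I" for i using A X that by (auto intro: measurable_sets)
        have inS: "(\<Inter>j\<in>I. S j) \<in> events" using ev False fin by auto
        have "complex_of_real (prob (\<Inter>j\<in>I. S j)) = (CLINT \<omega>|M. indicator (\<Inter>j\<in>I. S j) \<omega>)"
          using inS by (subst complex_ind) auto
        also have "\<dots> = (CLINT \<omega>|M. (\<Prod>i\<in>I. indicator (A i) (X i \<omega>)))"
        proof (rule Bochner_Integration.integral_cong[OF refl])
          fix \<omega> assume om: "\<omega> \<in> space M"
          show "indicator (\<Inter>j\<in>I. S j) \<omega> = (\<Prod>i\<in>I. indicator (A i) (X i \<omega>) :: complex)"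
          proof (cases "\<forall>i\<in>I. X i \<omega> \<in> A i")
            case True
            then show ?thesis using A om by simp
          next
            case f: False
            then obtain i where i: "i \<in> I" "X i \<omega> \<notin> A i" by auto
            hence "(\<Prod>i\<in>I. indicator (A i) (X i \<omega>) :: complex) = 0"
              using fin by (intro prod_zero) (auto simp: indicator_def)
            moreover have "\<omega> \<notin> (\<Inter>j\<in>I. S j)" using i A om by auto
            ultimately show ?thesis by simp
          qed
        qed
        also have "\<dots> = (\<Prod>i\<in>I. (CLINT \<omega>|M. indicator (A i) (X i \<omega>)))"
          using key[of I A] A(2) by simp
        also have "\<dots> = (\<Prod>i\<in>I. complex_of_real (prob (S i)))"
        proof (rule prod.cong[OF refl])
          fix i assume i: "i \<in> I"
          have "(CLINT \<omega>|M. indicator (A i) (X i \<omega>)) = (CLINT \<omega>|M. indicator (S i) \<omega>)"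
            using A(1)[OF i] by (intro Bochner_Integration.integral_cong) (auto simp: indicator_def)
          thus "(CLINT \<omega>|M. indicator (A i) (X i \<omega>)) = complex_of_real (prob (S i))"
            using complex_ind[OF ev[OF i]] by simp
        qed
        finally have "complex_of_real (prob (\<Inter>j\<in>I. S j)) = complex_of_real (\<Prod>i\<in>I. prob (S i))" by simp
        thus "prob (\<Inter>j\<in>I. S j) = (\<Prod>j\<in>I. prob (S j))" by (simp only: of_real_eq_iff)
      qed
    qed
  qed
qed

section \<open>Wiener integrals of step functions\<close>

lemma (in prob_space) char_normal_distributed:
  assumes X: "distributed M lborel X (normal_density 0 \<sigma>)" and s: "0 < \<sigma>"
  shows "(CLINT \<omega>|M. iexp (c * X \<omega>)) = of_real (exp (- (c * \<sigma>)\<^sup>2 / 2))"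
proof -
  have D: "distributed M lborel (\<lambda>\<omega>. X \<omega> / \<sigma>) std_normal_density"
    using X normal_standard_normal_convert[OF s, of X 0] by simp
  have Xm[measurable]: "X \<in> borel_measurable M"
    using distributed_measurable[OF X] by simp
  have "distr M lborel (\<lambda>\<omega>. X \<omega> / \<sigma>) = std_normal_distribution"
    using D by (rule distributed_distr_eq_density)
  hence "char (distr M lborel (\<lambda>\<omega>. X \<omega> / \<sigma>)) (c * \<sigma>) = of_real (exp (- ((c * \<sigma>)\<^sup>2) / 2))"
    using char_std_normal_distribution by metis
  moreover have "char (distr M lborel (\<lambda>\<omega>. X \<omega> / \<sigma>)) (c * \<sigma>) = (CLINT \<omega>|M. iexp (c * X \<omega>))"
    unfolding char_def using s by (subst integral_distr) simp_all
  ultimately show ?thesis by simp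
qed

lemma (in prob_space) square_normal_distributed:
  assumes X: "distributed M lborel X (normal_density 0 \<sigma>)" and s: "0 < \<sigma>"
  shows "integrable M (\<lambda>\<omega>. (X \<omega>)\<^sup>2)" and "expectation (\<lambda>\<omega>. (X \<omega>)\<^sup>2) = \<sigma>\<^sup>2"
proof -
  have "has_bochner_integral lborel (\<lambda>x. normal_density 0 \<sigma> x * x\<^sup>2) (\<sigma>\<^sup>2)"
    using normal_moment_even[OF s, of 0 1] by simp
  hence *: "integrable lborel (\<lambda>x. normal_density 0 \<sigma> x * x\<^sup>2)"
      "(\<integral>x. normal_density 0 \<sigma> x * x\<^sup>2 \<partial>lborel) = \<sigma>\<^sup>2"
    by (auto simp: has_bochner_integral_iff)
  show "integrable M (\<lambda>\<omega>. (X \<omega>)\<^sup>2)"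
    using *(1) by (subst distributed_integrable[OF X, symmetric]) auto
  show "expectation (\<lambda>\<omega>. (X \<omega>)\<^sup>2) = \<sigma>\<^sup>2"
    using *(2) by (subst distributed_integral[OF X, symmetric]) auto
qed

context brownian_motion
begin

lemma increment_measurable[measurable]:
  "s \<in> I \<Longrightarrow> t \<in> I \<Longrightarrow> (\<lambda>\<omega>. W t \<omega> - W s \<omega>) \<in> borel_measurable M"
  using rv by auto

lemma increment_square:
  assumes "s \<in> I" "t \<in> I"
  shows "integrable M (\<lambda>\<omega>. (W t \<omega> - W s \<omega>)\<^sup>2)"
    and "expectation (\<lambda>\<omega>. (W t \<omega> - W s \<omega>)\<^sup>2) = \<bar>t - s\<bar>"
proof -
  have "integrable M (\<lambda>\<omega>. (W t \<omega> - W s \<omega>)\<^sup>2) \<and> expectation (\<lambda>\<omega>. (W t \<omega> - W s \<omega>)\<^sup>2) = \<bar>t - s\<bar>"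
  proof (cases s t rule: linorder_cases)
    case less
    then show ?thesis
      using square_normal_distributed[OF increments_normal[OF assms less]] by simp
  next
    case equal
    then show ?thesis by simp
  next
    case greater
    then show ?thesis
      using square_normal_distributed[OF increments_normal[OF assms(2,1) greater]]
      by (simp add: power2_commute[of "W t _"])
  qed
  thus "integrable M (\<lambda>\<omega>. (W t \<omega> - W s \<omega>)\<^sup>2)"
    and "expectation (\<lambda>\<omega>. (W t \<omega> - W s \<omega>)\<^sup>2) = \<bar>t - s\<bar>" by auto
qed

text \<open>By polarization: \<open>2 (W b - W a) (W d - W c)\<close> is a combination of squared increments.\<close>

lemma increment_product:
  assumes "a \<in> I" "b \<in> I" "c \<in> I" "d \<in> I" "a \<le> b" "c \<le> d"
  shows "has_bochner_integral M (\<lambda>\<omega>. (W b \<omega> - W a \<omega>) * (W d \<omega> - W c \<omega>))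
    (LINT u|lborel. indicator {a<..b} u * indicator {c<..d} u)"
proof -
  let ?E = "\<lambda>\<omega>. ((W b \<omega> - W c \<omega>)\<^sup>2 + (W d \<omega> - W a \<omega>)\<^sup>2 - (W d \<omega> - W b \<omega>)\<^sup>2 - (W c \<omega> - W a \<omega>)\<^sup>2) / 2"
  have eq: "(W b \<omega> - W a \<omega>) * (W d \<omega> - W c \<omega>) = ?E \<omega>" for \<omega>
    by (simp add: power2_eq_square algebra_simps)
  have ind: "indicator {a<..b} u * indicator {c<..d} u = (indicator {max a c<..min b d} u :: real)" for u
    by (auto simp: indicator_def)
  have "(LINT u|lborel. indicator {a<..b} u * indicator {c<..d} u) = max 0 (min b d - max a c)"
    unfolding ind by (cases "max a c \<le> min b d") (auto simp del: max.bounded_iff min.bounded_iff)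
  \<comment> \<open>The overlap of two intervals is the polarized combination of distances, and a
    distance is the variance of an increment.\<close>
  also have "\<dots> = (\<bar>b - c\<bar> + \<bar>d - a\<bar> - \<bar>d - b\<bar> - \<bar>c - a\<bar>) / 2"
    using assms(5,6) by (auto simp: max_def min_def abs_if)
  also have "has_bochner_integral M ?E \<dots>"
    by (intro has_bochner_integral_divide_zero has_bochner_integral_add has_bochner_integral_diff)
      (auto simp: has_bochner_integral_iff increment_square assms)
  finally show ?thesis unfolding eq by simp
qed

definition steps_in :: "(real \<times> real \<times> real) list \<Rightarrow> bool"
  where "steps_in xs \<longleftrightarrow> (\<forall>(c, a, b)\<in>set xs. a \<in> I \<and> b \<in> I \<and> a \<le> b)"

lemma steps_in_simps[simp]:
  "steps_in []"
  "steps_in ((c, a, b) # xs) \<longleftrightarrow> a \<in> I \<and> b \<in> I \<and> a \<le> b \<and> steps_in xs"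
  "steps_in (xs @ ys) \<longleftrightarrow> steps_in xs \<and> steps_in ys"
  by (simp_all add: steps_in_def ball_Un)

end

lemma step_function_simps[simp]:
  "step_function [] u = 0"
  "step_function ((c, a, b) # xs) u = c * indicator {a<..b} u + step_function xs u"
  "step_function (xs @ ys) u = step_function xs u + step_function ys u"
  by (simp_all add: step_function_def)

lemma step_integral_simps[simp]:
  "step_integral W [] \<omega> = 0"
  "step_integral W ((c, a, b) # xs) \<omega> = c * (W b \<omega> - W a \<omega>) + step_integral W xs \<omega>"
  "step_integral W (xs @ ys) \<omega> = step_integral W xs \<omega> + step_integral W ys \<omega>"
  by (simp_all add: step_integral_def)

lemma step_function_measurable[measurable]: "step_function xs \<in> borel_measurable borel"
  unfolding step_function_def by (induction xs) (auto simp: case_prod_beta)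

definition scale_steps :: "real \<Rightarrow> (real \<times> real \<times> real) list \<Rightarrow> (real \<times> real \<times> real) list"
  where "scale_steps k xs = map (\<lambda>(c, a, b). (k * c, a, b)) xs"

lemma step_function_scale[simp]: "step_function (scale_steps k xs) u = k * step_function xs u"
  by (induction xs) (auto simp: scale_steps_def algebra_simps)

lemma step_integral_scale[simp]: "step_integral W (scale_steps k xs) \<omega> = k * step_integral W xs \<omega>"
  by (induction xs) (auto simp: scale_steps_def algebra_simps)

context brownian_motion
begin

lemma steps_in_scale[simp]: "steps_in xs \<Longrightarrow> steps_in (scale_steps k xs)"
  by (auto simp: scale_steps_def steps_in_def)

lemma step_integral_measurable[measurable]:
  "steps_in xs \<Longrightarrow> step_integral W xs \<in> borel_measurable M"
proof (induction xs)
  case Nil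
  then show ?case by (simp add: step_integral_def[abs_def])
next
  case (Cons x xs)
  obtain k a b where x: "x = (k, a, b)" by (cases x)
  have "(\<lambda>\<omega>. k * (W b \<omega> - W a \<omega>) + step_integral W xs \<omega>) \<in> borel_measurable M"
    using Cons x by (intro borel_measurable_add borel_measurable_times increment_measurable) auto
  thus ?case by (simp add: x cong: measurable_cong)
qed

text \<open>Integrability is carried along in the induction because it is what allows the integral
  of the sum to be split. Linearity in the other argument follows in
  \<open>step_integral_product\<close>.\<close>

lemma step_integral_increment_product:
  assumes "steps_in xs" "c \<in> I" "d \<in> I" "c \<le> d"
  shows "integrable lborel (\<lambda>u. step_function xs u * indicator {c<..d} u) \<and>
    has_bochner_integral M (\<lambda>\<omega>. step_integral W xs \<omega> * (W d \<omega> - W c \<omega>))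
      (LINT u|lborel. step_function xs u * indicator {c<..d} u)"
  using assms(1)
proof (induction xs)
  case Nil
  then show ?case by (simp add: has_bochner_integral_zero)
next
  case (Cons x xs)
  obtain k a b where x: "x = (k, a, b)" by (cases x)
  have *: "a \<in> I" "b \<in> I" "a \<le> b" "steps_in xs" using Cons.prems x by auto
  note IH = Cons.IH[OF *(4)]
  have i: "integrable lborel (\<lambda>u. indicator {a<..b} u * indicator {c<..d} u :: real)"
    unfolding indicator_inter_arith[symmetric]
  proof (rule integrable_real_indicator)
    have "bounded ({a<..b} \<inter> {c<..d})"
      by (rule bounded_subset[OF bounded_cbox[of a b]]) auto
    thus "emeasure lborel ({a<..b} \<inter> {c<..d}) < \<infinity>" by (rule emeasure_bounded_finite)
  qed simp
  have "has_bochner_integral M (\<lambda>\<omega>. k * ((W b \<omega> - W a \<omega>) * (W d \<omega> - W c \<omega>)) + step_integral W xs \<omega> * (W d \<omega> - W c \<omega>))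
    (k * (LINT u|lborel. indicator {a<..b} u * indicator {c<..d} u) + (LINT u|lborel. step_function xs u * indicator {c<..d} u))"
    using IH increment_product[OF *(1,2) assms(2,3) *(3) assms(4)]
    by (intro has_bochner_integral_add has_bochner_integral_mult_right) auto
  also have "(k * (LINT u|lborel. indicator {a<..b} u * indicator {c<..d} u) + (LINT u|lborel. step_function xs u * indicator {c<..d} u)) =
    (LINT u|lborel. k * (indicator {a<..b} u * indicator {c<..d} u) + step_function xs u * indicator {c<..d} u)"
    using IH i by simp
  finally show ?case using i IH by (simp add: x algebra_simps)
qed

lemma step_integral_product:
  assumes "steps_in xs" "steps_in ys"
  shows "integrable lborel (\<lambda>u. step_function xs u * step_function ys u) \<and>
    has_bochner_integral M (\<lambda>\<omega>. step_integral W xs \<omega> * step_integral W ys \<omega>)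
      (LINT u|lborel. step_function xs u * step_function ys u)"
  using assms(2)
proof (induction ys)
  case Nil
  then show ?case by (simp add: has_bochner_integral_zero)
next
  case (Cons x ys)
  obtain k a b where x: "x = (k, a, b)" by (cases x)
  have *: "a \<in> I" "b \<in> I" "a \<le> b" "steps_in ys" using Cons.prems x by auto
  note IH = Cons.IH[OF *(4)]
  note i = step_integral_increment_product[OF assms(1) *(1,2,3)]
  have "has_bochner_integral M (\<lambda>\<omega>. k * (step_integral W xs \<omega> * (W b \<omega> - W a \<omega>)) + step_integral W xs \<omega> * step_integral W ys \<omega>)
    (k * (LINT u|lborel. step_function xs u * indicator {a<..b} u) + (LINT u|lborel. step_function xs u * step_function ys u))"
    using IH i by (intro has_bochner_integral_add has_bochner_integral_mult_right) auto
  also have "(k * (LINT u|lborel. step_function xs u * indicator {a<..b} u) + (LINT u|lborel. step_function xs u * step_function ys u)) =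
    (LINT u|lborel. k * (step_function xs u * indicator {a<..b} u) + step_function xs u * step_function ys u)"
    using IH i by simp
  finally show ?case using i IH by (simp add: x algebra_simps)
qed

lemma step_isometry:
  assumes "steps_in xs"
  shows "integrable lborel (\<lambda>u. (step_function xs u)\<^sup>2)"
    and "integrable M (\<lambda>\<omega>. (step_integral W xs \<omega>)\<^sup>2)"
    and "expectation (\<lambda>\<omega>. (step_integral W xs \<omega>)\<^sup>2) = (LINT u|lborel. (step_function xs u)\<^sup>2)"
  using step_integral_product[OF assms assms]
  by (auto simp: power2_eq_square has_bochner_integral_iff)

lemma nn_step_isometry:
  assumes "steps_in xs"
  shows "(\<integral>\<^sup>+\<omega>. ennreal ((step_integral W xs \<omega>)\<^sup>2) \<partial>M) = (\<integral>\<^sup>+u. ennreal ((step_function xs u)\<^sup>2) \<partial>lborel)"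
  using step_isometry[OF assms] by (simp add: nn_integral_eq_integral)

text \<open>Over disjoint cells the increments are independent Gaussians, so the characteristic
  function is a product and the variances add. Writing the variance as an expectation removes the
  grid from the right-hand side; the isometry can then turn it into an integral of the step
  function.\<close>

lemma grid_step_char:
  fixes c :: "nat \<Rightarrow> real"
  assumes t: "\<And>i. i \<le> n \<Longrightarrow> \<tau> i \<in> I" "\<And>i. i < n \<Longrightarrow> \<tau> i < \<tau> (Suc i)"
  defines "S \<equiv> \<lambda>\<omega>. \<Sum>i<n. c i * (W (\<tau> (Suc i)) \<omega> - W (\<tau> i) \<omega>)"
  shows "(CLINT \<omega>|M. iexp (S \<omega>)) = of_real (exp (- expectation (\<lambda>\<omega>. (S \<omega>)\<^sup>2) / 2))"
proof -
  let ?D = "\<lambda>i \<omega>. W (\<tau> (Suc i)) \<omega> - W (\<tau> i) \<omega>"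
  let ?v = "\<lambda>i. \<tau> (Suc i) - \<tau> i"
  have ind: "indep_vars (\<lambda>_. borel) ?D {..<n}"
    by (rule increments_indep) (use t in auto)
  have tI: "\<tau> i \<in> I" "\<tau> (Suc i) \<in> I" if "i < n" for i using t(1) that by auto
  have mono: "\<tau> i \<le> \<tau> j" if "i \<le> j" "j \<le> n" for i j
    using that
  proof (induction j rule: dec_induct)
    case (step m)
    thus ?case using t(2)[of m] by simp
  qed simp
  have cov: "has_bochner_integral M (\<lambda>\<omega>. ?D i \<omega> * ?D j \<omega>) (if i = j then ?v i else 0)"
    if "i < n" "j < n" for i j
  proof -
    have a: "\<tau> i < \<tau> (Suc i)" "\<tau> j < \<tau> (Suc j)" using t(2) that by auto
    have "indicator {\<tau> i<..\<tau> (Suc i)} u * indicator {\<tau> j<..\<tau> (Suc j)} u =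
        (if i = j then indicator {\<tau> i<..\<tau> (Suc i)} u else 0 :: real)" for u
    proof (cases i j rule: linorder_cases)
      case less
      with mono[of "Suc i" j] that show ?thesis by (auto simp: indicator_def)
    next
      case greater
      with mono[of "Suc j" i] that show ?thesis by (auto simp: indicator_def)
    qed (auto simp: indicator_def)
    hence "(LINT u|lborel. indicator {\<tau> i<..\<tau> (Suc i)} u * indicator {\<tau> j<..\<tau> (Suc j)} u) =
        (if i = j then ?v i else 0)"
      using a by simp
    with increment_product[OF tI[OF that(1)] tI[OF that(2)]] a show ?thesis by simp
  qed
  have "has_bochner_integral M (\<lambda>\<omega>. \<Sum>i<n. \<Sum>j<n. c i * c j * (?D i \<omega> * ?D j \<omega>))
      (\<Sum>i<n. \<Sum>j<n. c i * c j * (if i = j then ?v i else 0))"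
    by (intro has_bochner_integral_sum has_bochner_integral_mult_right cov) auto
  moreover have "(\<Sum>i<n. \<Sum>j<n. c i * c j * (if i = j then ?v i else 0)) = (\<Sum>i<n. (c i)\<^sup>2 * ?v i)"
    by (intro sum.cong refl) (simp add: power2_eq_square if_distrib[of "\<lambda>x. _ * x"] sum.delta cong: if_cong)
  moreover have "(\<Sum>i<n. \<Sum>j<n. c i * c j * (?D i \<omega> * ?D j \<omega>)) = (S \<omega>)\<^sup>2" for \<omega>
    unfolding S_def power2_eq_square sum_product by (simp add: algebra_simps)
  ultimately have var: "expectation (\<lambda>\<omega>. (S \<omega>)\<^sup>2) = (\<Sum>i<n. (c i)\<^sup>2 * ?v i)"
    by (simp add: has_bochner_integral_iff)
  have "(CLINT \<omega>|M. iexp (S \<omega>)) = (CLINT \<omega>|M. (\<Prod>i<n. iexp (c i * ?D i \<omega>)))"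
    unfolding S_def by (simp add: exp_sum[symmetric] sum_distrib_left)
  also have "\<dots> = (\<Prod>i<n. (CLINT \<omega>|M. iexp (c i * ?D i \<omega>)))"
  proof (cases "n = 0")
    case True then show ?thesis by (simp add: prob_space)
  next
    case False
    have "indep_vars (\<lambda>_. borel) (\<lambda>i \<omega>. iexp (c i * ?D i \<omega>)) {..<n}"
      by (rule indep_vars_compose2[OF ind, where Y = "\<lambda>i x. iexp (c i * x)"]) measurable
    moreover have "integrable M (\<lambda>\<omega>. iexp (c i * ?D i \<omega>))" if "i < n" for i
    proof -
      note [measurable] = rv[OF tI(1)[OF that]] rv[OF tI(2)[OF that]]
      show ?thesis by (rule integrable_const_bound[of _ 1]) auto
    qed
    ultimately show ?thesis by (intro indep_vars_lebesgue_integral) auto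
  qed
  also have "\<dots> = (\<Prod>i<n. of_real (exp (- ((c i)\<^sup>2 * ?v i) / 2)))"
  proof (rule prod.cong[OF refl])
    fix i assume "i \<in> {..<n}"
    hence i: "i < n" by simp
    have "(CLINT \<omega>|M. iexp (c i * ?D i \<omega>)) = of_real (exp (- (c i * sqrt (?v i))\<^sup>2 / 2))"
      by (rule char_normal_distributed[OF increments_normal]) (use tI[OF i] t(2)[OF i] in auto)
    thus "(CLINT \<omega>|M. iexp (c i * ?D i \<omega>)) = of_real (exp (- ((c i)\<^sup>2 * ?v i) / 2))"
      using t(2)[OF i] by (simp add: power_mult_distrib)
  qed
  also have "\<dots> = of_real (exp (- expectation (\<lambda>\<omega>. (S \<omega>)\<^sup>2) / 2))"
    unfolding var of_real_prod[symmetric] exp_sum[OF finite_lessThan, symmetric]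
    by (simp add: sum_negf sum_divide_distrib)
  finally show ?thesis .
qed

text \<open>The intervals in \<open>xs\<close> may overlap, so their increments need not be
  independent; a grid through all endpoints makes the step function constant on each cell. Cells are
  open on the left, hence the value on a cell is read off at its right endpoint.\<close>

lemma step_integral_grid:
  assumes mono: "\<And>i. i < n \<Longrightarrow> \<tau> i < \<tau> (Suc i)"
    and ends: "\<And>c a b. (c, a, b) \<in> set xs \<Longrightarrow> a \<le> b \<and> a \<in> \<tau> ` {..n} \<and> b \<in> \<tau> ` {..n}"
  shows "step_integral W xs \<omega> = (\<Sum>i<n. step_function xs (\<tau> (Suc i)) * (W (\<tau> (Suc i)) \<omega> - W (\<tau> i) \<omega>))"
  using ends
proof (induction xs)
  case Nil
  then show ?case by simp
next
  case (Cons x xs)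
  obtain k a b where x: "x = (k, a, b)" by (cases x)
  from Cons.prems[of k a b] x obtain i j where ij: "a = \<tau> i" "b = \<tau> j" "i \<le> n" "j \<le> n" "a \<le> b" by auto
  have smono: "\<tau> i < \<tau> j" if "i < j" "j \<le> n" for i j
    using that
  proof (induction j)
    case (Suc m)
    thus ?case using mono[of m] by (cases "i = m") auto
  qed simp
  have le_iff: "\<tau> i \<le> \<tau> j \<longleftrightarrow> i \<le> j" if "i \<le> n" "j \<le> n" for i j
    using smono[of i j] smono[of j i] that by (cases i j rule: linorder_cases) auto
  have ijle: "i \<le> j" using ij le_iff by auto
  have ind: "indicator {a<..b} (\<tau> (Suc m)) = (if m \<in> {i..<j} then 1 else 0 :: real)" if "m < n" for m
    using le_iff[of "Suc m" i] le_iff[of "Suc m" j] that ij by (auto simp: indicator_def)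
  have "(\<Sum>m<n. indicator {a<..b} (\<tau> (Suc m)) * (W (\<tau> (Suc m)) \<omega> - W (\<tau> m) \<omega>)) =
      (\<Sum>m<n. if m \<in> {i..<j} then W (\<tau> (Suc m)) \<omega> - W (\<tau> m) \<omega> else 0)"
    by (intro sum.cong) (auto simp: ind)
  also have "\<dots> = (\<Sum>m\<in>{..<n} \<inter> {i..<j}. W (\<tau> (Suc m)) \<omega> - W (\<tau> m) \<omega>)"
    by (simp add: sum.inter_restrict)
  also have "{..<n} \<inter> {i..<j} = {i..<j}" using ij by auto
  also have "(\<Sum>m\<in>{i..<j}. W (\<tau> (Suc m)) \<omega> - W (\<tau> m) \<omega>) = W b \<omega> - W a \<omega>"
    using sum_Suc_diff'[OF ijle, of "\<lambda>m. W (\<tau> m) \<omega>"] ij by simp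
  finally have "W b \<omega> - W a \<omega> = (\<Sum>m<n. indicator {a<..b} (\<tau> (Suc m)) * (W (\<tau> (Suc m)) \<omega> - W (\<tau> m) \<omega>))" ..
  moreover have "step_integral W xs \<omega> = (\<Sum>i<n. step_function xs (\<tau> (Suc i)) * (W (\<tau> (Suc i)) \<omega> - W (\<tau> i) \<omega>))"
    by (rule Cons.IH) (use Cons.prems in auto)
  ultimately show ?case
    by (simp add: x sum_distrib_left sum.distrib[symmetric] algebra_simps)
qed

lemma step_integral_char:
  assumes "steps_in xs"
  shows "(CLINT \<omega>|M. iexp (step_integral W xs \<omega>)) = of_real (exp (- (LINT u|lborel. (step_function xs u)\<^sup>2) / 2))"
proof (cases "xs = []")
  case True
  then show ?thesis by (simp add: prob_space)
next
  case False
  define F where "F = (\<lambda>(c, a, b). a) ` set xs \<union> (\<lambda>(c, a, b). b) ` set xs"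
  define L where "L = sorted_list_of_set F"
  \<comment> \<open>\<open>n\<close> counts cells, one less than grid points. The empty list has
    been split off so that there is at least one point.\<close>
  define n where "n = length L - 1"
  define \<tau> where "\<tau> i = L ! i" for i
  have fin: "finite F" unfolding F_def by auto
  have "F \<noteq> {}" using False unfolding F_def by auto
  hence lenL: "length L = Suc n" unfolding n_def L_def using fin by (simp add: card_gt_0_iff)
  have setL: "set L = F" unfolding L_def using fin by simp
  have sd: "sorted_wrt (<) L" unfolding L_def by (simp add: strict_sorted_list_of_set)
  have im: "\<tau> ` {..n} = F"
    using setL lenL unfolding \<tau>_def by (auto simp: set_conv_nth image_def)
  have FI: "F \<subseteq> I" using assms unfolding F_def steps_in_def by auto
  have m: "\<tau> i < \<tau> (Suc i)" if "i < n" for i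
    unfolding \<tau>_def using sd lenL that by (intro sorted_wrt_nth_less[of "(<)"]) auto
  have eq: "step_integral W xs \<omega> = (\<Sum>i<n. step_function xs (\<tau> (Suc i)) * (W (\<tau> (Suc i)) \<omega> - W (\<tau> i) \<omega>))" for \<omega>
  proof (rule step_integral_grid)
    show "\<tau> i < \<tau> (Suc i)" if "i < n" for i by (rule m[OF that])
  next
    fix c a b assume "(c, a, b) \<in> set xs"
    thus "a \<le> b \<and> a \<in> \<tau> ` {..n} \<and> b \<in> \<tau> ` {..n}"
      using assms unfolding im F_def steps_in_def by force
  qed
  have "(CLINT \<omega>|M. iexp (step_integral W xs \<omega>)) = of_real (exp (- expectation (\<lambda>\<omega>. (step_integral W xs \<omega>)\<^sup>2) / 2))"
    unfolding eq by (rule grid_step_char) (use m FI im in auto)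
  thus ?thesis using step_isometry[OF assms] by simp
qed

end

section \<open>Wiener integrals\<close>

text \<open>\<open>C e\<close> may blow up as e tends to 0: for fixed e the second term dies out,
  and only then is e made small. Together with the weighted bound 2ab <= e a^2 + b^2 / e this does
  the work of the Cauchy-Schwarz inequality in the limits below.\<close>

lemma tendsto_zero_if_small_plus_null:
  fixes x d :: "nat \<Rightarrow> real"
  assumes d: "d \<longlonglongrightarrow> 0" and K: "0 \<le> K"
    and bound: "\<And>e. 0 < e \<Longrightarrow> eventually (\<lambda>n. \<bar>x n\<bar> \<le> e * K + C e * d n) sequentially"
  shows "x \<longlonglongrightarrow> 0"
proof (rule LIMSEQ_I)
  fix r :: real assume r: "0 < r"
  define e where "e = r / (2 * (K + 1))"
  have e: "0 < e" using r K unfolding e_def by simp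
  have eK: "e * K < r / 2"
    using r K unfolding e_def by (simp add: field_simps)
  have "(\<lambda>n. C e * d n) \<longlonglongrightarrow> 0" using tendsto_mult_left[OF d, of "C e"] by simp
  hence "eventually (\<lambda>n. C e * d n < r / 2) sequentially"
    by (rule order_tendstoD) (use r in simp)
  with bound[OF e] have "eventually (\<lambda>n. \<bar>x n\<bar> < r) sequentially"
    by eventually_elim (use eK in linarith)
  thus "\<exists>no. \<forall>n\<ge>no. norm (x n - 0) < r" by (simp add: eventually_sequentially)
qed

text \<open>Finitely many of the \<open>ennreal\<close> distances may be infinite, so integrability
  holds only eventually.\<close>

lemma integral_square_tendsto_zero:
  fixes h :: "nat \<Rightarrow> 'b \<Rightarrow> real"
  assumes h: "\<And>n. h n \<in> borel_measurable N"
    and lim: "(\<lambda>n. \<integral>\<^sup>+x. ennreal ((h n x)\<^sup>2) \<partial>N) \<longlonglongrightarrow> 0"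
  shows "eventually (\<lambda>n. integrable N (\<lambda>x. (h n x)\<^sup>2)) sequentially"
    and "(\<lambda>n. \<integral>x. (h n x)\<^sup>2 \<partial>N) \<longlonglongrightarrow> 0"
proof -
  have "eventually (\<lambda>n. (\<integral>\<^sup>+x. ennreal ((h n x)\<^sup>2) \<partial>N) < 1) sequentially"
    using lim by (rule order_tendstoD) simp
  thus *: "eventually (\<lambda>n. integrable N (\<lambda>x. (h n x)\<^sup>2)) sequentially"
  proof eventually_elim
    case (elim n)
    note [measurable] = h
    from elim have "(\<integral>\<^sup>+x. ennreal ((h n x)\<^sup>2) \<partial>N) < \<infinity>"
      using order.strict_trans by fastforce
    thus ?case by (intro integrableI_bounded) auto
  qed
  have "(\<lambda>n. enn2real (\<integral>\<^sup>+x. ennreal ((h n x)\<^sup>2) \<partial>N)) \<longlonglongrightarrow> 0"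
    using lim by (intro tendsto_enn2real) auto
  moreover have "enn2real (\<integral>\<^sup>+x. ennreal ((h n x)\<^sup>2) \<partial>N) = (\<integral>x. (h n x)\<^sup>2 \<partial>N)" for n
    using h by (subst integral_eq_nn_integral) auto
  ultimately show "(\<lambda>n. \<integral>x. (h n x)\<^sup>2 \<partial>N) \<longlonglongrightarrow> 0" by simp
qed

text \<open>Write g = f - (f - g) and bound the cross term by 2ab <= e a^2 + b^2 / e.\<close>

lemma square_diff_bound:
  fixes f g e :: real
  assumes "0 < e"
  shows "\<bar>g\<^sup>2 - f\<^sup>2\<bar> \<le> e * f\<^sup>2 + (1 + 1 / e) * (f - g)\<^sup>2"
proof -
  have "0 \<le> (sqrt e * \<bar>f\<bar> - \<bar>f - g\<bar> / sqrt e)\<^sup>2" by simp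
  also have "\<dots> = e * f\<^sup>2 + (f - g)\<^sup>2 / e - 2 * \<bar>f * (f - g)\<bar>"
    using assms by (simp add: power2_diff power_mult_distrib power_divide abs_mult)
  finally have 1: "2 * \<bar>f * (f - g)\<bar> \<le> e * f\<^sup>2 + (f - g)\<^sup>2 / e" by simp
  have "g\<^sup>2 - f\<^sup>2 = (f - g)\<^sup>2 - 2 * (f * (f - g))" by (simp add: power2_eq_square algebra_simps)
  hence "\<bar>g\<^sup>2 - f\<^sup>2\<bar> \<le> (f - g)\<^sup>2 + 2 * \<bar>f * (f - g)\<bar>"
    using abs_triangle_ineq4[of "(f - g)\<^sup>2" "2 * (f * (f - g))"] by (simp add: abs_mult)
  with 1 show ?thesis by (simp add: algebra_simps)
qed

lemma integral_square_tendsto: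
  fixes f :: "'b \<Rightarrow> real" and g :: "nat \<Rightarrow> 'b \<Rightarrow> real"
  assumes f[measurable]: "f \<in> borel_measurable N" and g[measurable]: "\<And>n. g n \<in> borel_measurable N"
    and int: "\<And>n. integrable N (\<lambda>x. (g n x)\<^sup>2)"
    and lim: "(\<lambda>n. \<integral>\<^sup>+x. ennreal ((f x - g n x)\<^sup>2) \<partial>N) \<longlonglongrightarrow> 0"
  shows "integrable N (\<lambda>x. (f x)\<^sup>2)" and "(\<lambda>n. \<integral>x. (g n x)\<^sup>2 \<partial>N) \<longlonglongrightarrow> (\<integral>x. (f x)\<^sup>2 \<partial>N)"
proof -
  have m: "(\<lambda>x. f x - g n x) \<in> borel_measurable N" for n by simp
  note Z = integral_square_tendsto_zero[OF m lim]
  obtain n where n: "integrable N (\<lambda>x. (f x - g n x)\<^sup>2)"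
    using Z(1) by (metis (no_types, lifting) eventually_sequentially order_refl)
  show fint: "integrable N (\<lambda>x. (f x)\<^sup>2)"
  proof (rule Bochner_Integration.integrable_bound)
    show "integrable N (\<lambda>x. 2 * (f x - g n x)\<^sup>2 + 2 * (g n x)\<^sup>2)" using n int by auto
    have "(f x)\<^sup>2 \<le> 2 * (f x - g n x)\<^sup>2 + 2 * (g n x)\<^sup>2" for x
      using zero_le_power2[of "f x - 2 * g n x"] by (simp add: power2_eq_square algebra_simps)
    thus "AE x in N. norm ((f x)\<^sup>2) \<le> norm (2 * (f x - g n x)\<^sup>2 + 2 * (g n x)\<^sup>2)" by simp
  qed simp
  have "(\<lambda>n. (\<integral>x. (g n x)\<^sup>2 \<partial>N) - (\<integral>x. (f x)\<^sup>2 \<partial>N)) \<longlonglongrightarrow> 0"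
  proof (rule tendsto_zero_if_small_plus_null[OF Z(2), where K = "\<integral>x. (f x)\<^sup>2 \<partial>N" and C = "\<lambda>e. 1 + 1 / e"])
    fix e :: real assume e: "0 < e"
    from Z(1) show "eventually (\<lambda>n. \<bar>(\<integral>x. (g n x)\<^sup>2 \<partial>N) - (\<integral>x. (f x)\<^sup>2 \<partial>N)\<bar>
      \<le> e * (\<integral>x. (f x)\<^sup>2 \<partial>N) + (1 + 1 / e) * (\<integral>x. (f x - g n x)\<^sup>2 \<partial>N)) sequentially"
    proof eventually_elim
      case (elim n)
      have "\<bar>(\<integral>x. (g n x)\<^sup>2 \<partial>N) - (\<integral>x. (f x)\<^sup>2 \<partial>N)\<bar> = \<bar>\<integral>x. (g n x)\<^sup>2 - (f x)\<^sup>2 \<partial>N\<bar>"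
        using int fint by simp
      also have "\<dots> \<le> (\<integral>x. \<bar>(g n x)\<^sup>2 - (f x)\<^sup>2\<bar> \<partial>N)" by (rule integral_abs_bound)
      also have "\<dots> \<le> (\<integral>x. e * (f x)\<^sup>2 + (1 + 1 / e) * (f x - g n x)\<^sup>2 \<partial>N)"
        by (rule integral_mono) (use int fint elim square_diff_bound[OF e] in auto)
      also have "\<dots> = e * (\<integral>x. (f x)\<^sup>2 \<partial>N) + (1 + 1 / e) * (\<integral>x. (f x - g n x)\<^sup>2 \<partial>N)"
        using fint elim by simp
      finally show ?case .
    qed
  qed simp
  thus "(\<lambda>n. \<integral>x. (g n x)\<^sup>2 \<partial>N) \<longlonglongrightarrow> (\<integral>x. (f x)\<^sup>2 \<partial>N)"
    by (simp add: LIM_zero_iff)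
qed

lemma integrable_mult_if_squares:
  fixes f g :: "'b \<Rightarrow> real"
  assumes [measurable]: "f \<in> borel_measurable N" "g \<in> borel_measurable N"
    and f: "integrable N (\<lambda>x. (f x)\<^sup>2)" and g: "integrable N (\<lambda>x. (g x)\<^sup>2)"
  shows "integrable N (\<lambda>x. f x * g x)"
proof (rule Bochner_Integration.integrable_bound)
  show "integrable N (\<lambda>x. (f x)\<^sup>2 + (g x)\<^sup>2)" using f g by auto
  have "\<bar>f x * g x\<bar> \<le> (f x)\<^sup>2 + (g x)\<^sup>2" for x
  proof -
    have "0 \<le> (\<bar>f x\<bar> - \<bar>g x\<bar>)\<^sup>2" by simp
    hence "2 * (\<bar>f x\<bar> * \<bar>g x\<bar>) \<le> (f x)\<^sup>2 + (g x)\<^sup>2" by (simp add: power2_diff)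
    moreover have "0 \<le> \<bar>f x\<bar> * \<bar>g x\<bar>" by simp
    ultimately show ?thesis unfolding abs_mult by linarith
  qed
  thus "AE x in N. norm (f x * g x) \<le> norm ((f x)\<^sup>2 + (g x)\<^sup>2)" by simp
qed simp

lemma nn_integral_square_add_le:
  fixes f g :: "'b \<Rightarrow> real"
  assumes [measurable]: "f \<in> borel_measurable N" "g \<in> borel_measurable N"
  shows "(\<integral>\<^sup>+x. ennreal ((f x + g x)\<^sup>2) \<partial>N) \<le>
    2 * (\<integral>\<^sup>+x. ennreal ((f x)\<^sup>2) \<partial>N) + 2 * (\<integral>\<^sup>+x. ennreal ((g x)\<^sup>2) \<partial>N)"
proof -
  have "(a + b)\<^sup>2 \<le> 2 * a\<^sup>2 + 2 * b\<^sup>2" for a b :: real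
    using zero_le_power2[of "a - b"] by (simp add: power2_eq_square algebra_simps)
  hence "ennreal ((f x + g x)\<^sup>2) \<le> 2 * ennreal ((f x)\<^sup>2) + 2 * ennreal ((g x)\<^sup>2)" for x
    by (simp add: ennreal_mult'[symmetric] ennreal_plus[symmetric] ennreal_leI
        flip: ennreal_numeral del: ennreal_plus)
  hence "(\<integral>\<^sup>+x. ennreal ((f x + g x)\<^sup>2) \<partial>N) \<le> (\<integral>\<^sup>+x. 2 * ennreal ((f x)\<^sup>2) + 2 * ennreal ((g x)\<^sup>2) \<partial>N)"
    by (intro nn_integral_mono) auto
  thus ?thesis by (simp add: nn_integral_add nn_integral_cmult)
qed

lemma nn_integral_square_lincomb_tendsto_zero:
  fixes f g :: "nat \<Rightarrow> 'b \<Rightarrow> real"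
  assumes [measurable]: "\<And>n. f n \<in> borel_measurable N" "\<And>n. g n \<in> borel_measurable N"
    and f: "(\<lambda>n. \<integral>\<^sup>+x. ennreal ((f n x)\<^sup>2) \<partial>N) \<longlonglongrightarrow> 0"
    and g: "(\<lambda>n. \<integral>\<^sup>+x. ennreal ((g n x)\<^sup>2) \<partial>N) \<longlonglongrightarrow> 0"
  shows "(\<lambda>n. \<integral>\<^sup>+x. ennreal ((a * f n x + b * g n x)\<^sup>2) \<partial>N) \<longlonglongrightarrow> 0"
proof (rule tendsto_sandwich[OF _ _ tendsto_const])
  have "(\<integral>\<^sup>+x. ennreal ((a * f n x + b * g n x)\<^sup>2) \<partial>N) \<le>
      2 * (ennreal (a\<^sup>2) * (\<integral>\<^sup>+x. ennreal ((f n x)\<^sup>2) \<partial>N)) + 2 * (ennreal (b\<^sup>2) * (\<integral>\<^sup>+x. ennreal ((g n x)\<^sup>2) \<partial>N))" for n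
    using nn_integral_square_add_le[of "\<lambda>x. a * f n x" N "\<lambda>x. b * g n x"]
    by (simp add: power_mult_distrib ennreal_mult' nn_integral_cmult)
  thus "\<forall>\<^sub>F n in sequentially. (\<integral>\<^sup>+x. ennreal ((a * f n x + b * g n x)\<^sup>2) \<partial>N) \<le>
      2 * (ennreal (a\<^sup>2) * (\<integral>\<^sup>+x. ennreal ((f n x)\<^sup>2) \<partial>N)) + 2 * (ennreal (b\<^sup>2) * (\<integral>\<^sup>+x. ennreal ((g n x)\<^sup>2) \<partial>N))"
    by simp
  have "(\<lambda>n. 2 * (ennreal (a\<^sup>2) * (\<integral>\<^sup>+x. ennreal ((f n x)\<^sup>2) \<partial>N)) + 2 * (ennreal (b\<^sup>2) * (\<integral>\<^sup>+x. ennreal ((g n x)\<^sup>2) \<partial>N)))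
    \<longlonglongrightarrow> 2 * (ennreal (a\<^sup>2) * 0) + 2 * (ennreal (b\<^sup>2) * 0)"
    by (intro tendsto_add ennreal_tendsto_cmult f g) (auto simp: ennreal_mult_less_top)
  thus "(\<lambda>n. 2 * (ennreal (a\<^sup>2) * (\<integral>\<^sup>+x. ennreal ((f n x)\<^sup>2) \<partial>N)) + 2 * (ennreal (b\<^sup>2) * (\<integral>\<^sup>+x. ennreal ((g n x)\<^sup>2) \<partial>N)))
    \<longlonglongrightarrow> 0" by simp
qed simp

section \<open>Wiener integrals with integrands on the whole line\<close>

context brownian_motion
begin

text \<open>Integrands live on the whole line (extended by \<open>0\<close> outside \<open>I\<close>), so that Wiener integrals
  over different intervals can be added.\<close>

definition full_wiener_integral :: "(real \<Rightarrow> real) \<Rightarrow> ('a \<Rightarrow> real) \<Rightarrow> bool"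
  where "full_wiener_integral f X \<longleftrightarrow> f \<in> borel_measurable lebesgue \<and> X \<in> borel_measurable M \<and>
    (\<exists>\<phi>. (\<forall>n. steps_in (\<phi> n)) \<and>
      (\<lambda>n. \<integral>\<^sup>+u. ennreal ((f u - step_function (\<phi> n) u)\<^sup>2) \<partial>lebesgue) \<longlonglongrightarrow> 0 \<and>
      (\<lambda>n. \<integral>\<^sup>+\<omega>. ennreal ((X \<omega> - step_integral W (\<phi> n) \<omega>)\<^sup>2) \<partial>M) \<longlonglongrightarrow> 0)"

lemma full_wiener_integral_measurable:
  "full_wiener_integral f X \<Longrightarrow> f \<in> borel_measurable lebesgue"
  "full_wiener_integral f X \<Longrightarrow> X \<in> borel_measurable M"
  by (simp_all add: full_wiener_integral_def)

lemma step_function_lebesgue_measurable[measurable]: "step_function xs \<in> borel_measurable lebesgue"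
  by (rule measurable_completion) simp

text \<open>A step with both endpoints in the interval \<open>A\<close> vanishes off
  \<open>A\<close>, so extending \<open>f\<close> by zero leaves its distance to every approximating
  step function unchanged.\<close>

lemma full_wiener_integral_of_wiener_integral:
  assumes X: "is_wiener_integral M W A f X" and AI: "A \<subseteq> I" and A: "is_interval A"
  shows "full_wiener_integral (\<lambda>u. indicator A u * f u) X"
proof -
  obtain \<phi> where f: "f \<in> borel_measurable (lebesgue_on A)" and Xm: "X \<in> borel_measurable M"
    and \<phi>: "\<And>n c a b. (c, a, b) \<in> set (\<phi> n) \<Longrightarrow> a \<in> A \<and> b \<in> A \<and> a \<le> b"
    and f_lim: "(\<lambda>n. \<integral>\<^sup>+u. ennreal ((f u - step_function (\<phi> n) u)\<^sup>2) \<partial>lebesgue_on A) \<longlonglongrightarrow> 0"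
    and X_lim: "(\<lambda>n. \<integral>\<^sup>+\<omega>. ennreal ((X \<omega> - step_integral W (\<phi> n) \<omega>)\<^sup>2) \<partial>M) \<longlonglongrightarrow> 0"
    using X unfolding is_wiener_integral_def by fast
  have Am: "A \<in> sets lebesgue"
    using real_interval_borel_measurable[OF A] by auto
  have steps: "steps_in (\<phi> n)" for n using \<phi> AI unfolding steps_in_def by fast
  have out: "step_function xs u = 0"
    if "u \<notin> A" "\<And>c a b. (c, a, b) \<in> set xs \<Longrightarrow> a \<in> A \<and> b \<in> A \<and> a \<le> b" for u xs
    using that(2)
  proof (induction xs)
    case (Cons x xs)
    obtain c a b where x: "x = (c, a, b)" by (cases x)
    have "a \<in> A" "b \<in> A" using Cons.prems[of c a b] x by auto
    hence "u \<notin> {a<..b}" using A that(1) unfolding is_interval_1 by fastforce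
    moreover have "step_function xs u = 0" by (rule Cons.IH) (use Cons.prems in auto)
    ultimately show ?case using x by simp
  qed simp
  have "ennreal ((indicator A u * f u - step_function (\<phi> n) u)\<^sup>2) =
      ennreal ((f u - step_function (\<phi> n) u)\<^sup>2) * indicator A u" for n u
    using out[of u "\<phi> n"] \<phi> by (cases "u \<in> A") auto
  hence "(\<integral>\<^sup>+u. ennreal ((indicator A u * f u - step_function (\<phi> n) u)\<^sup>2) \<partial>lebesgue) =
      (\<integral>\<^sup>+u. ennreal ((f u - step_function (\<phi> n) u)\<^sup>2) \<partial>lebesgue_on A)" for n
    using Am by (simp add: nn_integral_restrict_space)
  moreover have "(\<lambda>u. indicator A u * f u) \<in> borel_measurable lebesgue"
    using f Am by (subst (asm) borel_measurable_restrict_space_iff) auto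
  ultimately show ?thesis
    unfolding full_wiener_integral_def using Xm steps f_lim X_lim by (intro conjI exI[of _ \<phi>]) auto
qed

lemma full_wiener_integral_isometry:
  assumes "full_wiener_integral f X"
  shows "integrable lebesgue (\<lambda>u. (f u)\<^sup>2)" and "integrable M (\<lambda>\<omega>. (X \<omega>)\<^sup>2)"
    and "expectation (\<lambda>\<omega>. (X \<omega>)\<^sup>2) = (LINT u|lebesgue. (f u)\<^sup>2)"
proof -
  obtain \<phi> where [measurable]: "f \<in> borel_measurable lebesgue" "X \<in> borel_measurable M"
    and steps: "\<And>n. steps_in (\<phi> n)"
    and f_lim: "(\<lambda>n. \<integral>\<^sup>+u. ennreal ((f u - step_function (\<phi> n) u)\<^sup>2) \<partial>lebesgue) \<longlonglongrightarrow> 0"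
    and X_lim: "(\<lambda>n. \<integral>\<^sup>+\<omega>. ennreal ((X \<omega> - step_integral W (\<phi> n) \<omega>)\<^sup>2) \<partial>M) \<longlonglongrightarrow> 0"
    using assms unfolding full_wiener_integral_def by auto
  note iso = step_isometry[OF steps]
  have sm: "step_integral W (\<phi> n) \<in> borel_measurable M" for n using steps by measurable
  have il: "integrable lebesgue (\<lambda>u. (step_function (\<phi> n) u)\<^sup>2)" for n
    using iso(1) by (subst integrable_completion) auto
  have eq: "(LINT u|lebesgue. (step_function (\<phi> n) u)\<^sup>2) = expectation (\<lambda>\<omega>. (step_integral W (\<phi> n) \<omega>)\<^sup>2)" for n
    using iso(3) by (subst integral_completion) auto
  note F = integral_square_tendsto[OF _ _ il f_lim, simplified]
  note X = integral_square_tendsto[OF _ sm iso(2) X_lim, simplified]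
  show "integrable lebesgue (\<lambda>u. (f u)\<^sup>2)" "integrable M (\<lambda>\<omega>. (X \<omega>)\<^sup>2)" using F X by auto
  show "expectation (\<lambda>\<omega>. (X \<omega>)\<^sup>2) = (LINT u|lebesgue. (f u)\<^sup>2)"
    using F(2) X(2) unfolding eq by (intro LIMSEQ_unique[OF X(2)]) auto
qed

lemma full_wiener_integral_lincomb:
  assumes X: "full_wiener_integral f X" and Y: "full_wiener_integral g Y"
  shows "full_wiener_integral (\<lambda>u. a * f u + b * g u) (\<lambda>\<omega>. a * X \<omega> + b * Y \<omega>)"
proof -
  obtain \<phi> where [measurable]: "f \<in> borel_measurable lebesgue" "X \<in> borel_measurable M"
    and steps: "\<And>n. steps_in (\<phi> n)"
    and f_lim: "(\<lambda>n. \<integral>\<^sup>+u. ennreal ((f u - step_function (\<phi> n) u)\<^sup>2) \<partial>lebesgue) \<longlonglongrightarrow> 0"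
    and X_lim: "(\<lambda>n. \<integral>\<^sup>+\<omega>. ennreal ((X \<omega> - step_integral W (\<phi> n) \<omega>)\<^sup>2) \<partial>M) \<longlonglongrightarrow> 0"
    using X unfolding full_wiener_integral_def by auto
  obtain \<psi> where [measurable]: "g \<in> borel_measurable lebesgue" "Y \<in> borel_measurable M"
    and steps': "\<And>n. steps_in (\<psi> n)"
    and g_lim: "(\<lambda>n. \<integral>\<^sup>+u. ennreal ((g u - step_function (\<psi> n) u)\<^sup>2) \<partial>lebesgue) \<longlonglongrightarrow> 0"
    and Y_lim: "(\<lambda>n. \<integral>\<^sup>+\<omega>. ennreal ((Y \<omega> - step_integral W (\<psi> n) \<omega>)\<^sup>2) \<partial>M) \<longlonglongrightarrow> 0"
    using Y unfolding full_wiener_integral_def by auto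
  have [measurable]: "step_integral W (\<phi> n) \<in> borel_measurable M" "step_integral W (\<psi> n) \<in> borel_measurable M" for n
    using steps steps' by auto
  define \<theta> where "\<theta> n = scale_steps a (\<phi> n) @ scale_steps b (\<psi> n)" for n
  have "steps_in (\<theta> n)" for n using steps steps' by (simp add: \<theta>_def)
  moreover have "(\<lambda>n. \<integral>\<^sup>+u. ennreal ((a * f u + b * g u - step_function (\<theta> n) u)\<^sup>2) \<partial>lebesgue) \<longlonglongrightarrow> 0"
    using nn_integral_square_lincomb_tendsto_zero[OF _ _ f_lim g_lim, of a b]
    by (simp add: \<theta>_def algebra_simps)
  moreover have "(\<lambda>n. \<integral>\<^sup>+\<omega>. ennreal ((a * X \<omega> + b * Y \<omega> - step_integral W (\<theta> n) \<omega>)\<^sup>2) \<partial>M) \<longlonglongrightarrow> 0"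
    using nn_integral_square_lincomb_tendsto_zero[OF _ _ X_lim Y_lim, of a b]
    by (simp add: \<theta>_def algebra_simps)
  ultimately show ?thesis unfolding full_wiener_integral_def by auto
qed

lemma full_wiener_integral_zero: "full_wiener_integral (\<lambda>u. 0) (\<lambda>\<omega>. 0)"
  unfolding full_wiener_integral_def by (auto intro!: exI[of _ "\<lambda>n. []"])

lemma full_wiener_integral_sum:
  assumes "finite J" "\<And>i. i \<in> J \<Longrightarrow> full_wiener_integral (f i) (X i)"
  shows "full_wiener_integral (\<lambda>u. \<Sum>i\<in>J. c i * f i u) (\<lambda>\<omega>. \<Sum>i\<in>J. c i * X i \<omega>)"
  using assms
proof (induction J)
  case empty
  then show ?case by (simp add: full_wiener_integral_zero)
next
  case (insert i J)
  then show ?case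
    using full_wiener_integral_lincomb[of "f i" "X i" "\<lambda>u. \<Sum>i\<in>J. c i * f i u" "\<lambda>\<omega>. \<Sum>i\<in>J. c i * X i \<omega>" "c i" 1]
    by simp
qed

text \<open>The difference is a Wiener integral of a null function, so its second moment is 0 by the
  isometry.\<close>

lemma full_wiener_integral_unique:
  assumes X: "full_wiener_integral f X" and Y: "full_wiener_integral g Y" and fg: "AE u in lebesgue. f u = g u"
  shows "AE \<omega> in M. X \<omega> = Y \<omega>"
proof -
  note D = full_wiener_integral_lincomb[OF X Y, of 1 "-1"]
  note [measurable] = full_wiener_integral_measurable[OF X] full_wiener_integral_measurable[OF Y]
  have "(LINT u|lebesgue. (1 * f u + -1 * g u)\<^sup>2) = 0"
  proof (rule integral_eq_zero_AE)
    show "AE u in lebesgue. (1 * f u + -1 * g u)\<^sup>2 = 0" using fg by eventually_elim simp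
  qed
  hence "expectation (\<lambda>\<omega>. (1 * X \<omega> + -1 * Y \<omega>)\<^sup>2) = 0"
    using full_wiener_integral_isometry(3)[OF D] by simp
  hence "AE \<omega> in M. (1 * X \<omega> + -1 * Y \<omega>)\<^sup>2 = 0"
    using full_wiener_integral_isometry(2)[OF D] by (subst (asm) integral_nonneg_eq_0_iff_AE) auto
  thus ?thesis by eventually_elim simp
qed

lemma full_wiener_integral_char:
  assumes "full_wiener_integral f X"
  shows "(CLINT \<omega>|M. iexp (X \<omega>)) = of_real (exp (- (LINT u|lebesgue. (f u)\<^sup>2) / 2))"
proof -
  obtain \<phi> where [measurable]: "f \<in> borel_measurable lebesgue" "X \<in> borel_measurable M"
    and steps: "\<And>n. steps_in (\<phi> n)"
    and f_lim: "(\<lambda>n. \<integral>\<^sup>+u. ennreal ((f u - step_function (\<phi> n) u)\<^sup>2) \<partial>lebesgue) \<longlonglongrightarrow> 0"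
    and X_lim: "(\<lambda>n. \<integral>\<^sup>+\<omega>. ennreal ((X \<omega> - step_integral W (\<phi> n) \<omega>)\<^sup>2) \<partial>M) \<longlonglongrightarrow> 0"
    using assms unfolding full_wiener_integral_def by auto
  let ?S = "\<lambda>n. step_integral W (\<phi> n)"
  have [measurable]: "?S n \<in> borel_measurable M" for n using steps by auto
  have il: "integrable lebesgue (\<lambda>u. (step_function (\<phi> n) u)\<^sup>2)" for n
    using step_isometry(1)[OF steps] by (subst integrable_completion) auto
  have "(LINT u|lebesgue. (step_function (\<phi> n) u)\<^sup>2) = (LINT u|lborel. (step_function (\<phi> n) u)\<^sup>2)" for n
    by (subst integral_completion) auto
  with integral_square_tendsto(2)[OF _ _ il f_lim]
  have "(\<lambda>n. LINT u|lborel. (step_function (\<phi> n) u)\<^sup>2) \<longlonglongrightarrow> (LINT u|lebesgue. (f u)\<^sup>2)" by simp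
  hence lim1: "(\<lambda>n. CLINT \<omega>|M. iexp (?S n \<omega>)) \<longlonglongrightarrow> of_real (exp (- (LINT u|lebesgue. (f u)\<^sup>2) / 2))"
    unfolding step_integral_char[OF steps] by (intro tendsto_intros) auto
  have Xm: "(\<lambda>\<omega>. X \<omega> - ?S n \<omega>) \<in> borel_measurable M" for n by simp
  note Z = integral_square_tendsto_zero[OF Xm X_lim]
  have ie: "integrable M (\<lambda>\<omega>. iexp (Y \<omega>))" if "Y \<in> borel_measurable M" for Y :: "'a \<Rightarrow> real"
    using that by (intro integrable_const_bound[of _ 1]) auto
  have "(\<lambda>n. cmod ((CLINT \<omega>|M. iexp (?S n \<omega>)) - (CLINT \<omega>|M. iexp (X \<omega>)))) \<longlonglongrightarrow> 0"
  proof (rule tendsto_zero_if_small_plus_null[OF Z(2), where K = 1 and C = "\<lambda>e. 1 / e"])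
    fix e :: real assume e: "0 < e"
    from Z(1) show "eventually (\<lambda>n. \<bar>cmod ((CLINT \<omega>|M. iexp (?S n \<omega>)) - (CLINT \<omega>|M. iexp (X \<omega>)))\<bar>
      \<le> e * 1 + 1 / e * expectation (\<lambda>\<omega>. (X \<omega> - ?S n \<omega>)\<^sup>2)) sequentially"
    proof eventually_elim
      case (elim n)
      \<comment> \<open>The complex exponential is 1-Lipschitz on the imaginary axis, and |x| <= e +
        x^2 / e turns this into a bound by the squared distance, whose mean is known to
        vanish.\<close>
      have pt: "cmod (iexp (?S n \<omega>) - iexp (X \<omega>)) \<le> e + 1 / e * (X \<omega> - ?S n \<omega>)\<^sup>2" for \<omega>
      proof -
        have "iexp (?S n \<omega>) - iexp (X \<omega>) = iexp (X \<omega>) * (iexp (?S n \<omega> - X \<omega>) - 1)"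
          by (simp add: algebra_simps exp_diff exp_minus field_simps)
        hence "cmod (iexp (?S n \<omega>) - iexp (X \<omega>)) = cmod (iexp (?S n \<omega> - X \<omega>) - 1)"
          by (simp add: norm_mult del: of_real_diff)
        also have "\<dots> \<le> \<bar>?S n \<omega> - X \<omega>\<bar>"
          using iexp_approx1[of "?S n \<omega> - X \<omega>" 0] by simp
        also have "\<dots> \<le> e + 1 / e * (?S n \<omega> - X \<omega>)\<^sup>2"
        proof -
          let ?a = "\<bar>?S n \<omega> - X \<omega>\<bar>"
          have "0 \<le> (e - ?a)\<^sup>2" by simp
          hence "2 * e * ?a \<le> e\<^sup>2 + ?a\<^sup>2" by (simp add: power2_diff)
          moreover have "0 \<le> e * ?a" using e by simp
          ultimately have "e * ?a \<le> e\<^sup>2 + ?a\<^sup>2" by linarith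
          thus ?thesis using e by (simp add: field_simps power2_eq_square)
        qed
        finally show ?thesis by (simp add: power2_commute)
      qed
      have "cmod ((CLINT \<omega>|M. iexp (?S n \<omega>)) - (CLINT \<omega>|M. iexp (X \<omega>))) = cmod (CLINT \<omega>|M. iexp (?S n \<omega>) - iexp (X \<omega>))"
        by (subst Bochner_Integration.integral_diff) (auto intro!: ie)
      also have "\<dots> \<le> expectation (\<lambda>\<omega>. cmod (iexp (?S n \<omega>) - iexp (X \<omega>)))"
        by (rule integral_norm_bound)
      also have "\<dots> \<le> expectation (\<lambda>\<omega>. e + 1 / e * (X \<omega> - ?S n \<omega>)\<^sup>2)"
        by (rule integral_mono) (use pt elim in \<open>auto intro!: ie integrable_norm Bochner_Integration.integrable_diff\<close>)
      also have "\<dots> = e * 1 + 1 / e * expectation (\<lambda>\<omega>. (X \<omega> - ?S n \<omega>)\<^sup>2)"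
        using elim by (simp add: prob_space)
      finally show ?case by simp
    qed
  qed simp
  hence "(\<lambda>n. (CLINT \<omega>|M. iexp (?S n \<omega>)) - (CLINT \<omega>|M. iexp (X \<omega>))) \<longlonglongrightarrow> 0"
    by (rule tendsto_norm_zero_cancel)
  hence "(\<lambda>n. CLINT \<omega>|M. iexp (?S n \<omega>)) \<longlonglongrightarrow> (CLINT \<omega>|M. iexp (X \<omega>))"
    by (simp add: LIM_zero_iff)
  with lim1 show ?thesis using LIMSEQ_unique by blast
qed

lemma full_wiener_integral_normal:
  assumes X: "full_wiener_integral f X" and v: "(LINT u|lebesgue. (f u)\<^sup>2) = \<sigma>\<^sup>2" and s: "0 < \<sigma>"
  shows "distributed M lborel X (normal_density 0 \<sigma>)"
proof -
  note [measurable] = full_wiener_integral_measurable[OF X]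
  have "char (distr M borel (\<lambda>\<omega>. X \<omega> / \<sigma>)) t = char std_normal_distribution t" for t
  proof -
    have "full_wiener_integral (\<lambda>u. t / \<sigma> * f u) (\<lambda>\<omega>. t / \<sigma> * X \<omega>)"
      using full_wiener_integral_lincomb[OF X X, of "t / \<sigma>" 0] by simp
    note c = full_wiener_integral_char[OF this]
    have "(LINT u|lebesgue. (t / \<sigma> * f u)\<^sup>2) = t\<^sup>2"
      using v s by (simp add: power_mult_distrib power_divide)
    with c show ?thesis
      unfolding char_std_normal_distribution char_def by (subst integral_distr) simp_all
  qed
  hence "distr M borel (\<lambda>\<omega>. X \<omega> / \<sigma>) = std_normal_distribution"
    using real_distribution_distr real_dist_normal_dist by (intro Levy_uniqueness) auto
  moreover have "distr M lborel (\<lambda>\<omega>. X \<omega> / \<sigma>) = distr M borel (\<lambda>\<omega>. X \<omega> / \<sigma>)"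
    by (rule distr_cong) auto
  ultimately have "distributed M lborel (\<lambda>\<omega>. (X \<omega> - 0) / \<sigma>) std_normal_density"
    unfolding distributed_def by simp
  thus ?thesis using normal_standard_normal_convert[OF s, of X 0] by simp
qed

text \<open>The characteristic function of a linear combination depends only on the L2 norm of the
  combined integrand. Orthogonality removes the cross terms of this norm, and the exponential of the
  remaining sum is a product.\<close>

lemma full_wiener_integral_indep:
  assumes J: "finite J" and X: "\<And>i. i \<in> J \<Longrightarrow> full_wiener_integral (f i) (X i)"
    and orth: "\<And>i j. i \<in> J \<Longrightarrow> j \<in> J \<Longrightarrow> i \<noteq> j \<Longrightarrow> (LINT u|lebesgue. f i u * f j u) = 0"
  shows "indep_vars (\<lambda>_. borel) X J"
proof (rule indep_vars_if_char_factorizes[OF J])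
  show "X i \<in> borel_measurable M" if "i \<in> J" for i using full_wiener_integral_measurable X that by blast
  fix c :: "_ \<Rightarrow> real"
  have sq: "integrable lebesgue (\<lambda>u. (f i u)\<^sup>2)" if "i \<in> J" for i
    using full_wiener_integral_isometry X that by blast
  have cross: "integrable lebesgue (\<lambda>u. f i u * f j u)" if "i \<in> J" "j \<in> J" for i j
    using that by (intro integrable_mult_if_squares sq full_wiener_integral_measurable(1)[OF X])
  have "(LINT u|lebesgue. (\<Sum>i\<in>J. c i * f i u)\<^sup>2) = (LINT u|lebesgue. (\<Sum>i\<in>J. \<Sum>j\<in>J. c i * c j * (f i u * f j u)))"
    unfolding power2_eq_square sum_product by (simp add: algebra_simps)
  also have "\<dots> = (\<Sum>i\<in>J. \<Sum>j\<in>J. c i * c j * (LINT u|lebesgue. f i u * f j u))"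
    using cross by (subst Bochner_Integration.integral_sum; (intro sum.cong refl Bochner_Integration.integrable_sum)?;
      (subst Bochner_Integration.integral_sum)?) auto
  also have "\<dots> = (\<Sum>i\<in>J. \<Sum>j\<in>J. if i = j then (c i)\<^sup>2 * (LINT u|lebesgue. (f i u)\<^sup>2) else 0)"
    by (intro sum.cong refl) (use orth in \<open>auto simp: power2_eq_square\<close>)
  also have "\<dots> = (\<Sum>i\<in>J. (c i)\<^sup>2 * (LINT u|lebesgue. (f i u)\<^sup>2))"
    using J by simp
  finally have var: "(LINT u|lebesgue. (\<Sum>i\<in>J. c i * f i u)\<^sup>2) = (\<Sum>i\<in>J. (c i)\<^sup>2 * (LINT u|lebesgue. (f i u)\<^sup>2))" .
  have "(CLINT \<omega>|M. (\<Prod>i\<in>J. iexp (c i * X i \<omega>))) = (CLINT \<omega>|M. iexp (\<Sum>i\<in>J. c i * X i \<omega>))"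
    using J by (simp add: exp_sum[symmetric] sum_distrib_left)
  also have "\<dots> = of_real (exp (- (\<Sum>i\<in>J. (c i)\<^sup>2 * (LINT u|lebesgue. (f i u)\<^sup>2)) / 2))"
    using full_wiener_integral_char[OF full_wiener_integral_sum[of J f X c, OF J X]] unfolding var by simp
  also have "\<dots> = (\<Prod>i\<in>J. of_real (exp (- ((c i)\<^sup>2 * (LINT u|lebesgue. (f i u)\<^sup>2)) / 2)))"
    unfolding of_real_prod[symmetric] exp_sum[OF J, symmetric]
    by (simp add: sum_negf sum_divide_distrib)
  also have "\<dots> = (\<Prod>i\<in>J. (CLINT \<omega>|M. iexp (c i * X i \<omega>)))"
  proof (rule prod.cong[OF refl])
    fix i assume "i \<in> J"
    hence "full_wiener_integral (\<lambda>u. c i * f i u) (\<lambda>\<omega>. c i * X i \<omega>)"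
      using full_wiener_integral_lincomb[OF X X, of i i "c i" 0] by simp
    from full_wiener_integral_char[OF this]
    show "of_real (exp (- ((c i)\<^sup>2 * (LINT u|lebesgue. (f i u)\<^sup>2)) / 2)) = (CLINT \<omega>|M. iexp (c i * X i \<omega>))"
      by (simp add: power_mult_distrib)
  qed
  finally show "(CLINT \<omega>|M. (\<Prod>i\<in>J. iexp (c i * X i \<omega>))) = (\<Prod>i\<in>J. (CLINT \<omega>|M. iexp (c i * X i \<omega>)))" .
qed

text \<open>By the isometry the mean square distance of the m-th and n-th step integrals is at most
  2 D(m) + 2 D(n), where D is the distance of the integrands from \<open>f\<close>; Fatou's lemma in
  m then bounds the distance from \<open>X\<close>. This is how an explicit functional of paths is
  recognized as a Wiener integral.\<close>

lemma step_integral_L2_limit: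
  assumes f[measurable]: "f \<in> borel_measurable lebesgue" and X[measurable]: "X \<in> borel_measurable M"
    and steps: "\<And>n. steps_in (\<phi> n)"
    and f_lim: "(\<lambda>n. \<integral>\<^sup>+u. ennreal ((f u - step_function (\<phi> n) u)\<^sup>2) \<partial>lebesgue) \<longlonglongrightarrow> 0"
    and path: "AE \<omega> in M. (\<lambda>n. step_integral W (\<phi> n) \<omega>) \<longlonglongrightarrow> X \<omega>"
  shows "(\<lambda>n. \<integral>\<^sup>+\<omega>. ennreal ((X \<omega> - step_integral W (\<phi> n) \<omega>)\<^sup>2) \<partial>M) \<longlonglongrightarrow> 0"
proof (rule tendsto_sandwich[OF _ _ tendsto_const])
  let ?D = "\<lambda>n. \<integral>\<^sup>+u. ennreal ((f u - step_function (\<phi> n) u)\<^sup>2) \<partial>lebesgue"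
  let ?S = "\<lambda>n. step_integral W (\<phi> n)"
  have [measurable]: "?S n \<in> borel_measurable M" for n using steps by auto
  have "(\<integral>\<^sup>+\<omega>. ennreal ((X \<omega> - ?S n \<omega>)\<^sup>2) \<partial>M) \<le> 2 * ?D n" for n
  proof -
    have diff: "(\<integral>\<^sup>+\<omega>. ennreal ((?S m \<omega> - ?S n \<omega>)\<^sup>2) \<partial>M) \<le> 2 * ?D m + 2 * ?D n" for m
    proof -
      have "(\<integral>\<^sup>+\<omega>. ennreal ((?S m \<omega> - ?S n \<omega>)\<^sup>2) \<partial>M) =
          (\<integral>\<^sup>+u. ennreal ((step_function (\<phi> m) u - step_function (\<phi> n) u)\<^sup>2) \<partial>lebesgue)"
        using nn_step_isometry[of "\<phi> m @ scale_steps (-1) (\<phi> n)"] steps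
        by (simp add: nn_integral_completion)
      also have "\<dots> = (\<integral>\<^sup>+u. ennreal (((step_function (\<phi> m) u - f u) + (f u - step_function (\<phi> n) u))\<^sup>2) \<partial>lebesgue)"
        by simp
      also have "\<dots> \<le> 2 * (\<integral>\<^sup>+u. ennreal ((step_function (\<phi> m) u - f u)\<^sup>2) \<partial>lebesgue) + 2 * ?D n"
        by (rule nn_integral_square_add_le) simp_all
      also have "(\<integral>\<^sup>+u. ennreal ((step_function (\<phi> m) u - f u)\<^sup>2) \<partial>lebesgue) = ?D m"
        by (simp add: power2_commute)
      finally show ?thesis .
    qed
    have "(\<integral>\<^sup>+\<omega>. ennreal ((X \<omega> - ?S n \<omega>)\<^sup>2) \<partial>M) = (\<integral>\<^sup>+\<omega>. liminf (\<lambda>m. ennreal ((?S m \<omega> - ?S n \<omega>)\<^sup>2)) \<partial>M)"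
    proof (rule nn_integral_cong_AE, use path in eventually_elim)
      case (elim \<omega>)
      hence "(\<lambda>m. ennreal ((?S m \<omega> - ?S n \<omega>)\<^sup>2)) \<longlonglongrightarrow> ennreal ((X \<omega> - ?S n \<omega>)\<^sup>2)"
        by (intro tendsto_ennrealI tendsto_intros)
      from lim_imp_Liminf[OF trivial_limit_sequentially this] show ?case by simp
    qed
    also have "\<dots> \<le> liminf (\<lambda>m. \<integral>\<^sup>+\<omega>. ennreal ((?S m \<omega> - ?S n \<omega>)\<^sup>2) \<partial>M)"
      by (rule nn_integral_liminf) simp
    also have "\<dots> \<le> liminf (\<lambda>m. 2 * ?D m + 2 * ?D n)"
      by (rule Liminf_mono) (simp add: diff)
    also have "\<dots> = 2 * 0 + 2 * ?D n"
    proof (rule lim_imp_Liminf)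
      show "(\<lambda>m. 2 * ?D m + 2 * ?D n) \<longlonglongrightarrow> 2 * 0 + 2 * ?D n"
        by (intro tendsto_add ennreal_tendsto_cmult f_lim tendsto_const) simp_all
    qed simp
    finally show ?thesis by simp
  qed
  thus "\<forall>\<^sub>F n in sequentially. (\<integral>\<^sup>+\<omega>. ennreal ((X \<omega> - ?S n \<omega>)\<^sup>2) \<partial>M) \<le> 2 * ?D n" by simp
  have "(\<lambda>n. 2 * ?D n) \<longlonglongrightarrow> 2 * 0" by (intro ennreal_tendsto_cmult f_lim) simp
  thus "(\<lambda>n. 2 * ?D n) \<longlonglongrightarrow> 0" by simp
qed simp

end

section \<open>Integration by parts\<close>

text \<open>On each cell the error is the integral of f'(u) times the difference between g at the
  right endpoint and g(u), which is small by uniform continuity. Right endpoints are used because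
  summation by parts of left-endpoint sums produces them.\<close>

lemma Riemann_Stieltjes_sum_tendsto:
  fixes f g :: "real \<Rightarrow> real"
  assumes t: "0 \<le> t"
    and f: "\<And>u. u \<in> {0..t} \<Longrightarrow> (f has_real_derivative f' u) (at u within {0..t})"
    and f': "continuous_on {0..t} f'" and g: "continuous_on {0..t} g"
  shows "(\<lambda>n. \<Sum>i<Suc n. g (t * real (Suc i) / real (Suc n)) *
      (f (t * real (Suc i) / real (Suc n)) - f (t * real i / real (Suc n))))
    \<longlonglongrightarrow> integral {0..t} (\<lambda>u. f' u * g u)"
proof (rule LIMSEQ_I)
  fix r :: real assume r: "0 < r"
  have "compact (f' ` {0..t})" using f' by (intro compact_continuous_image) auto
  then obtain C where "\<forall>x\<in>f' ` {0..t}. norm x \<le> C"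
    using compact_imp_bounded bounded_iff by metis
  hence C: "\<And>u. u \<in> {0..t} \<Longrightarrow> \<bar>f' u\<bar> \<le> C" by simp
  have C0: "0 \<le> C" using C[of 0] t by auto
  \<comment> \<open>The summand 1 keeps the denominator positive when C t = 0.\<close>
  define e where "e = r / (2 * (C * t + 1))"
  have e: "0 < e" using r C0 t unfolding e_def by (simp add: add_nonneg_pos)
  have eC: "e * C * t < r"
  proof -
    have "0 \<le> C * t" using C0 t by simp
    hence "e * C * t \<le> r / 2" "0 < r / 2" using r unfolding e_def by (simp_all add: field_simps)
    thus ?thesis using r by linarith
  qed
  have "uniformly_continuous_on {0..t} g" using g by (intro compact_uniformly_continuous) auto
  then obtain d where d: "0 < d"
    and gd: "\<And>x y. x \<in> {0..t} \<Longrightarrow> y \<in> {0..t} \<Longrightarrow> \<bar>y - x\<bar> < d \<Longrightarrow> \<bar>g y - g x\<bar> < e"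
    using e unfolding uniformly_continuous_on_def dist_real_def by metis
  obtain N :: nat where N: "t / d < real N" using reals_Archimedean2 by blast
  show "\<exists>no. \<forall>n\<ge>no. norm ((\<Sum>i<Suc n. g (t * real (Suc i) / real (Suc n)) *
      (f (t * real (Suc i) / real (Suc n)) - f (t * real i / real (Suc n)))) -
      integral {0..t} (\<lambda>u. f' u * g u)) < r"
  proof (intro exI allI impI)
    fix n assume n: "N \<le> n"
    define p where "p i = t * real i / real (Suc n)" for i
    have p0: "0 \<le> p i" for i using t by (simp add: p_def)
    have pS: "p (Suc i) = p i + t / real (Suc n)" for i by (simp add: p_def distrib_left add_divide_distrib)
    have pm: "p i \<le> p (Suc i)" for i using t unfolding pS by simp
    have pt: "p i \<le> t" if "i \<le> Suc n" for i
      using that t unfolding p_def by (simp add: divide_le_eq mult_left_mono)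
    have step: "t / real (Suc n) < d"
    proof -
      have "t / d < real (Suc n)" using N n by simp
      thus ?thesis using d by (simp add: field_simps)
    qed
    have cfg: "continuous_on {0..t} (\<lambda>u. f' u * g u)" by (intro continuous_intros f' g)
    have "\<bar>(\<Sum>i<k. g (p (Suc i)) * (f (p (Suc i)) - f (p i))) - integral {0..p k} (\<lambda>u. f' u * g u)\<bar> \<le> e * C * p k"
      if "k \<le> Suc n" for k
      using that
    proof (induction k)
      case 0
      then show ?case by (simp add: p_def)
    next
      case (Suc k)
      have sub: "{p k..p (Suc k)} \<subseteq> {0..t}" using p0[of k] pt[OF Suc.prems] by auto
      have comb: "integral {0..p (Suc k)} (\<lambda>u. f' u * g u) =
          integral {0..p k} (\<lambda>u. f' u * g u) + integral {p k..p (Suc k)} (\<lambda>u. f' u * g u)"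
        using p0 pm pt[OF Suc.prems]
        by (intro Henstock_Kurzweil_Integration.integral_combine[symmetric] integrable_continuous_real
            continuous_on_subset[OF cfg]) auto
      have "(f' has_integral (f (p (Suc k)) - f (p k))) {p k..p (Suc k)}"
        by (rule fundamental_theorem_of_calculus[OF pm])
          (use sub in \<open>auto simp: has_real_derivative_iff_has_vector_derivative[symmetric] intro!: has_field_derivative_subset[OF f]\<close>)
      from has_integral_mult_right[OF this, of "g (p (Suc k))"]
      have h1: "((\<lambda>u. g (p (Suc k)) * f' u) has_integral (g (p (Suc k)) * (f (p (Suc k)) - f (p k)))) {p k..p (Suc k)}" .
      have h2: "((\<lambda>u. f' u * g u) has_integral (integral {p k..p (Suc k)} (\<lambda>u. f' u * g u))) {p k..p (Suc k)}"
        by (intro integrable_integral integrable_continuous_real continuous_on_subset[OF cfg] sub)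
      have "\<bar>g (p (Suc k)) * (f (p (Suc k)) - f (p k)) - integral {p k..p (Suc k)} (\<lambda>u. f' u * g u)\<bar> \<le> e * C * (p (Suc k) - p k)"
      proof -
        have "norm (g (p (Suc k)) * (f (p (Suc k)) - f (p k)) - integral {p k..p (Suc k)} (\<lambda>u. f' u * g u))
          \<le> (e * C) * Sigma_Algebra.measure lborel (cbox (p k) (p (Suc k)))"
        proof (rule has_integral_bound)
          show "0 \<le> e * C" using e C0 by simp
          show "((\<lambda>u. g (p (Suc k)) * f' u - f' u * g u) has_integral
            (g (p (Suc k)) * (f (p (Suc k)) - f (p k)) - integral {p k..p (Suc k)} (\<lambda>u. f' u * g u))) (cbox (p k) (p (Suc k)))"
            using has_integral_diff[OF h1 h2] by simp
          fix u assume u: "u \<in> cbox (p k) (p (Suc k))"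
          hence u': "u \<in> {0..t}" using sub by auto
          have "\<bar>p (Suc k) - u\<bar> < d" using u step pS[of k] by auto
          moreover have "p (Suc k) \<in> {0..t}" using p0 pt[OF Suc.prems] by auto
          ultimately have "\<bar>g (p (Suc k)) - g u\<bar> < e" using gd[OF u'] by blast
          hence "\<bar>g (p (Suc k)) - g u\<bar> * \<bar>f' u\<bar> \<le> e * C"
            using C[OF u'] by (intro mult_mono) auto
          thus "norm (g (p (Suc k)) * f' u - f' u * g u) \<le> e * C"
            by (simp add: abs_mult[symmetric] algebra_simps)
        qed
        thus ?thesis using pm[of k] by simp
      qed
      moreover have "\<bar>(\<Sum>i<k. g (p (Suc i)) * (f (p (Suc i)) - f (p i))) - integral {0..p k} (\<lambda>u. f' u * g u)\<bar> \<le> e * C * p k"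
        using Suc by simp
      ultimately show ?case unfolding comb by (simp add: algebra_simps)
    qed
    from this[of "Suc n"] have "\<bar>(\<Sum>i<Suc n. g (p (Suc i)) * (f (p (Suc i)) - f (p i))) - integral {0..t} (\<lambda>u. f' u * g u)\<bar> \<le> e * C * t"
      by (simp add: p_def)
    with eC show "norm ((\<Sum>i<Suc n. g (t * real (Suc i) / real (Suc n)) *
      (f (t * real (Suc i) / real (Suc n)) - f (t * real i / real (Suc n)))) -
      integral {0..t} (\<lambda>u. f' u * g u)) < r" unfolding p_def by simp
  qed
qed

text \<open>The integral is a limit of Riemann sums, so only measurability at single times up to t
  enters. \<open>N\<close> may therefore carry the sigma-algebra of a filtration, which later gives
  adaptedness.\<close>

lemma borel_measurable_integral_continuous_paths:
  fixes X :: "real \<Rightarrow> 'b \<Rightarrow> real"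
  assumes t: "0 \<le> t" and X: "\<And>s. 0 \<le> s \<Longrightarrow> s \<le> t \<Longrightarrow> X s \<in> borel_measurable N"
    and cont: "\<And>\<omega>. \<omega> \<in> space N \<Longrightarrow> continuous_on {0..t} (\<lambda>s. X s \<omega>)"
  shows "(\<lambda>\<omega>. integral {0..t} (\<lambda>s. X s \<omega>)) \<in> borel_measurable N"
proof (rule borel_measurable_LIMSEQ_real)
  fix n :: nat
  have "X (t * real (Suc i) / real (Suc n)) \<in> borel_measurable N" if "i < Suc n" for i
  proof (rule X)
    show "0 \<le> t * real (Suc i) / real (Suc n)" using t by simp
    show "t * real (Suc i) / real (Suc n) \<le> t"
      using that t by (simp add: divide_le_eq mult_left_mono del: of_nat_Suc)
  qed
  thus "(\<lambda>\<omega>. \<Sum>i<Suc n. X (t * real (Suc i) / real (Suc n)) \<omega> *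
      (t * real (Suc i) / real (Suc n) - t * real i / real (Suc n))) \<in> borel_measurable N"
    by (intro borel_measurable_sum borel_measurable_times) auto
next
  fix \<omega> assume "\<omega> \<in> space N"
  from Riemann_Stieltjes_sum_tendsto[OF t _ _ cont[OF this], where f = "\<lambda>x. x" and f' = "\<lambda>_. 1"]
  show "(\<lambda>n. \<Sum>i<Suc n. X (t * real (Suc i) / real (Suc n)) \<omega> *
      (t * real (Suc i) / real (Suc n) - t * real i / real (Suc n)))
    \<longlonglongrightarrow> integral {0..t} (\<lambda>s. X s \<omega>)"
    by (simp del: of_nat_Suc sum.lessThan_Suc)
qed

section \<open>Approximation of continuous integrands by left-endpoint step functions\<close>

text \<open>With left-endpoint values, summation by parts moves the increments to \<open>f\<close>
  and evaluates the path at right endpoints. The number \<open>Suc n\<close> of cells is never zero,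
  so the mesh makes sense for n = 0 as well.\<close>

definition left_steps :: "(real \<Rightarrow> real) \<Rightarrow> real \<Rightarrow> nat \<Rightarrow> (real \<times> real \<times> real) list"
  where "left_steps f t n = map (\<lambda>i. (f (t * real i / real (Suc n)), t * real i / real (Suc n), t * real (Suc i) / real (Suc n))) [0..<Suc n]"

lemma step_function_left_steps:
  "step_function (left_steps f t n) u = (\<Sum>i<Suc n. f (t * real i / real (Suc n)) *
    indicator {t * real i / real (Suc n)<..t * real (Suc i) / real (Suc n)} u)"
  unfolding step_function_def left_steps_def
  by (simp only: map_map comp_def split_conv interv_sum_list_conv_sum_set_nat set_upt atLeast0LessThan)

lemma step_integral_left_steps:
  "step_integral W (left_steps f t n) \<omega> = (\<Sum>i<Suc n. f (t * real i / real (Suc n)) *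
    (W (t * real (Suc i) / real (Suc n)) \<omega> - W (t * real i / real (Suc n)) \<omega>))"
  unfolding step_integral_def left_steps_def
  by (simp only: map_map comp_def split_conv interv_sum_list_conv_sum_set_nat set_upt atLeast0LessThan)

text \<open>Consecutive left-open cells are disjoint and exhaust their union, so at most one summand
  survives. The two cases are joined because the induction for the second uses the first.\<close>

lemma sum_consecutive_indicators:
  fixes p c :: "nat \<Rightarrow> real"
  assumes "\<And>i. p i \<le> p (Suc i)"
  shows "(u \<notin> {p 0<..p k} \<longrightarrow> (\<Sum>i<k. c i * indicator {p i<..p (Suc i)} u) = 0) \<and>
    (u \<in> {p 0<..p k} \<longrightarrow> (\<exists>i<k. u \<in> {p i<..p (Suc i)} \<and> (\<Sum>i<k. c i * indicator {p i<..p (Suc i)} u) = c i))"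
proof (induction k)
  case 0
  then show ?case by simp
next
  case (Suc k)
  have mono: "p 0 \<le> p k" by (induction k) (use assms order_trans in blast)+
  consider "u \<in> {p 0<..p k}" | "u \<in> {p k<..p (Suc k)}" | "u \<notin> {p 0<..p (Suc k)}"
    by fastforce
  then show ?case
  proof cases
    case 1
    with Suc obtain i where i: "i < k" "u \<in> {p i<..p (Suc i)}" "(\<Sum>i<k. c i * indicator {p i<..p (Suc i)} u) = c i"
      by blast
    moreover have "u \<in> {p 0<..p (Suc k)}" using 1 assms[of k] by auto
    ultimately show ?thesis using 1 by (auto intro!: exI[of _ i] simp: indicator_def)
  next
    case 2
    hence "(\<Sum>i<k. c i * indicator {p i<..p (Suc i)} u) = 0" using Suc by auto
    moreover have "u \<in> {p 0<..p (Suc k)}" using 2 mono by auto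
    ultimately show ?thesis using 2 by (auto intro!: exI[of _ k])
  next
    case 3
    hence "u \<notin> {p 0<..p k}" "u \<notin> {p k<..p (Suc k)}" using mono assms[of k] by auto
    thus ?thesis using 3 Suc by auto
  qed
qed

lemma ennreal_tendsto_zero_if_eventually_le:
  fixes x :: "nat \<Rightarrow> ennreal"
  assumes "\<And>r. 0 < r \<Longrightarrow> eventually (\<lambda>n. x n \<le> ennreal r) sequentially"
  shows "x \<longlonglongrightarrow> 0"
proof (rule order_tendstoI)
  fix a :: ennreal assume "0 < a"
  then obtain b where b: "0 < b" "b < a" using dense by blast
  then obtain r where r: "b = ennreal r" "0 \<le> r" by (cases b) auto
  hence "0 < r" using b by simp
  from assms[OF this] show "eventually (\<lambda>n. x n < a) sequentially"
    by eventually_elim (use b r in simp)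
qed simp

lemma left_steps_tendsto:
  assumes t: "0 \<le> t" and f: "continuous_on {0..t} f"
  shows "(\<lambda>n. \<integral>\<^sup>+u. ennreal ((indicator {0..t} u * f u - step_function (left_steps f t n) u)\<^sup>2) \<partial>lebesgue) \<longlonglongrightarrow> 0"
proof (rule ennreal_tendsto_zero_if_eventually_le)
  fix r :: real assume r: "0 < r"
  define e where "e = sqrt (r / (t + 1))"
  have e: "0 < e" "e\<^sup>2 * t \<le> r" using r t unfolding e_def by (simp_all add: field_simps)
  have "uniformly_continuous_on {0..t} f" using f by (intro compact_uniformly_continuous) auto
  then obtain d where d: "0 < d"
    and fd: "\<And>x y. x \<in> {0..t} \<Longrightarrow> y \<in> {0..t} \<Longrightarrow> \<bar>y - x\<bar> < d \<Longrightarrow> \<bar>f y - f x\<bar> < e"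
    using e unfolding uniformly_continuous_on_def dist_real_def by metis
  obtain N :: nat where N: "t / d < real N" using reals_Archimedean2 by blast
  show "eventually (\<lambda>n. (\<integral>\<^sup>+u. ennreal ((indicator {0..t} u * f u - step_function (left_steps f t n) u)\<^sup>2) \<partial>lebesgue) \<le> ennreal r) sequentially"
    using eventually_ge_at_top[of N]
  proof eventually_elim
    case (elim n)
    define p where "p i = t * real i / real (Suc n)" for i
    have p0: "0 \<le> p i" for i using t by (simp add: p_def)
    have pS: "p (Suc i) = p i + t / real (Suc n)" for i by (simp add: p_def distrib_left add_divide_distrib)
    have pm: "p i \<le> p (Suc i)" for i using t unfolding pS by simp
    have pt: "p i \<le> t" if "i \<le> Suc n" for i
      using that t unfolding p_def by (simp add: divide_le_eq mult_left_mono)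
    have step: "t / real (Suc n) < d"
    proof -
      have "t / d < real (Suc n)" using N elim by simp
      thus ?thesis using d by (simp add: field_simps)
    qed
    have sf: "step_function (left_steps f t n) u = (\<Sum>i<Suc n. f (p i) * indicator {p i<..p (Suc i)} u)" for u
      unfolding step_function_left_steps p_def ..
    have pe: "p 0 = 0" "p (Suc n) = t" by (simp_all add: p_def)
    \<comment> \<open>The point 0 lies in no left-open cell, so the step function misses the value
      of \<open>f\<close> there; it is removed as a null set.\<close>
    have pt_bound: "ennreal ((indicator {0..t} u * f u - step_function (left_steps f t n) u)\<^sup>2) \<le> ennreal (e\<^sup>2) * indicator {0..t} u"
      if "u \<noteq> 0" for u
    proof (cases "u \<in> {0<..t}")
      case True
      with sum_consecutive_indicators[of p u "Suc n" "\<lambda>i. f (p i)", OF pm] obtain i where i: "i < Suc n" "u \<in> {p i<..p (Suc i)}"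
          "step_function (left_steps f t n) u = f (p i)"
        unfolding sf pe by blast
      have "\<bar>u - p i\<bar> < d" using i(2) step pS[of i] by auto
      moreover have "p i \<in> {0..t}" "u \<in> {0..t}" using p0 pt[of i] i True by auto
      ultimately have "\<bar>f u - f (p i)\<bar> < e" using fd by blast
      hence "(f u - f (p i))\<^sup>2 \<le> e\<^sup>2" by (metis abs_le_square_iff abs_of_pos e(1) less_imp_le)
      thus ?thesis using i True by (simp add: ennreal_leI)
    next
      case False
      with sum_consecutive_indicators[of p u "Suc n" "\<lambda>i. f (p i)", OF pm] have "step_function (left_steps f t n) u = 0"
        unfolding sf pe by blast
      moreover have "u \<notin> {0..t}" using False that by auto
      ultimately show ?thesis by simp
    qed
    have "AE u in lebesgue. u \<noteq> (0::real)"
      by (rule AE_completion) (rule AE_lborel_singleton)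
    hence "(\<integral>\<^sup>+u. ennreal ((indicator {0..t} u * f u - step_function (left_steps f t n) u)\<^sup>2) \<partial>lebesgue) \<le>
        (\<integral>\<^sup>+u. ennreal (e\<^sup>2) * indicator {0..t} u \<partial>lebesgue)"
      by (intro nn_integral_mono_AE) (auto elim!: eventually_mono intro: pt_bound)
    also have "\<dots> = ennreal (e\<^sup>2 * t)"
      using t by (simp add: nn_integral_cmult_indicator ennreal_mult'')
    also have "\<dots> \<le> ennreal r" using e(2) by (rule ennreal_leI)
    finally show ?case .
  qed
qed

context brownian_motion
begin

text \<open>Summation by parts turns left-endpoint sums into f(t) W(t) minus a Riemann-Stieltjes sum
  of W against f, and W(0) = 0 removes the lower boundary term. The pathwise limit is also the mean
  square limit by \<open>step_integral_L2_limit\<close>. This is applied to the given W and to the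
  constructed B.\<close>

lemma wiener_integral_by_parts:
  assumes t: "0 \<le> t" "{0..t} \<subseteq> I"
    and f: "\<And>u. u \<in> {0..t} \<Longrightarrow> (f has_real_derivative f' u) (at u within {0..t})"
    and f': "continuous_on {0..t} f'"
    and X: "X \<in> borel_measurable M"
    and eq: "AE \<omega> in M. X \<omega> = f t * W t \<omega> - integral {0..t} (\<lambda>u. f' u * W u \<omega>)"
  shows "is_wiener_integral M W {0..t} f X"
proof -
  have fc: "continuous_on {0..t} f"
    using f DERIV_continuous_on by blast
  have steps: "a \<in> {0..t} \<and> b \<in> {0..t} \<and> a \<le> b" if "(c, a, b) \<in> set (left_steps f t n)" for c a b n
    using that t unfolding left_steps_def
    by (auto simp: divide_le_eq mult_left_mono divide_right_mono simp del: of_nat_Suc upt_Suc)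
  hence steps_in: "steps_in (left_steps f t n)" for n using t unfolding steps_in_def by fast
  have fm: "(\<lambda>u. indicator {0..t} u * f u) \<in> borel_measurable lebesgue"
  proof -
    have "(\<lambda>u. indicator {0..t} u *\<^sub>R f u) \<in> borel_measurable borel"
      by (rule borel_measurable_continuous_on_indicator[OF _ fc]) simp
    thus ?thesis by (intro measurable_completion) (simp add: scaleR_conv_of_real)
  qed
  note f_lim = left_steps_tendsto[OF t(1) fc]
  have path: "AE \<omega> in M. (\<lambda>n. step_integral W (left_steps f t n) \<omega>) \<longlonglongrightarrow> X \<omega>"
    using start paths_continuous eq
  proof eventually_elim
    case (elim \<omega>)
    have Wc: "continuous_on {0..t} (\<lambda>s. W s \<omega>)" using elim t continuous_on_subset by blast
    have abel: "step_integral W (left_steps f t n) \<omega> = f t * W t \<omega> -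
      (\<Sum>i<Suc n. W (t * real (Suc i) / real (Suc n)) \<omega> *
        (f (t * real (Suc i) / real (Suc n)) - f (t * real i / real (Suc n))))" for n
    proof -
      define p where "p i = t * real i / real (Suc n)" for i
      have "f t * W t \<omega> = (\<Sum>i<Suc n. f (p (Suc i)) * W (p (Suc i)) \<omega> - f (p i) * W (p i) \<omega>)"
        using sum_lessThan_telescope[of "\<lambda>i. f (p i) * W (p i) \<omega>" "Suc n"] elim(1)
        by (simp add: p_def del: sum.lessThan_Suc)
      thus ?thesis
        unfolding step_integral_left_steps p_def[symmetric]
        by (simp add: sum_subtractf[symmetric] algebra_simps del: sum.lessThan_Suc)
    qed
    have "(\<lambda>n. step_integral W (left_steps f t n) \<omega>) \<longlonglongrightarrow> f t * W t \<omega> - integral {0..t} (\<lambda>u. f' u * W u \<omega>)"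
      unfolding abel by (intro tendsto_diff tendsto_const Riemann_Stieltjes_sum_tendsto[OF t(1) f f' Wc])
    thus ?case using elim(3) by simp
  qed
  have "(\<integral>\<^sup>+u. ennreal ((f u - step_function (left_steps f t n) u)\<^sup>2) \<partial>lebesgue_on {0..t}) \<le>
      (\<integral>\<^sup>+u. ennreal ((indicator {0..t} u * f u - step_function (left_steps f t n) u)\<^sup>2) \<partial>lebesgue)" for n
    by (subst nn_integral_restrict_space) (auto intro!: nn_integral_mono simp: indicator_def)
  hence "(\<lambda>n. \<integral>\<^sup>+u. ennreal ((f u - step_function (left_steps f t n) u)\<^sup>2) \<partial>lebesgue_on {0..t}) \<longlonglongrightarrow> 0"
    by (intro tendsto_sandwich[OF _ _ tendsto_const f_lim]) auto
  moreover have "f \<in> borel_measurable (lebesgue_on {0..t})"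
    by (rule continuous_imp_measurable_on_sets_lebesgue[OF fc]) simp
  moreover note step_integral_L2_limit[OF fm X steps_in f_lim path]
  ultimately show ?thesis
    unfolding is_wiener_integral_def using X steps
    by (intro conjI exI[of _ "left_steps f t"]) auto
qed

text \<open>With this covariance the integrands of increments over disjoint intervals are
  orthogonal, and orthogonal Wiener integrals are independent Gaussians. \<open>F t\<close> lives on
  the whole line, so \<open>B\<close> may depend on the driving process before time 0.\<close>

lemma brownian_motion_if_covariance_min:
  assumes B: "\<And>t. t \<in> {0..T} \<Longrightarrow> full_wiener_integral (F t) (B t)"
    and cov: "\<And>s t. 0 \<le> s \<Longrightarrow> s \<le> t \<Longrightarrow> t \<le> T \<Longrightarrow> (LINT u|lebesgue. F s u * F t u) = s"
    and T: "0 \<le> T" and cont: "AE \<omega> in M. continuous_on {0..T} (\<lambda>t. B t \<omega>)"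
  shows "brownian_motion M {0..T} B"
proof
  have cov': "(LINT u|lebesgue. F s u * F t u) = min s t" if "s \<in> {0..T}" "t \<in> {0..T}" for s t
    using cov[of s t] cov[of t s] that by (cases "s \<le> t") (auto simp: mult.commute)
  have int: "integrable lebesgue (\<lambda>u. F s u * F t u)" if "s \<in> {0..T}" "t \<in> {0..T}" for s t
    using B[OF that(1)] B[OF that(2)]
    by (intro integrable_mult_if_squares full_wiener_integral_measurable full_wiener_integral_isometry)
  have inc: "(LINT u|lebesgue. (F t u - F s u) * (F t' u - F s' u)) = min t t' - min t s' - min s t' + min s s'"
    if "s \<in> {0..T}" "t \<in> {0..T}" "s' \<in> {0..T}" "t' \<in> {0..T}" for s t s' t'
  proof -
    have "(LINT u|lebesgue. (F t u - F s u) * (F t' u - F s' u)) =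
        (LINT u|lebesgue. F t u * F t' u - F t u * F s' u - F s u * F t' u + F s u * F s' u)"
      by (simp add: algebra_simps)
    also have "\<dots> = min t t' - min t s' - min s t' + min s s'"
      using that by (simp add: int cov')
    finally show ?thesis .
  qed
  have incl: "full_wiener_integral (\<lambda>u. F t u - F s u) (\<lambda>\<omega>. B t \<omega> - B s \<omega>)"
    if "s \<in> {0..T}" "t \<in> {0..T}" for s t
    using full_wiener_integral_lincomb[OF B[OF that(2)] B[OF that(1)], of 1 "-1"] by simp
  show "B t \<in> borel_measurable M" if "t \<in> {0..T}" for t
    using B[OF that] full_wiener_integral_measurable by blast
  show "AE \<omega> in M. B 0 \<omega> = 0"
  proof -
    have B0: "full_wiener_integral (F 0) (B 0)" using B T by simp
    have "expectation (\<lambda>\<omega>. (B 0 \<omega>)\<^sup>2) = 0"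
      using full_wiener_integral_isometry(3)[OF B0] cov[of 0 0] T by (simp add: power2_eq_square)
    hence "AE \<omega> in M. (B 0 \<omega>)\<^sup>2 = 0"
      using full_wiener_integral_isometry(2)[OF B0] by (subst (asm) integral_nonneg_eq_0_iff_AE) auto
    thus ?thesis by eventually_elim simp
  qed
  show "distributed M lborel (\<lambda>\<omega>. B t \<omega> - B s \<omega>) (normal_density 0 (sqrt (t - s)))"
    if "s \<in> {0..T}" "t \<in> {0..T}" "s < t" for s t
  proof (rule full_wiener_integral_normal[OF incl[OF that(1,2)]])
    show "(LINT u|lebesgue. (F t u - F s u)\<^sup>2) = (sqrt (t - s))\<^sup>2"
      using inc[OF that(1,2,1,2)] that by (simp add: power2_eq_square[of "F _ _ - _"] )
  qed (use that in simp)
  show "indep_vars (\<lambda>_. borel) (\<lambda>i \<omega>. B (\<tau> (Suc i)) \<omega> - B (\<tau> i) \<omega>) {..<n}"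
    if tI: "\<And>i. i \<le> n \<Longrightarrow> \<tau> i \<in> {0..T}" and t: "\<And>i. i < n \<Longrightarrow> \<tau> i < \<tau> (Suc i)" for n \<tau>
  proof (rule full_wiener_integral_indep[OF finite_lessThan])
    show "full_wiener_integral (\<lambda>u. F (\<tau> (Suc i)) u - F (\<tau> i) u) (\<lambda>\<omega>. B (\<tau> (Suc i)) \<omega> - B (\<tau> i) \<omega>)"
      if "i \<in> {..<n}" for i
      using that by (intro incl tI) auto
    have mono: "\<tau> i \<le> \<tau> j" if "i \<le> j" "j \<le> n" for i j
      using that
    proof (induction j rule: dec_induct)
      case (step m)
      thus ?case using t[of m] by simp
    qed simp
    fix i j assume "i \<in> {..<n}" "j \<in> {..<n}" "i \<noteq> j"
    hence ij: "i < n" "j < n" "i \<noteq> j" by auto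
    have "(LINT u|lebesgue. (F (\<tau> (Suc i)) u - F (\<tau> i) u) * (F (\<tau> (Suc j)) u - F (\<tau> j) u)) =
      min (\<tau> (Suc i)) (\<tau> (Suc j)) - min (\<tau> (Suc i)) (\<tau> j) - min (\<tau> i) (\<tau> (Suc j)) + min (\<tau> i) (\<tau> j)"
      by (rule inc) (use ij tI in auto)
    also have "\<dots> = 0"
    proof (cases "i < j")
      case True
      thus ?thesis using mono[of "Suc i" j] mono[of i "Suc i"] mono[of j "Suc j"] ij by auto
    next
      case False
      thus ?thesis using mono[of "Suc j" i] mono[of i "Suc i"] mono[of j "Suc j"] ij by auto
    qed
    finally show "(LINT u|lebesgue. (F (\<tau> (Suc i)) u - F (\<tau> i) u) * (F (\<tau> (Suc j)) u - F (\<tau> j) u)) = 0" .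
  qed
qed (rule cont)

end

section \<open>The kernels\<close>

lemma lebesgue_on_interval_FTC:
  fixes F f :: "real \<Rightarrow> real"
  assumes "s \<le> t" and F: "\<And>u. u \<in> {s..t} \<Longrightarrow> (F has_real_derivative f u) (at u within {s..t})"
    and f: "continuous_on {s..t} f"
  shows "(LINT u|lebesgue_on {s..t}. f u) = F t - F s"
proof -
  have "(LINT u|lebesgue_on {s..t}. f u) = integral {s..t} f"
    by (rule lebesgue_integral_eq_integral[OF continuous_imp_integrable_real[OF f]]) simp
  also have "\<dots> = F t - F s"
    using assms by (intro integral_unique fundamental_theorem_of_calculus)
      (auto simp: has_real_derivative_iff_has_vector_derivative)
  finally show ?thesis .
qed

lemma compact_volterra_triangle: "compact (volterra_triangle T)"
proof -
  have "volterra_triangle T = {x. 0 \<le> snd x \<and> snd x \<le> fst x \<and> fst x \<le> T}"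
    by (auto simp: volterra_triangle_def)
  moreover have "closed {x::real\<times>real. 0 \<le> snd x \<and> snd x \<le> fst x \<and> fst x \<le> T}"
    by (intro closed_Collect_conj closed_Collect_le continuous_intros)
  moreover have "volterra_triangle T \<subseteq> {0..T} \<times> {0..T}"
    by (auto simp: volterra_triangle_def)
  hence "bounded (volterra_triangle T)"
    by (rule bounded_subset[rotated]) (intro bounded_Times bounded_closed_interval)
  ultimately show ?thesis by (simp add: compact_eq_bounded_closed)
qed

locale volterra_parameters =
  fixes p q :: real
  assumes q_pos: "0 < q" and p_gt: "- q < p"
begin

definition ka :: "real \<Rightarrow> real"
  where "ka s = (2 * q + p) * exp (q * s) - p * exp (- q * s)"

definition kb :: "real \<Rightarrow> real"
  where "kb t = (2 * q + p)\<^sup>2 * exp (q * t) - p\<^sup>2 * exp (- q * t)"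

text \<open>At t = 0 the value is (2 q + p)^2 - p^2 = 4 q (q + p), and larger t can only help. Thus
  the denominators of both kernels never vanish.\<close>

lemma kb_pos: "0 < kb t" if "0 \<le> t"
proof -
  have "(2 * q + p)\<^sup>2 = p\<^sup>2 + 4 * (q * (q + p))" by (simp add: power2_eq_square algebra_simps)
  moreover have "0 < q * (q + p)" using q_pos p_gt by simp
  ultimately have "p\<^sup>2 < (2 * q + p)\<^sup>2" by linarith
  moreover have "p\<^sup>2 * exp (- q * t) \<le> p\<^sup>2 * 1"
    using q_pos that by (intro mult_left_mono) auto
  moreover have "(2 * q + p)\<^sup>2 * 1 \<le> (2 * q + p)\<^sup>2 * exp (q * t)"
    using q_pos that by (intro mult_left_mono) auto
  ultimately show ?thesis unfolding kb_def by linarith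
qed

lemma kb_nz: "0 \<le> t \<Longrightarrow> kb t \<noteq> 0"
  using kb_pos[of t] by simp

lemma kernel_k_eq: "kernel_k p q t s = p * (2 * q + p) * ka s / kb t"
  by (simp add: kernel_k_def ka_def kb_def)

text \<open>With r = 2 q + p and E = exp(q s), the numerator of the braces is r^2 E^2 - p^2 - 2 p q
  = r (r E^2 - p). In the resulting product form t enters only through exp(-\<rho> t).\<close>

lemma kernel_l_eq:
  assumes "0 \<le> s"
  shows "kernel_l p q t s = p * (2 * q + p) * exp (- (p + q) * t) * exp ((p + q) * s) * ka s / kb s"
proof -
  define E where "E = exp (q * s)"
  have E: "0 < E" "exp (- q * s) = 1 / E" "exp (2 * q * s) = E\<^sup>2"
    by (simp_all add: E_def exp_minus field_simps power2_eq_square exp_add[symmetric])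
  define D where "D = (2 * q + p)\<^sup>2 * E\<^sup>2 - p\<^sup>2"
  have b: "kb s = D / E"
    using E by (simp add: kb_def D_def E_def[symmetric] field_simps power2_eq_square)
  have "0 < D" using kb_pos[OF assms] E(1) unfolding b by (simp add: zero_less_divide_iff)
  have "1 - 2 * p * q / D = (D - 2 * p * q) / D" using \<open>0 < D\<close> by (simp add: field_simps)
  also have "D - 2 * p * q = (2 * q + p) * ((2 * q + p) * E\<^sup>2 - p)"
    by (simp add: D_def power2_eq_square algebra_simps)
  also have "(2 * q + p) * E\<^sup>2 - p = ka s * E"
    using E by (simp add: ka_def E_def[symmetric] field_simps power2_eq_square)
  finally have eq1: "1 - 2 * p * q / D = (2 * q + p) * ka s / kb s"
    unfolding b by simp
  have eq2: "exp (- (p + q) * (t - s)) = exp (- (p + q) * t) * exp ((p + q) * s)"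
    by (simp add: exp_add[symmetric] algebra_simps)
  show ?thesis
    unfolding kernel_l_def E(3) D_def[symmetric] eq1 eq2 by (simp only: times_divide_eq_right mult_ac)
qed

lemma ka_continuous[continuous_intros]: "continuous_on S f \<Longrightarrow> continuous_on S (\<lambda>x. ka (f x))"
  unfolding ka_def by (intro continuous_intros)

lemma kb_continuous[continuous_intros]: "continuous_on S f \<Longrightarrow> continuous_on S (\<lambda>x. kb (f x))"
  unfolding kb_def by (intro continuous_intros)

lemma kb_deriv:
  "(kb has_real_derivative (p + q) * kb t - p * (2 * q + p) * ka t) (at t within S)"
  unfolding kb_def[abs_def] ka_def
  by (auto intro!: derivative_eq_intros simp: algebra_simps power2_eq_square)

text \<open>The integrand depends on u through exp(\<rho> u) ka(u) / kb(u)^2, and p r times this is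
  the derivative of exp(\<rho> u) / kb(u). The endpoint t yields k, the endpoint s yields l.\<close>

lemma convolution_l_k:
  assumes "0 \<le> s" "s \<le> t"
  shows "(LINT u|lebesgue_on {s..t}. kernel_l p q t u * kernel_k p q u s) = kernel_k p q t s - kernel_l p q t s"
proof -
  let ?f = "\<lambda>u. p * (2 * q + p) * exp (- (p + q) * t) * exp ((p + q) * u) * ka u / kb u * (p * (2 * q + p) * ka s / kb u)"
  let ?F = "\<lambda>u. p * (2 * q + p) * ka s * exp (- (p + q) * t) * (exp ((p + q) * u) / kb u)"
  have "(LINT u|lebesgue_on {s..t}. kernel_l p q t u * kernel_k p q u s) = (LINT u|lebesgue_on {s..t}. ?f u)"
    using assms by (intro Bochner_Integration.integral_cong) (auto simp: kernel_l_eq kernel_k_eq space_restrict_space)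
  also have "\<dots> = ?F t - ?F s"
  proof (rule lebesgue_on_interval_FTC[OF assms(2)])
    fix u assume u: "u \<in> {s..t}"
    have nz: "kb u \<noteq> 0" using u assms by (intro kb_nz) auto
    have "((\<lambda>u. exp ((p + q) * u) / kb u) has_real_derivative
      ((p + q) * exp ((p + q) * u) * kb u - exp ((p + q) * u) * ((p + q) * kb u - p * (2 * q + p) * ka u)) / (kb u * kb u)) (at u within {s..t})"
      by (rule DERIV_divide[OF _ kb_deriv nz]) (auto intro!: derivative_eq_intros)
    from DERIV_cmult[OF this, of "p * (2 * q + p) * ka s * exp (- (p + q) * t)"]
    show "(?F has_real_derivative ?f u) (at u within {s..t})"
      by (rule DERIV_cong) (use nz in \<open>simp add: field_simps\<close>)
  next
    show "continuous_on {s..t} ?f"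
      by (intro continuous_intros) (use assms kb_nz in auto)
  qed
  also have "\<dots> = kernel_k p q t s - kernel_l p q t s"
  proof -
    have "exp (- (p + q) * t) * exp ((p + q) * t) = 1" by (simp add: exp_add[symmetric] algebra_simps)
    hence "?F t = kernel_k p q t s" unfolding kernel_k_eq
      by (metis (no_types, opaque_lifting) mult.assoc mult.right_neutral times_divide_eq_right)
    thus ?thesis using assms by (simp add: kernel_l_eq)
  qed
  finally show ?thesis .
qed

text \<open>Here u enters through exp(-\<rho> u) ka(u), and p r times this is the derivative of
  -exp(-\<rho> u) kb(u). The endpoints exchange roles: s yields k, t yields l.\<close>

lemma convolution_k_l:
  assumes "0 \<le> s" "s \<le> t"
  shows "(LINT u|lebesgue_on {s..t}. kernel_k p q t u * kernel_l p q u s) = kernel_k p q t s - kernel_l p q t s"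
proof -
  let ?c = "p * (2 * q + p) * ka s * exp ((p + q) * s) / (kb t * kb s)"
  let ?f = "\<lambda>u. ?c * (p * (2 * q + p) * ka u * exp (- (p + q) * u))"
  let ?F = "\<lambda>u. ?c * (- (exp (- (p + q) * u) * kb u))"
  have nz: "kb t \<noteq> 0" "kb s \<noteq> 0" using assms by (auto intro!: kb_nz)
  have "(LINT u|lebesgue_on {s..t}. kernel_k p q t u * kernel_l p q u s) = (LINT u|lebesgue_on {s..t}. ?f u)"
    using assms by (intro Bochner_Integration.integral_cong) (auto simp: kernel_l_eq kernel_k_eq)
  also have "\<dots> = ?F t - ?F s"
  proof (rule lebesgue_on_interval_FTC[OF assms(2)])
    fix u assume u: "u \<in> {s..t}"
    have "((\<lambda>u. - (exp (- (p + q) * u) * kb u)) has_real_derivative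
      - ((- (p + q) * exp (- (p + q) * u)) * kb u + ((p + q) * kb u - p * (2 * q + p) * ka u) * exp (- (p + q) * u))) (at u within {s..t})"
      by (intro DERIV_minus DERIV_mult kb_deriv) (auto intro!: derivative_eq_intros)
    from DERIV_cmult[OF this, of ?c]
    show "(?F has_real_derivative ?f u) (at u within {s..t})"
      by (rule DERIV_cong) (simp add: algebra_simps)
  next
    show "continuous_on {s..t} ?f" by (intro continuous_intros)
  qed
  also have "\<dots> = kernel_k p q t s - kernel_l p q t s"
  proof -
    have e: "exp ((p + q) * s) * exp (- (p + q) * s) = 1" by (simp add: exp_add[symmetric] algebra_simps)
    have "?F s = - (p * (2 * q + p) * ka s / kb t) * (exp ((p + q) * s) * exp (- (p + q) * s))"
      using nz by (simp add: field_simps)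
    hence "?F s = - kernel_k p q t s" unfolding kernel_k_eq e by simp
    moreover have "?F t = - kernel_l p q t s" using nz assms by (simp add: kernel_l_eq field_simps)
    ultimately show ?thesis by simp
  qed
  finally show ?thesis .
qed

lemma kernel_l_continuous: "continuous_on (volterra_triangle T) (\<lambda>(t, s). kernel_l p q t s)"
proof -
  have "continuous_on (volterra_triangle T)
      (\<lambda>x. p * (2 * q + p) * exp (- (p + q) * fst x) * exp ((p + q) * snd x) * ka (snd x) / kb (snd x))"
    by (intro continuous_intros) (auto simp: volterra_triangle_def kb_nz)
  thus ?thesis
    by (rule continuous_on_cong[THEN iffD1, rotated 2]) (auto simp: volterra_triangle_def kernel_l_eq)
qed

lemma is_resolvent_kernel_l: "is_resolvent T (kernel_k p q) (kernel_l p q)"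
proof -
  let ?D = "volterra_triangle T"
  have Dm: "?D \<in> lmeasurable" using compact_volterra_triangle by (rule lmeasurable_compact)
  hence Ds: "?D \<in> sets lebesgue" by (rule fmeasurableD)
  interpret D: finite_measure "lebesgue_on ?D" by (rule finite_measure_lebesgue_on[OF Dm])
  have meas: "(\<lambda>(t, s). kernel_l p q t s) \<in> borel_measurable (lebesgue_on ?D)"
    by (rule continuous_imp_measurable_on_sets_lebesgue[OF kernel_l_continuous Ds])
  have "compact ((\<lambda>(t, s). kernel_l p q t s) ` ?D)"
    by (rule compact_continuous_image[OF kernel_l_continuous compact_volterra_triangle])
  then obtain C where "\<forall>x\<in>(\<lambda>(t, s). kernel_l p q t s) ` ?D. norm x \<le> C"
    using compact_imp_bounded bounded_iff by metis
  hence C: "\<bar>kernel_l p q t s\<bar> \<le> C" if "(t, s) \<in> ?D" for t s using that by force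
  have "integrable (lebesgue_on ?D) (\<lambda>(t, s). (kernel_l p q t s)\<^sup>2)"
  proof (rule D.integrable_const_bound)
    show "AE x in lebesgue_on ?D. norm (case x of (t, s) \<Rightarrow> (kernel_l p q t s)\<^sup>2) \<le> C\<^sup>2"
    proof (rule AE_I2)
      fix x assume "x \<in> space (lebesgue_on ?D)"
      hence "\<bar>kernel_l p q (fst x) (snd x)\<bar> \<le> C" using C[of "fst x" "snd x"] by simp
      from power_mono[OF this, of 2] show "norm (case x of (t, s) \<Rightarrow> (kernel_l p q t s)\<^sup>2) \<le> C\<^sup>2"
        by (simp add: case_prod_beta)
    qed
    have "(\<lambda>x. ((case x of (t, s) \<Rightarrow> kernel_l p q t s))\<^sup>2) \<in> borel_measurable (lebesgue_on ?D)"
      using meas by (rule borel_measurable_power)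
    thus "(\<lambda>(t, s). (kernel_l p q t s)\<^sup>2) \<in> borel_measurable (lebesgue_on ?D)"
      by (simp add: case_prod_beta)
  qed
  moreover have "AE (t, s) in lebesgue_on ?D.
      kernel_l p q t s - kernel_k p q t s + (LINT u|lebesgue_on {s..t}. kernel_l p q t u * kernel_k p q u s) = 0 \<and>
      kernel_l p q t s - kernel_k p q t s + (LINT u|lebesgue_on {s..t}. kernel_k p q t u * kernel_l p q u s) = 0"
    by (rule AE_I2) (auto simp: volterra_triangle_def convolution_k_l convolution_l_k)
  ultimately show ?thesis
    unfolding is_resolvent_def square_integrable_volterra_kernel_def using meas by blast
qed

text \<open>Since \<open>k t s\<close> is a product \<open>\<alpha> s * \<beta> t\<close>, the homogeneous equation reduces to a
  linear differential equation with integrating factor \<open>exp (- (p + q) s) * kb s\<close>.\<close>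

lemma homogeneous_equation_trivial:
  assumes t: "0 \<le> t" and g: "g absolutely_integrable_on {0..t}"
    and N: "negligible N"
    and eq: "\<And>s. s \<in> {0..t} - N \<Longrightarrow> g s + (LINT u|lebesgue_on {s..t}. g u * kernel_k p q u s) = 0"
    and s: "s \<in> {0..t} - N"
  shows "g s = 0"
proof -
  \<comment> \<open>Dividing by \<open>kb\<close> collects the u-dependence of the integrand: the
    integral becomes p r ka(s) times the tail integral \<open>G\<close> of \<open>w\<close>.\<close>
  define w where "w u = 1 / kb u * g u" for u
  have cb: "continuous_on {0..t} (\<lambda>u. 1 / kb u)"
    by (intro continuous_intros) (auto simp: kb_nz)
  have w: "w absolutely_integrable_on {0..t}"
    unfolding w_def
  proof (rule absolutely_integrable_bounded_measurable_product_real[OF _ _ _ g])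
    show "(\<lambda>u. 1 / kb u) \<in> borel_measurable (lebesgue_on {0..t})"
      by (rule continuous_imp_measurable_on_sets_lebesgue[OF cb]) simp
    show "bounded ((\<lambda>u. 1 / kb u) ` {0..t})"
      by (intro compact_imp_bounded compact_continuous_image[OF cb]) simp
  qed simp
  have wi: "w integrable_on {0..t}" using w set_lebesgue_integral_eq_integral(1) by blast
  define G where "G s = integral {s..t} w" for s
  have G: "(LINT u|lebesgue_on {s..t}. g u * kernel_k p q u s) = p * (2 * q + p) * ka s * G s" if "s \<in> {0..t}" for s
  proof -
    have ws: "w absolutely_integrable_on {s..t}"
      by (rule set_integrable_subset[OF w]) (use that in auto)
    have "(LINT u|lebesgue_on {s..t}. g u * kernel_k p q u s) = (LINT u|lebesgue_on {s..t}. (p * (2 * q + p) * ka s) * w u)"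
      by (simp add: kernel_k_eq w_def mult_ac)
    also have "\<dots> = (p * (2 * q + p) * ka s) * (LINT u|lebesgue_on {s..t}. w u)"
      by (rule integral_mult_right_zero)
    also have "(LINT u|lebesgue_on {s..t}. w u) = G s"
      unfolding G_def by (rule lebesgue_integral_eq_integral[OF absolutely_integrable_imp_integrable[OF ws]]) simp_all
    finally show ?thesis .
  qed
  have Gc: "continuous_on {0..t} G"
    unfolding G_def by (rule indefinite_integral_continuous_1'[OF wi])
  \<comment> \<open>\<open>g\<close> is only integrable, but off \<open>N\<close> the equation
    expresses \<open>w\<close> through the continuous \<open>G\<close>. Replacing \<open>w\<close>
    by the continuous \<open>h\<close> under the integral makes \<open>G\<close> differentiable at
    every point.\<close>
  define h where "h u = - (p * (2 * q + p) * ka u / kb u) * G u" for u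
  have hc: "continuous_on {0..t} h"
    unfolding h_def by (intro continuous_intros Gc) (auto simp: kb_nz)
  have wh: "w u = h u" if "u \<in> {0..t} - N" for u
  proof -
    have "g u = - (p * (2 * q + p) * ka u * G u)" using eq[OF that] G[of u] that by simp
    thus ?thesis unfolding w_def h_def by simp
  qed
  have Gh: "G u = integral {u..t} h" if "u \<in> {0..t}" for u
    unfolding G_def by (rule integral_spike[OF N]) (use that wh in auto)
  \<comment> \<open>The derivative of the tail integral is -h = p r (ka / kb) G, and the derivative
    of exp(-\<rho> u) kb(u) contributes the opposite term. So \<open>F\<close> is constant, and it
    vanishes at u = t.\<close>
  define F where "F u = exp (- (p + q) * u) * kb u * integral {u..t} h" for u
  have "(F has_real_derivative 0) (at u within {0..t})" if u: "u \<in> {0..t}" for u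
  proof -
    have nz: "kb u \<noteq> 0" using u by (intro kb_nz) auto
    have "(F has_real_derivative
       (((- (p + q) * exp (- (p + q) * u)) * kb u + ((p + q) * kb u - p * (2 * q + p) * ka u) * exp (- (p + q) * u)) * integral {u..t} h
        + (- h u) * (exp (- (p + q) * u) * kb u))) (at u within {0..t})"
      unfolding F_def[abs_def]
      by (intro DERIV_mult kb_deriv integral_has_real_derivative'[OF hc u]) (auto intro!: derivative_eq_intros)
    thus ?thesis
      by (rule DERIV_cong) (use nz in \<open>simp add: h_def Gh[OF u] field_simps\<close>)
  qed
  hence "\<exists>c. \<forall>x\<in>{0..t}. F x = c"
    by (intro has_field_derivative_zero_constant) auto
  moreover have "F t = 0" unfolding F_def by simp
  moreover have "t \<in> {0..t}" "s \<in> {0..t}" using t s by auto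
  ultimately have "F s = 0" by metis
  hence "G s = 0" using Gh[of s] s kb_pos[of s] unfolding F_def by auto
  thus ?thesis using eq[OF s] G[of s] s by simp
qed

text \<open>For almost every fixed t, the difference from \<open>kernel_l\<close> as a function of s
  solves the homogeneous equation. Slices of a Lebesgue measurable function of two variables need
  not be measurable, so Fubini is applied to a Borel version \<open>E0\<close> of \<open>l\<close>
  extended by zero.\<close>

lemma resolvent_unique:
  assumes l: "is_resolvent T (kernel_k p q) l"
  shows "AE (t, s) in lebesgue_on (volterra_triangle T). l t s = kernel_l p q t s"
proof -
  let ?D = "volterra_triangle T"
  have Dm: "?D \<in> lmeasurable" using compact_volterra_triangle by (rule lmeasurable_compact)
  hence Ds: "?D \<in> sets lebesgue" by (rule fmeasurableD)
  interpret D: finite_measure "lebesgue_on ?D" by (rule finite_measure_lebesgue_on[OF Dm])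
  have lm: "(\<lambda>x. l (fst x) (snd x)) \<in> borel_measurable (lebesgue_on ?D)"
    and lsq: "integrable (lebesgue_on ?D) (\<lambda>x. (l (fst x) (snd x))\<^sup>2)"
    and leq: "AE (t, s) in lebesgue_on ?D.
      l t s - kernel_k p q t s + (LINT u|lebesgue_on {s..t}. l t u * kernel_k p q u s) = 0"
    using l unfolding is_resolvent_def square_integrable_volterra_kernel_def
    by (auto simp: case_prod_unfold elim: eventually_mono)
  \<comment> \<open>The triangle has finite measure, so the constant 1 is square integrable and can
    serve as the second factor.\<close>
  have li: "integrable (lebesgue_on ?D) (\<lambda>x. l (fst x) (snd x))"
    using integrable_mult_if_squares[OF lm, of "\<lambda>_. 1"] lsq by simp
  define E where "E x = indicator ?D x * l (fst x) (snd x)" for x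
  have Ei: "integrable lebesgue E"
    using li Ds unfolding E_def by (simp add: integrable_restrict_space)
  obtain E0 where E0[measurable]: "E0 \<in> borel_measurable lborel" and EE0: "AE x in lborel. E x = E0 x"
    using completion_ex_borel_measurable_real[OF borel_measurable_integrable[OF Ei]] by blast
  have "integrable lebesgue E0"
    using Ei
  proof (rule Bochner_Integration.integrable_cong_AE[THEN iffD1, rotated 3])
    show "AE x in lebesgue. E x = E0 x" using EE0 by (simp add: AE_completion_iff)
  qed (use Ei in \<open>auto intro: measurable_completion\<close>)
  hence E0i: "integrable (lborel \<Otimes>\<^sub>M lborel) E0"
    by (simp add: integrable_completion lborel_prod)
  have sl: "AE t in lborel. integrable lborel (\<lambda>s. E0 (t, s))"
    using lborel_pair.AE_integrable_fst'[OF E0i] .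
  have "AE x in lborel. x \<in> ?D \<longrightarrow> l (fst x) (snd x) = E0 x \<and>
      l (fst x) (snd x) - kernel_k p q (fst x) (snd x) + (LINT u|lebesgue_on {snd x..fst x}. l (fst x) u * kernel_k p q u (snd x)) = 0"
  proof -
    have "AE x in lborel. x \<in> ?D \<longrightarrow>
      l (fst x) (snd x) - kernel_k p q (fst x) (snd x) + (LINT u|lebesgue_on {snd x..fst x}. l (fst x) u * kernel_k p q u (snd x)) = 0"
      using leq Ds by (simp add: AE_restrict_space_iff AE_completion_iff case_prod_beta)
    with EE0 show ?thesis by eventually_elim (auto simp: E_def)
  qed
  hence "AE x in lborel \<Otimes>\<^sub>M lborel. x \<in> ?D \<longrightarrow> l (fst x) (snd x) = E0 x \<and>
      l (fst x) (snd x) - kernel_k p q (fst x) (snd x) + (LINT u|lebesgue_on {snd x..fst x}. l (fst x) u * kernel_k p q u (snd x)) = 0"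
    by (simp only: lborel_prod)
  from lborel_pair.AE_pair[OF this]
  have eqs: "AE t in lborel. AE s in lborel. (t, s) \<in> ?D \<longrightarrow> l t s = E0 (t, s) \<and>
      l t s - kernel_k p q t s + (LINT u|lebesgue_on {s..t}. l t u * kernel_k p q u s) = 0"
    by simp
  have "AE t in lborel. AE s in lborel. (t, s) \<in> ?D \<longrightarrow> E0 (t, s) = kernel_l p q t s"
    using sl eqs
  proof eventually_elim
    case (elim t)
    show ?case
    proof (cases "0 \<le> t \<and> t \<le> T")
      case False
      then show ?thesis by (auto simp: volterra_triangle_def)
    next
      case True
      hence t: "0 \<le> t" "t \<le> T" by auto
      \<comment> \<open>\<open>N\<close> depends on t. It absorbs both the points where
        \<open>l\<close> differs from its Borel version and those where the resolvent equation
        fails.\<close>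
      from elim(2) obtain N where N: "N \<in> null_sets lborel"
        and ok': "\<And>s. s \<notin> N \<Longrightarrow> (t, s) \<in> ?D \<longrightarrow> l t s = E0 (t, s) \<and>
          l t s - kernel_k p q t s + (LINT u|lebesgue_on {s..t}. l t u * kernel_k p q u s) = 0"
        by (rule AE_E3) (rule that, auto)
      note ok = ok'[rule_format]
      have Nn: "negligible N"
        unfolding negligible_iff_null_sets using N by (rule null_sets_completionI)
      have inD: "(t, s) \<in> ?D" if "s \<in> {0..t}" for s using that t by (auto simp: volterra_triangle_def)
      have "(\<lambda>s. E0 (t, s)) absolutely_integrable_on {0..t}"
      proof -
        have "integrable lebesgue (\<lambda>s. E0 (t, s))"
          using elim(1) by (subst integrable_completion) auto
        hence "(\<lambda>s. E0 (t, s)) absolutely_integrable_on UNIV" by (simp add: set_integrable_def)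
        thus ?thesis by (rule set_integrable_subset) auto
      qed
      hence la: "(\<lambda>s. l t s) absolutely_integrable_on {0..t}"
        by (rule absolutely_integrable_spike[OF _ Nn]) (use ok inD in auto)
      have kc: "continuous_on {0..t} (\<lambda>s. kernel_l p q t s)"
      proof -
        have "continuous_on {0..t} (\<lambda>s. p * (2 * q + p) * exp (- (p + q) * t) * exp ((p + q) * s) * ka s / kb s)"
          by (intro continuous_intros) (auto simp: kb_nz)
        thus ?thesis by (rule continuous_on_cong[THEN iffD1, rotated 2]) (auto simp: kernel_l_eq)
      qed
      have ka: "(\<lambda>s. kernel_l p q t s) absolutely_integrable_on {0..t}"
        by (rule absolutely_integrable_continuous_real[OF kc])
      have "l t s - kernel_l p q t s = 0" if s: "s \<in> {0..t} - N" for s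
      proof (rule homogeneous_equation_trivial[OF t(1) _ Nn _ s])
        show "(\<lambda>s. l t s - kernel_l p q t s) absolutely_integrable_on {0..t}"
          using la ka by (rule set_integral_diff)
        fix s assume s: "s \<in> {0..t} - N"
        have prod: "integrable (lebesgue_on {s..t}) (\<lambda>u. f u * kernel_k p q u s)"
          if f: "f absolutely_integrable_on {0..t}" for f
        proof (rule absolutely_integrable_imp_integrable)
          have fs: "f absolutely_integrable_on {s..t}"
            by (rule set_integrable_subset[OF f]) (use s in auto)
          have kk: "continuous_on {s..t} (\<lambda>u. kernel_k p q u s)"
            unfolding kernel_k_eq using s by (intro continuous_intros) (auto simp: kb_nz)
          have "(\<lambda>u. kernel_k p q u s * f u) absolutely_integrable_on {s..t}"
            by (rule absolutely_integrable_bounded_measurable_product_real[OF _ _ _ fs])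
              (auto intro!: continuous_imp_measurable_on_sets_lebesgue[OF kk] compact_imp_bounded compact_continuous_image[OF kk])
          thus "(\<lambda>u. f u * kernel_k p q u s) absolutely_integrable_on {s..t}" by (simp add: mult.commute)
        qed simp
        have "(LINT u|lebesgue_on {s..t}. (l t u - kernel_l p q t u) * kernel_k p q u s) =
            (LINT u|lebesgue_on {s..t}. l t u * kernel_k p q u s) - (LINT u|lebesgue_on {s..t}. kernel_l p q t u * kernel_k p q u s)"
          unfolding left_diff_distrib by (rule Bochner_Integration.integral_diff[OF prod[OF la] prod[OF ka]])
        moreover have "l t s - kernel_k p q t s + (LINT u|lebesgue_on {s..t}. l t u * kernel_k p q u s) = 0"
          using ok s inD by blast
        ultimately show "l t s - kernel_l p q t s + (LINT u|lebesgue_on {s..t}. (l t u - kernel_l p q t u) * kernel_k p q u s) = 0"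
          using convolution_l_k[of s t] s by simp
      qed
      hence "(t, s) \<in> ?D \<longrightarrow> E0 (t, s) = kernel_l p q t s" if "s \<notin> N" for s
        using that ok[OF that] by (auto simp: volterra_triangle_def)
      thus ?thesis using AE_not_in[OF N] by (auto elim: eventually_mono)
    qed
  qed
  hence slices: "AE t in lborel. AE s in lborel.
      (t, s) \<in> ?D \<longrightarrow> E0 (t, s) = kernel_l p q (fst (t, s)) (snd (t, s))" by simp
  have "AE x in lborel \<Otimes>\<^sub>M lborel. x \<in> ?D \<longrightarrow> E0 x = kernel_l p q (fst x) (snd x)"
  proof (rule lborel_pair.AE_pair_measure[OF _ slices])
    have D: "?D \<in> sets (lborel \<Otimes>\<^sub>M lborel)"
      unfolding lborel_prod using compact_imp_closed[OF compact_volterra_triangle] by (simp add: borel_closed)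
    have E0': "E0 \<in> borel_measurable (lborel \<Otimes>\<^sub>M lborel)" using E0 by (simp only: lborel_prod)
    have k: "(\<lambda>x. kernel_l p q (fst x) (snd x)) \<in> borel_measurable (lborel \<Otimes>\<^sub>M lborel)"
      unfolding kernel_l_def by measurable
    have "{x \<in> space (lborel \<Otimes>\<^sub>M lborel). E0 x \<noteq> kernel_l p q (fst x) (snd x)} \<in> sets (lborel \<Otimes>\<^sub>M lborel)"
      by (rule borel_measurable_neq[OF E0' k])
    from sets.Diff[OF sets.top sets.Int[OF D this]]
    show "{x \<in> space (lborel \<Otimes>\<^sub>M lborel). x \<in> ?D \<longrightarrow> E0 x = kernel_l p q (fst x) (snd x)} \<in> sets (lborel \<Otimes>\<^sub>M lborel)"
      by (rule back_subst[where P = "\<lambda>S. S \<in> sets (lborel \<Otimes>\<^sub>M lborel)"]) auto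
  qed
  hence "AE x in lborel. x \<in> ?D \<longrightarrow> E0 x = kernel_l p q (fst x) (snd x)" by (simp only: lborel_prod)
  with EE0 have "AE x in lborel. x \<in> ?D \<longrightarrow> l (fst x) (snd x) = kernel_l p q (fst x) (snd x)"
    by eventually_elim (auto simp: E_def)
  thus ?thesis using Ds by (simp add: AE_restrict_space_iff AE_completion_iff case_prod_beta)
qed

end

section \<open>The innovation as a functional of paths\<close>

lemma integral_lborel_exp_Iic:
  fixes c :: real
  assumes c: "0 < c"
  shows "integrable lborel (\<lambda>u. indicator {..0} u * exp (c * u))"
    and "(LINT u|lborel. indicator {..0} u * exp (c * u)) = 1 / c"
proof -
  have h: "((\<lambda>x. exp (- c * x)) has_integral 1 / c) {0..}"
    using has_integral_exp_minus_to_infinity[OF c, of 0] by simp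
  hence "(\<lambda>x. exp (- c * x)) absolutely_integrable_on {0..}"
    by (intro nonnegative_absolutely_integrable_1) auto
  hence s: "set_integrable lborel {0..} (\<lambda>x. exp (- c * x))"
    unfolding set_integrable_def by (subst (asm) integrable_completion) auto
  have "has_bochner_integral lborel (\<lambda>u. indicator {0..} u * exp (- c * u)) (1 / c)"
    using s set_borel_integral_eq_integral(2)[OF s] integral_unique[OF h]
    by (simp add: has_bochner_integral_iff set_integrable_def set_lebesgue_integral_def)
  moreover have "indicator {0..} u * exp (- c * u) = indicator {..0} (0 + - 1 * u) * exp (c * (0 + - 1 * u))" for u :: real
    by (simp add: indicator_def)
  ultimately have "has_bochner_integral lborel (\<lambda>u. indicator {..0} (0 + - 1 * u) * exp (c * (0 + - 1 * u))) (1 / c)"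
    by simp
  hence "has_bochner_integral lborel (\<lambda>u. indicator {..0} u * exp (c * u)) (1 / c)"
    by (subst lborel_has_bochner_integral_real_affine_iff[of "- 1" _ _ 0]) simp_all
  thus "integrable lborel (\<lambda>u. indicator {..0} u * exp (c * u))"
    and "(LINT u|lborel. indicator {..0} u * exp (c * u)) = 1 / c"
    by (auto simp: has_bochner_integral_iff)
qed

lemma constant_if_zero_deriv_interval:
  fixes D :: "real \<Rightarrow> real"
  assumes "\<And>s. s \<in> {0..T} \<Longrightarrow> (D has_real_derivative 0) (at s within {0..T})" and "t \<in> {0..T}"
  shows "D t = D 0"
proof -
  have "\<exists>c. \<forall>x\<in>{0..T}. D x = c"
    by (rule has_field_derivative_zero_constant) (use assms in auto)
  thus ?thesis using assms(2) by force
qed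

context volterra_parameters
begin

definition ka_deriv :: "real \<Rightarrow> real"
  where "ka_deriv s = q * ((2 * q + p) * exp (q * s) + p * exp (- q * s))"

lemma ka_has_deriv: "(ka has_real_derivative ka_deriv t) (at t within S)"
  unfolding ka_def[abs_def] ka_deriv_def
  by (auto intro!: derivative_eq_intros simp: algebra_simps)

lemma ka_deriv_continuous[continuous_intros]: "continuous_on S f \<Longrightarrow> continuous_on S (\<lambda>x. ka_deriv (f x))"
  unfolding ka_deriv_def by (intro continuous_intros)

definition kb_deriv_fun :: "real \<Rightarrow> real"
  where "kb_deriv_fun t = (p + q) * kb t - p * (2 * q + p) * ka t"

lemma kb_has_deriv: "(kb has_real_derivative kb_deriv_fun t) (at t within S)"
  unfolding kb_deriv_fun_def by (rule kb_deriv)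

lemma kb_deriv_fun_continuous[continuous_intros]: "continuous_on S f \<Longrightarrow> continuous_on S (\<lambda>x. kb_deriv_fun (f x))"
  unfolding kb_deriv_fun_def by (intro continuous_intros)

text \<open>The processes of the theorem as functionals of continuous paths: \<open>stat_path y w\<close> is
  the stationary Ornstein-Uhlenbeck process driven by \<open>w\<close> with initial value \<open>y\<close>,
  \<open>filter_path v s\<close> is \<open>\<integral>\<^sub>0\<^sup>s k(s,u) dv(u)\<close>, and \<open>volterra_path b s\<close> is \<open>\<integral>\<^sub>0\<^sup>s l(s,u) db(u)\<close>,
  both written without stochastic integrals by integration by parts.\<close>

definition stat_path :: "real \<Rightarrow> (real \<Rightarrow> real) \<Rightarrow> real \<Rightarrow> real"
  where "stat_path y w s = exp (- (p + q) * s) *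
    (y + (p * exp ((p + q) * s) * w s - integral {0..s} (\<lambda>u. p * (p + q) * exp ((p + q) * u) * w u)))"

definition filter_path :: "(real \<Rightarrow> real) \<Rightarrow> real \<Rightarrow> real"
  where "filter_path v s = p * (2 * q + p) / kb s * (ka s * v s - integral {0..s} (\<lambda>u. ka_deriv u * v u))"

definition innovation :: "(real \<Rightarrow> real) \<Rightarrow> real \<Rightarrow> real"
  where "innovation v t = v t + integral {0..t} (filter_path v)"

text \<open>The factor of l that depends on the integration variable: l(s,u) = exp(-\<rho> s) kc(u)
  for 0 \<le> u.\<close>

definition kc :: "real \<Rightarrow> real"
  where "kc u = p * (2 * q + p) * exp ((p + q) * u) * ka u / kb u"

definition kc_deriv :: "real \<Rightarrow> real"
  where "kc_deriv u = p * (2 * q + p) * exp ((p + q) * u) / kb u * (p * (2 * q + p) * ka u / kb u * ka u + ka_deriv u)"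

definition volterra_path :: "(real \<Rightarrow> real) \<Rightarrow> real \<Rightarrow> real"
  where "volterra_path b s = exp (- (p + q) * s) * (kc s * b s - integral {0..s} (\<lambda>u. kc_deriv u * b u))"

text \<open>Since kb' / kb = \<rho> - p r ka / kb, the terms in \<rho> cancel and the logarithmic
  derivative of exp(\<rho> t) / kb(t) is p r ka / kb.\<close>

lemma exp_kb_deriv:
  assumes "kb t \<noteq> 0"
  shows "((\<lambda>t. p * (2 * q + p) * exp ((p + q) * t) / kb t) has_real_derivative
    p * (2 * q + p) * exp ((p + q) * t) / kb t * (p * (2 * q + p) * ka t / kb t)) (at t within S)"
proof -
  have "((\<lambda>t. p * (2 * q + p) * exp ((p + q) * t) / kb t) has_real_derivative
    ((p * (2 * q + p) * ((p + q) * exp ((p + q) * t))) * kb t - (p * (2 * q + p) * exp ((p + q) * t)) * kb_deriv_fun t) / (kb t * kb t)) (at t within S)"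
    by (rule DERIV_divide[OF _ kb_has_deriv assms]) (auto intro!: derivative_eq_intros)
  thus ?thesis
    by (rule DERIV_cong) (use assms in \<open>simp add: kb_deriv_fun_def field_simps\<close>)
qed

lemma kc_has_deriv:
  assumes "kb t \<noteq> 0"
  shows "(kc has_real_derivative kc_deriv t) (at t within S)"
proof -
  have "kc = (\<lambda>t. (p * (2 * q + p) * exp ((p + q) * t) / kb t) * ka t)" by (auto simp: kc_def)
  moreover have "((\<lambda>t. (p * (2 * q + p) * exp ((p + q) * t) / kb t) * ka t) has_real_derivative
    (p * (2 * q + p) * exp ((p + q) * t) / kb t * (p * (2 * q + p) * ka t / kb t)) * ka t + ka_deriv t * (p * (2 * q + p) * exp ((p + q) * t) / kb t)) (at t within S)"
    by (intro DERIV_mult exp_kb_deriv[OF assms] ka_has_deriv)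
  moreover have alg: "E * X * a + a' * E = E * (X * a + a')" for E X a a' :: real
    by (simp add: algebra_simps)
  ultimately show ?thesis unfolding kc_deriv_def alg by (simp only:)
qed

lemma kc_deriv_continuous: "continuous_on {0..T} kc_deriv"
  unfolding kc_deriv_def by (intro continuous_intros) (auto simp: kb_nz)

lemma kc_continuous: "continuous_on {0..T} kc"
  unfolding kc_def by (intro continuous_intros) (auto simp: kb_nz)

lemma indefinite_integral_continuous_on:
  fixes f :: "real \<Rightarrow> real"
  shows "continuous_on {0..T} f \<Longrightarrow> continuous_on {0..T} (\<lambda>s. integral {0..s} f)"
  by (intro indefinite_integral_continuous_1 integrable_continuous_real)

lemma stat_path_continuous:
  assumes "continuous_on {0..T} w"
  shows "continuous_on {0..T} (stat_path y w)"
  unfolding stat_path_def by (intro continuous_intros indefinite_integral_continuous_on assms)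

lemma filter_path_continuous:
  assumes "continuous_on {0..T} v"
  shows "continuous_on {0..T} (filter_path v)"
  unfolding filter_path_def by (intro continuous_intros indefinite_integral_continuous_on assms) (auto simp: kb_nz)

lemma innovation_continuous:
  assumes "continuous_on {0..T} v"
  shows "continuous_on {0..T} (innovation v)"
  unfolding innovation_def
  by (intro continuous_intros indefinite_integral_continuous_on filter_path_continuous assms)

lemma volterra_path_continuous:
  assumes "continuous_on {0..T} b"
  shows "continuous_on {0..T} (volterra_path b)"
  unfolding volterra_path_def
  by (intro continuous_intros indefinite_integral_continuous_on kc_continuous kc_deriv_continuous assms)

lemma exp_cancel: "exp (- (p + q) * s) * exp ((p + q) * s) = 1"
  by (simp add: exp_add[symmetric] algebra_simps)

text \<open>This is the pathwise form of the resolvent equation, and it makes the passage from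
  \<open>v\<close> to its innovation invertible.\<close>

lemma volterra_path_innovation:
  assumes v: "continuous_on {0..T} v" and s: "s \<in> {0..T}"
  shows "volterra_path (innovation v) s = filter_path v s"
proof -
  define Im where "Im s = integral {0..s} (filter_path v)" for s
  define Ia where "Ia s = integral {0..s} (\<lambda>u. ka_deriv u * v u)" for s
  define Ic where "Ic s = integral {0..s} (\<lambda>u. kc_deriv u * innovation v u)" for s
  define E where "E t = p * (2 * q + p) * exp ((p + q) * t) / kb t" for t
  have c: "continuous_on {0..T} (\<lambda>u. ka_deriv u * v u)" "continuous_on {0..T} (\<lambda>u. kc_deriv u * innovation v u)"
    by (intro continuous_intros v kc_deriv_continuous innovation_continuous)+
  \<comment> \<open>\<open>D\<close> is exp(\<rho> s) times the difference of the two sides of the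
    claim. The terms kc(s) v(s) have cancelled, so \<open>D\<close> is differentiable although
    \<open>v\<close> is merely continuous.\<close>
  define D where "D s = E s * Ia s + kc s * Im s - Ic s" for s
  have D': "(D has_real_derivative 0) (at s within {0..T})" if s: "s \<in> {0..T}" for s
  proof -
    have nz: "kb s \<noteq> 0" using s by (intro kb_nz) auto
    have "(E has_real_derivative E s * (p * (2 * q + p) * ka s / kb s)) (at s within {0..T})"
      unfolding E_def[abs_def] by (rule exp_kb_deriv[OF nz])
    moreover have "(Ia has_real_derivative ka_deriv s * v s) (at s within {0..T})"
      unfolding Ia_def[abs_def] by (rule integral_has_real_derivative[OF c(1) s])
    moreover have "(Im has_real_derivative filter_path v s) (at s within {0..T})"
      unfolding Im_def[abs_def] by (rule integral_has_real_derivative[OF filter_path_continuous[OF v] s])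
    moreover have "(Ic has_real_derivative kc_deriv s * innovation v s) (at s within {0..T})"
      unfolding Ic_def[abs_def] by (rule integral_has_real_derivative[OF c(2) s])
    ultimately have "(D has_real_derivative
      (E s * (p * (2 * q + p) * ka s / kb s)) * Ia s + ka_deriv s * v s * E s
      + (kc_deriv s * Im s + filter_path v s * kc s) - kc_deriv s * innovation v s) (at s within {0..T})"
      unfolding D_def[abs_def] by (intro DERIV_diff DERIV_add DERIV_mult kc_has_deriv[OF nz])
    moreover have "(E s * (p * (2 * q + p) * ka s / kb s)) * Ia s + ka_deriv s * v s * E s
      + (kc_deriv s * Im s + filter_path v s * kc s) - kc_deriv s * innovation v s = 0"
    proof -
      define P where "P = p * (2 * q + p)"
      have 1: "innovation v s = v s + Im s" by (simp add: innovation_def Im_def)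
      have 2: "kc_deriv s = E s * (p * (2 * q + p) * ka s / kb s * ka s + ka_deriv s)"
        by (simp add: kc_deriv_def E_def)
      have 3: "kc s = E s * ka s" by (simp add: kc_def E_def)
      have 4: "filter_path v s = p * (2 * q + p) / kb s * (ka s * v s - Ia s)"
        by (simp add: filter_path_def Ia_def)
      show ?thesis unfolding 1 2 3 4 P_def[symmetric] using nz by (simp add: field_simps)
    qed
    ultimately show ?thesis by simp
  qed
  have "D s = D 0" by (rule constant_if_zero_deriv_interval[OF D' s])
  also have "D 0 = 0" by (simp add: D_def Ia_def Im_def Ic_def)
  finally have D0: "E s * Ia s + kc s * Im s - Ic s = 0" by (simp add: D_def)
  have "kc s * innovation v s - Ic s = kc s * v s - E s * Ia s"
    using D0 by (simp add: innovation_def Im_def[symmetric] algebra_simps)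
  also have "\<dots> = exp ((p + q) * s) * filter_path v s"
    by (simp add: kc_def E_def filter_path_def Ia_def algebra_simps diff_divide_distrib add_divide_distrib)
  finally have "volterra_path (innovation v) s = exp (- (p + q) * s) * (exp ((p + q) * s) * filter_path v s)"
    by (simp add: volterra_path_def Ic_def)
  also have "\<dots> = filter_path v s"
    by (simp only: mult.assoc[symmetric] exp_cancel mult_1_left)
  finally show ?thesis .
qed

lemma innovation_inverse:
  assumes v: "continuous_on {0..T} v" and t: "t \<in> {0..T}"
  shows "v t = innovation v t - integral {0..t} (volterra_path (innovation v))"
proof -
  have "integral {0..t} (volterra_path (innovation v)) = integral {0..t} (filter_path v)"
    by (rule Henstock_Kurzweil_Integration.integral_cong) (use t in \<open>auto intro!: volterra_path_innovation[OF v]\<close>)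
  thus ?thesis by (simp add: innovation_def)
qed

section \<open>The filtering error, and the innovation as a Wiener integral with its
  covariance\<close>

definition kh :: "real \<Rightarrow> real"
  where "kh u = p * kb u - p * (2 * q + p) * ka u"

definition kh_deriv :: "real \<Rightarrow> real"
  where "kh_deriv u = p * kb_deriv_fun u - p * (2 * q + p) * ka_deriv u"

definition kH :: "real \<Rightarrow> real"
  where "kH t = integral {0..t} (\<lambda>u. 1 / kb u)"

text \<open>The coefficient of dW(u) in B(t) for 0 \<le> u \<le> t. In B = W - \<integral> g the
  error g(s) contains the integral of kh dW divided by kb(s); exchanging the order of integration
  leaves kh(u) times the integral of 1 / kb from u to t.\<close>

definition weight :: "real \<Rightarrow> real \<Rightarrow> real"
  where "weight t u = 1 - kh u * (kH t - kH u)"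

definition weight_deriv :: "real \<Rightarrow> real \<Rightarrow> real"
  where "weight_deriv t u = kh u / kb u - kh_deriv u * (kH t - kH u)"

lemma kh_has_deriv: "(kh has_real_derivative kh_deriv t) (at t within S)"
  unfolding kh_def[abs_def] kh_deriv_def
  by (intro DERIV_diff DERIV_cmult kb_has_deriv ka_has_deriv)

lemma kh_continuous[continuous_intros]: "continuous_on S f \<Longrightarrow> continuous_on S (\<lambda>x. kh (f x))"
  unfolding kh_def by (intro continuous_intros)

lemma kh_deriv_continuous[continuous_intros]: "continuous_on S f \<Longrightarrow> continuous_on S (\<lambda>x. kh_deriv (f x))"
  unfolding kh_deriv_def by (intro continuous_intros)

lemma inverse_kb_continuous: "continuous_on {0..T} (\<lambda>u. 1 / kb u)"
  by (intro continuous_intros) (auto simp: kb_nz)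

lemma kH_has_deriv: "s \<in> {0..T} \<Longrightarrow> (kH has_real_derivative 1 / kb s) (at s within {0..T})"
  unfolding kH_def[abs_def] by (rule integral_has_real_derivative[OF inverse_kb_continuous])

lemma kH_continuous: "continuous_on {0..T} kH"
  unfolding kH_def by (rule indefinite_integral_continuous_on[OF inverse_kb_continuous])

lemma kH_0[simp]: "kH 0 = 0"
  by (simp add: kH_def)

lemma weight_has_deriv: "u \<in> {0..T} \<Longrightarrow> (weight t has_real_derivative weight_deriv t u) (at u within {0..T})"
  unfolding weight_def[abs_def] weight_deriv_def
  by (rule DERIV_cong[OF DERIV_diff[OF DERIV_const DERIV_mult[OF kh_has_deriv DERIV_diff[OF DERIV_const kH_has_deriv]]]])
    (auto simp: algebra_simps)

lemma weight_deriv_continuous: "continuous_on {0..T} (weight_deriv t)"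
  unfolding weight_deriv_def[abs_def] by (intro continuous_intros kH_continuous) (auto simp: kb_nz)

lemma weight_continuous: "continuous_on {0..T} (weight t)"
  using weight_has_deriv DERIV_continuous_on by blast

text \<open>The filtering error \<open>g = y - m\<close> satisfies \<open>d(kb g) = kh dw\<close>: the drift cancels.\<close>

lemma filter_error:
  assumes w: "continuous_on {0..T} w" and s: "s \<in> {0..T}"
    and v: "\<And>t. t \<in> {0..T} \<Longrightarrow> v t = w t - integral {0..t} (stat_path y w)"
  shows "kb s * (stat_path y w s - filter_path v s) = kb 0 * y + kh s * w s - integral {0..s} (\<lambda>u. kh_deriv u * w u)"
proof -
  define J where "J s = integral {0..s} (\<lambda>u. p * (p + q) * exp ((p + q) * u) * w u)" for s
  \<comment> \<open>\<open>R\<close> is the stationary process without its rough part p w. It is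
    differentiable, with derivative -\<rho> times \<open>stat_path y w\<close>.\<close>
  define R where "R s = exp (- (p + q) * s) * (y - J s)" for s
  define Iy where "Iy s = integral {0..s} (stat_path y w)" for s
  define Ia where "Ia s = integral {0..s} (\<lambda>u. ka_deriv u * v u)" for s
  define Ih where "Ih s = integral {0..s} (\<lambda>u. kh_deriv u * w u)" for s
  have yR: "stat_path y w s = p * w s + R s" for s
  proof -
    have "stat_path y w s = p * (exp (- (p + q) * s) * exp ((p + q) * s)) * w s + R s"
      unfolding stat_path_def R_def J_def by (simp add: algebra_simps)
    thus ?thesis unfolding exp_cancel by simp
  qed
  have yc: "continuous_on {0..T} (stat_path y w)" by (rule stat_path_continuous[OF w])
  have vc: "continuous_on {0..T} v"
  proof -
    have "continuous_on {0..T} (\<lambda>t. w t - integral {0..t} (stat_path y w))"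
      by (intro continuous_intros w indefinite_integral_continuous_on yc)
    thus ?thesis by (rule continuous_on_cong[THEN iffD1, rotated 2]) (simp_all add: v)
  qed
  have c: "continuous_on {0..T} (\<lambda>u. p * (p + q) * exp ((p + q) * u) * w u)"
    "continuous_on {0..T} (\<lambda>u. ka_deriv u * v u)" "continuous_on {0..T} (\<lambda>u. kh_deriv u * w u)"
    by (intro continuous_intros w vc)+
  \<comment> \<open>\<open>D\<close> is kb g - kh w + Ih, written so that \<open>w\<close> occurs
    only under integrals. The claim is that it keeps its initial value.\<close>
  define D where "D s = kb s * R s + p * (2 * q + p) * (ka s * Iy s) + p * (2 * q + p) * Ia s + Ih s" for s
  have D': "(D has_real_derivative 0) (at s within {0..T})" if s: "s \<in> {0..T}" for s
  proof -
    have dJ: "(J has_real_derivative p * (p + q) * exp ((p + q) * s) * w s) (at s within {0..T})"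
      unfolding J_def[abs_def] by (rule integral_has_real_derivative[OF c(1) s])
    have "(R has_real_derivative (- (p + q) * exp (- (p + q) * s)) * (y - J s)
        + (0 - p * (p + q) * exp ((p + q) * s) * w s) * exp (- (p + q) * s)) (at s within {0..T})"
      unfolding R_def[abs_def] by (intro DERIV_mult DERIV_diff DERIV_const dJ) (auto intro!: derivative_eq_intros)
    moreover have "(- (p + q) * exp (- (p + q) * s)) * (y - J s)
        + (0 - p * (p + q) * exp ((p + q) * s) * w s) * exp (- (p + q) * s) = - (p + q) * stat_path y w s"
    proof -
      have "(- (p + q) * exp (- (p + q) * s)) * (y - J s)
        + (0 - p * (p + q) * exp ((p + q) * s) * w s) * exp (- (p + q) * s)
        = - (p + q) * R s - p * (p + q) * (exp (- (p + q) * s) * exp ((p + q) * s)) * w s"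
        unfolding R_def by (simp add: algebra_simps)
      thus ?thesis unfolding exp_cancel yR by (simp add: algebra_simps)
    qed
    ultimately have dR: "(R has_real_derivative - (p + q) * stat_path y w s) (at s within {0..T})" by simp
    have dIy: "(Iy has_real_derivative stat_path y w s) (at s within {0..T})"
      unfolding Iy_def[abs_def] by (rule integral_has_real_derivative[OF yc s])
    have dIa: "(Ia has_real_derivative ka_deriv s * v s) (at s within {0..T})"
      unfolding Ia_def[abs_def] by (rule integral_has_real_derivative[OF c(2) s])
    have dIh: "(Ih has_real_derivative kh_deriv s * w s) (at s within {0..T})"
      unfolding Ih_def[abs_def] by (rule integral_has_real_derivative[OF c(3) s])
    have "(D has_real_derivative (kb_deriv_fun s * R s + (- (p + q) * stat_path y w s) * kb s)
        + p * (2 * q + p) * (ka_deriv s * Iy s + stat_path y w s * ka s)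
        + p * (2 * q + p) * (ka_deriv s * v s) + kh_deriv s * w s) (at s within {0..T})"
      unfolding D_def[abs_def]
      by (intro DERIV_add DERIV_mult DERIV_cmult kb_has_deriv ka_has_deriv dR dIy dIa dIh)
    moreover have "(kb_deriv_fun s * R s + (- (p + q) * stat_path y w s) * kb s)
        + p * (2 * q + p) * (ka_deriv s * Iy s + stat_path y w s * ka s)
        + p * (2 * q + p) * (ka_deriv s * v s) + kh_deriv s * w s = 0"
    proof -
      have vs: "v s = w s - Iy s" using v[OF s] by (simp add: Iy_def)
      show ?thesis unfolding vs yR kh_deriv_def kb_deriv_fun_def by (simp add: algebra_simps)
    qed
    ultimately show ?thesis by simp
  qed
  have "D s = D 0" by (rule constant_if_zero_deriv_interval[OF D' s])
  also have "D 0 = kb 0 * y" by (simp add: D_def R_def J_def Iy_def Ia_def Ih_def)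
  finally have Ds: "D s = kb 0 * y" .
  have nz: "kb s \<noteq> 0" using s by (intro kb_nz) auto
  have "kb s * filter_path v s = p * (2 * q + p) * (ka s * v s - Ia s)"
    using nz by (simp add: filter_path_def Ia_def)
  moreover have "v s = w s - Iy s" using v[OF s] by (simp add: Iy_def)
  ultimately have "kb s * (stat_path y w s - filter_path v s) = kh s * w s + D s - Ih s"
    unfolding D_def yR kh_def by (simp add: algebra_simps)
  thus ?thesis unfolding Ds Ih_def by simp
qed

text \<open>The innovation is w - \<integral> g with the error g from \<open>filter_error\<close>.
  The resulting double integral is turned around by integrating by parts against \<open>kH\<close>,
  a primitive of 1 / kb.\<close>

lemma innovation_representation:
  assumes w: "continuous_on {0..T} w" and t: "t \<in> {0..T}"
    and v: "\<And>t. t \<in> {0..T} \<Longrightarrow> v t = w t - integral {0..t} (stat_path y w)"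
  shows "innovation v t = - (kb 0 * kH t) * y + (weight t t * w t - integral {0..t} (\<lambda>u. weight_deriv t u * w u))"
proof -
  define Ih where "Ih s = integral {0..s} (\<lambda>u. kh_deriv u * w u)" for s
  define g where "g s = stat_path y w s - filter_path v s" for s
  define Ig where "Ig s = integral {0..s} g" for s
  define Ik where "Ik s = integral {0..s} (\<lambda>u. (kh u / kb u + kH u * kh_deriv u) * w u)" for s
  have yc: "continuous_on {0..T} (stat_path y w)" by (rule stat_path_continuous[OF w])
  have vc: "continuous_on {0..T} v"
  proof -
    have "continuous_on {0..T} (\<lambda>t. w t - integral {0..t} (stat_path y w))"
      by (intro continuous_intros w indefinite_integral_continuous_on yc)
    thus ?thesis by (rule continuous_on_cong[THEN iffD1, rotated 2]) (simp_all add: v)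
  qed
  have gc: "continuous_on {0..T} g" unfolding g_def by (intro continuous_intros yc filter_path_continuous vc)
  have c: "continuous_on {0..T} (\<lambda>u. kh_deriv u * w u)"
    "continuous_on {0..T} (\<lambda>u. (kh u / kb u + kH u * kh_deriv u) * w u)"
    by (intro continuous_intros w kH_continuous; auto simp: kb_nz)+
  have D': "((\<lambda>s. kH s * (kb 0 * y - Ih s) + Ik s - Ig s) has_real_derivative 0) (at s within {0..T})"
    if s: "s \<in> {0..T}" for s
  proof -
    have nz: "kb s \<noteq> 0" using s by (intro kb_nz) auto
    have dIh: "(Ih has_real_derivative kh_deriv s * w s) (at s within {0..T})"
      unfolding Ih_def[abs_def] by (rule integral_has_real_derivative[OF c(1) s])
    have dIk: "(Ik has_real_derivative (kh s / kb s + kH s * kh_deriv s) * w s) (at s within {0..T})"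
      unfolding Ik_def[abs_def] by (rule integral_has_real_derivative[OF c(2) s])
    have dIg: "(Ig has_real_derivative g s) (at s within {0..T})"
      unfolding Ig_def[abs_def] by (rule integral_has_real_derivative[OF gc s])
    have "((\<lambda>s. kH s * (kb 0 * y - Ih s) + Ik s - Ig s) has_real_derivative
      (1 / kb s) * (kb 0 * y - Ih s) + (0 - kh_deriv s * w s) * kH s + (kh s / kb s + kH s * kh_deriv s) * w s - g s) (at s within {0..T})"
      by (intro DERIV_diff DERIV_add DERIV_mult DERIV_const kH_has_deriv s dIh dIk dIg)
    moreover have "g s = (kb 0 * y + kh s * w s - Ih s) / kb s"
      using filter_error[OF w s v] nz unfolding g_def Ih_def by (simp add: field_simps)
    hence "(1 / kb s) * (kb 0 * y - Ih s) + (0 - kh_deriv s * w s) * kH s + (kh s / kb s + kH s * kh_deriv s) * w s - g s = 0"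
      by (simp add: algebra_simps add_divide_distrib diff_divide_distrib)
    ultimately show ?thesis by simp
  qed
  from constant_if_zero_deriv_interval[OF D' t]
  have Ig: "Ig t = kH t * (kb 0 * y - Ih t) + Ik t" by (simp add: Ih_def Ik_def Ig_def)
  have sub: "{0..t} \<subseteq> {0..T}" using t by auto
  have int: "f integrable_on {0..t}" if "continuous_on {0..T} f" for f :: "real \<Rightarrow> real"
    by (intro integrable_continuous_real continuous_on_subset[OF that sub])
  have "integral {0..t} (\<lambda>u. weight_deriv t u * w u) =
      integral {0..t} (\<lambda>u. (kh u / kb u + kH u * kh_deriv u) * w u - kH t * (kh_deriv u * w u))"
    by (rule Henstock_Kurzweil_Integration.integral_cong) (simp add: weight_deriv_def algebra_simps)
  also have "\<dots> = Ik t - kH t * Ih t"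
    unfolding Ik_def Ih_def
    by (subst Henstock_Kurzweil_Integration.integral_diff) (auto intro!: int c continuous_intros integrable_on_mult_right)
  finally have wd: "integral {0..t} (\<lambda>u. weight_deriv t u * w u) = Ik t - kH t * Ih t" .
  have "Ig t = integral {0..t} (stat_path y w) - integral {0..t} (filter_path v)"
    unfolding Ig_def g_def by (intro Henstock_Kurzweil_Integration.integral_diff int yc filter_path_continuous vc)
  hence "innovation v t = w t - Ig t" using v[OF t] by (simp add: innovation_def)
  thus ?thesis unfolding Ig wd by (simp add: weight_def algebra_simps)
qed

text \<open>The integrand on the whole line whose Wiener integral is B(t). The half-line part
  carries the initial value y(0), the integral of p exp(\<rho> u) over u \<le> 0; the other part is
  driven by W after time 0.\<close>

definition innovation_kernel :: "real \<Rightarrow> real \<Rightarrow> real"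
  where "innovation_kernel t u = - (kb 0 * kH t) * (indicator {..0} u * (p * exp ((p + q) * u))) + indicator {0..t} u * weight t u"

lemma kh_eq: "kh u = 2 * p\<^sup>2 * q * exp (- q * u)"
  unfolding kh_def ka_def kb_def by (simp add: power2_eq_square algebra_simps)

lemma kh_deriv_eq: "kh_deriv u = - q * kh u"
  unfolding kh_eq kh_deriv_def kb_deriv_fun_def ka_def kb_def ka_deriv_def
  by (simp add: power2_eq_square algebra_simps)

text \<open>The Riccati equation of P = kh / kb cleared of denominators: as kb' = (q + P) kb, the
  derivative of kh kb = P kb^2 is P^2 kb^2.\<close>

lemma kh_kb_deriv: "kh_deriv u * kb u + kb_deriv_fun u * kh u = (kh u)\<^sup>2"
proof -
  have "kb_deriv_fun u - q * kb u = kh u"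
    unfolding kb_deriv_fun_def kh_def by (simp add: algebra_simps)
  hence "(kb_deriv_fun u - q * kb u) * kh u = kh u * kh u" by simp
  thus ?thesis unfolding kh_deriv_eq power2_eq_square by (simp add: algebra_simps)
qed

text \<open>Put a = kH(s) - kH(u) and b = kH(t) - kH(u). By \<open>kh_kb_deriv\<close> and kH' = 1 /
  kb the derivative of kh kb a b is kh^2 a b - kh (a + b); adding 1 gives (1 - kh a) (1 - kh b). At
  u = s the product vanishes, at u = 0 it leaves the correction term.\<close>

lemma weight_covariance:
  assumes "0 \<le> s" "s \<le> t"
  shows "(LINT u|lebesgue_on {0..s}. weight s u * weight t u) = s - kh 0 * kb 0 * kH s * kH t"
proof -
  let ?F = "\<lambda>u. u + kh u * kb u * ((kH s - kH u) * (kH t - kH u))"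
  have "(LINT u|lebesgue_on {0..s}. weight s u * weight t u) = ?F s - ?F 0"
  proof (rule lebesgue_on_interval_FTC[OF assms(1)])
    fix u assume u: "u \<in> {0..s}"
    have nz: "kb u \<noteq> 0" using u by (intro kb_nz) auto
    have "(?F has_real_derivative 1 + ((kh_deriv u * kb u + kb_deriv_fun u * kh u) * ((kH s - kH u) * (kH t - kH u))
        + ((0 - 1 / kb u) * (kH t - kH u) + (0 - 1 / kb u) * (kH s - kH u)) * (kh u * kb u))) (at u within {0..s})"
      by (intro DERIV_add DERIV_ident DERIV_mult DERIV_diff DERIV_const kh_has_deriv kb_has_deriv kH_has_deriv u)
    thus "(?F has_real_derivative weight s u * weight t u) (at u within {0..s})"
    proof (rule DERIV_cong)
      show "1 + ((kh_deriv u * kb u + kb_deriv_fun u * kh u) * ((kH s - kH u) * (kH t - kH u))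
        + ((0 - 1 / kb u) * (kH t - kH u) + (0 - 1 / kb u) * (kH s - kH u)) * (kh u * kb u)) = weight s u * weight t u"
        unfolding kh_kb_deriv weight_def power2_eq_square using nz by (simp add: field_simps)
    qed
  next
    show "continuous_on {0..s} (\<lambda>u. weight s u * weight t u)"
      by (intro continuous_intros weight_continuous)
  qed
  thus ?thesis by simp
qed

text \<open>The past of W contributes kb(0)^2 kH(s) kH(t) times the variance p^2 / (2 \<rho>) of
  y(0). This variance equals kh(0) / kb(0), so the contribution is exactly what the integral in
  \<open>weight_covariance\<close> falls short of s.\<close>

lemma innovation_kernel_covariance:
  assumes "0 \<le> s" "s \<le> t"
  shows "(LINT u|lebesgue. innovation_kernel s u * innovation_kernel t u) = s"
proof -
  let ?e = "\<lambda>u::real. indicator {..0} u * exp ((2 * (p + q)) * u)"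
  let ?C = "kb 0 * kH s * (kb 0 * kH t) * p\<^sup>2"
  have rho: "0 < 2 * (p + q)" using p_gt by simp
  have w_int: "integrable (lebesgue_on {0..s}) (\<lambda>u. weight s u * weight t u)"
    by (intro continuous_imp_integrable_real continuous_intros weight_continuous)
  hence w_int': "integrable lebesgue (\<lambda>u. indicator {0..s} u * (weight s u * weight t u))"
    by (simp add: integrable_restrict_space)
  have e_int: "integrable lebesgue ?e" "(LINT u|lebesgue. ?e u) = 1 / (2 * (p + q))"
    using integral_lborel_exp_Iic[OF rho] by (auto simp: integrable_completion integral_completion)
  \<comment> \<open>The half-line and the interval share only the point 0, so no cross terms remain
    elsewhere.\<close>
  have eq: "innovation_kernel s u * innovation_kernel t u = ?C * ?e u + indicator {0..s} u * (weight s u * weight t u)"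
    if u: "u \<noteq> 0" for u
  proof -
    consider "u < 0" | "0 < u" "u \<le> s" | "s < u" "0 < u" using u by (metis neq_iff not_le)
    then show ?thesis
    proof cases
      case 1
      have "exp ((p + q) * u) * exp ((p + q) * u) = exp ((2 * (p + q)) * u)"
        by (simp add: exp_add[symmetric] algebra_simps)
      with 1 show ?thesis
        by (simp add: innovation_kernel_def power2_eq_square mult_ac)
    qed (use assms in \<open>auto simp: innovation_kernel_def\<close>)
  qed
  have "AE u in lebesgue. u \<noteq> (0::real)"
    by (rule AE_completion) (rule AE_lborel_singleton)
  hence "AE u in lebesgue. innovation_kernel s u * innovation_kernel t u = ?C * ?e u + indicator {0..s} u * (weight s u * weight t u)"
    by (rule eventually_mono) (rule eq)
  moreover have "innovation_kernel s \<in> borel_measurable lebesgue" for s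
  proof -
    have "(\<lambda>u. indicator {0..s} u *\<^sub>R weight s u) \<in> borel_measurable borel"
      by (rule borel_measurable_continuous_on_indicator[OF _ weight_continuous]) simp
    thus ?thesis unfolding innovation_kernel_def[abs_def]
      by (intro measurable_completion) simp
  qed
  ultimately have "(LINT u|lebesgue. innovation_kernel s u * innovation_kernel t u) =
      (LINT u|lebesgue. ?C * ?e u + indicator {0..s} u * (weight s u * weight t u))"
    by (intro Bochner_Integration.integral_cong_AE) (use e_int(1) w_int' in \<open>auto intro: borel_measurable_integrable\<close>)
  also have "\<dots> = ?C * (1 / (2 * (p + q))) + (LINT u|lebesgue. indicator {0..s} u * (weight s u * weight t u))"
    using e_int w_int' by simp
  also have "(LINT u|lebesgue. indicator {0..s} u * (weight s u * weight t u)) = s - kh 0 * kb 0 * kH s * kH t"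
    using weight_covariance[OF assms] by (simp add: integral_restrict_space)
  also have "?C * (1 / (2 * (p + q))) = kh 0 * kb 0 * kH s * kH t"
  proof -
    have "kb 0 * p\<^sup>2 = kh 0 * (2 * (p + q))"
      unfolding kh_eq by (simp add: kb_def power2_eq_square algebra_simps)
    hence "kb 0 * p\<^sup>2 / (2 * (p + q)) = kh 0" using rho by simp
    moreover have "?C * (1 / (2 * (p + q))) = kb 0 * p\<^sup>2 / (2 * (p + q)) * kb 0 * kH s * kH t"
      by (simp only: times_divide_eq_right times_divide_eq_left mult_1_right mult_ac)
    ultimately show ?thesis by (simp only:)
  qed
  finally show ?thesis by simp
qed

end

section \<open>Measurability and filtrations\<close>

text \<open>The path is sampled at the grid point below s of mesh 1 / (n + 1). Each approximation
  uses only countably many times, and continuity gives the limit.\<close>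

lemma borel_measurable_continuous_paths:
  fixes X :: "real \<Rightarrow> 'b \<Rightarrow> real"
  assumes X: "\<And>s. X s \<in> borel_measurable N"
    and cont: "\<And>\<omega>. \<omega> \<in> space N \<Longrightarrow> continuous_on UNIV (\<lambda>s. X s \<omega>)"
  shows "(\<lambda>x. X (fst x) (snd x)) \<in> borel_measurable (borel \<Otimes>\<^sub>M N)"
proof (rule borel_measurable_LIMSEQ_real)
  fix n :: nat
  have "(\<lambda>x. X (of_int i / real (Suc n)) (snd x)) \<in> borel_measurable (borel \<Otimes>\<^sub>M N)" for i :: int
    by (rule measurable_compose[OF measurable_snd X])
  moreover have "(\<lambda>x. \<lfloor>fst x * real (Suc n)\<rfloor>) \<in> borel \<Otimes>\<^sub>M N \<rightarrow>\<^sub>M count_space UNIV"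
    by measurable
  ultimately show "(\<lambda>x. X (of_int \<lfloor>fst x * real (Suc n)\<rfloor> / real (Suc n)) (snd x)) \<in> borel_measurable (borel \<Otimes>\<^sub>M N)"
    by (rule measurable_compose_countable)
next
  fix x :: "real \<times> 'b" assume "x \<in> space (borel \<Otimes>\<^sub>M N)"
  hence "snd x \<in> space N" by (auto simp: space_pair_measure)
  from cont[OF this] have "isCont (\<lambda>s. X s (snd x)) (fst x)"
    by (simp add: continuous_on_eq_continuous_at)
  moreover have "(\<lambda>n. of_int \<lfloor>fst x * real (Suc n)\<rfloor> / real (Suc n)) \<longlonglongrightarrow> fst x"
  proof (rule real_tendsto_sandwich)
    show "\<forall>\<^sub>F n in sequentially. fst x - 1 / real (Suc n) \<le> of_int \<lfloor>fst x * real (Suc n)\<rfloor> / real (Suc n)"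
    proof (rule always_eventually, rule allI)
      fix n
      have "fst x * real (Suc n) - 1 \<le> of_int \<lfloor>fst x * real (Suc n)\<rfloor>" by linarith
      hence "(fst x * real (Suc n) - 1) / real (Suc n) \<le> of_int \<lfloor>fst x * real (Suc n)\<rfloor> / real (Suc n)"
        by (rule divide_right_mono) simp
      thus "fst x - 1 / real (Suc n) \<le> of_int \<lfloor>fst x * real (Suc n)\<rfloor> / real (Suc n)"
        by (simp add: diff_divide_distrib del: of_nat_Suc)
    qed
    show "\<forall>\<^sub>F n in sequentially. of_int \<lfloor>fst x * real (Suc n)\<rfloor> / real (Suc n) \<le> fst x"
    proof (rule always_eventually, rule allI)
      fix n
      have "of_int \<lfloor>fst x * real (Suc n)\<rfloor> / real (Suc n) \<le> (fst x * real (Suc n)) / real (Suc n)"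
        by (rule divide_right_mono) simp_all
      thus "of_int \<lfloor>fst x * real (Suc n)\<rfloor> / real (Suc n) \<le> fst x" by (simp del: of_nat_Suc)
    qed
    have "(\<lambda>n. fst x - 1 / real (Suc n)) \<longlonglongrightarrow> fst x - 0"
      by (intro tendsto_diff tendsto_const LIMSEQ_Suc[OF lim_1_over_n])
    thus "(\<lambda>n. fst x - 1 / real (Suc n)) \<longlonglongrightarrow> fst x" by simp
  qed simp
  ultimately show "(\<lambda>n. X (of_int \<lfloor>fst x * real (Suc n)\<rfloor> / real (Suc n)) (snd x)) \<longlonglongrightarrow> X (fst x) (snd x)"
    by (rule isCont_tendsto_compose)
qed

text \<open>Clamping time to the interval turns its paths into continuous paths on the line.\<close>

lemma borel_measurable_continuous_paths_interval:
  fixes X :: "real \<Rightarrow> 'b \<Rightarrow> real"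
  assumes T: "0 \<le> T" and X: "\<And>s. s \<in> {0..T} \<Longrightarrow> X s \<in> borel_measurable N"
    and cont: "\<And>\<omega>. \<omega> \<in> space N \<Longrightarrow> continuous_on {0..T} (\<lambda>s. X s \<omega>)"
  shows "(\<lambda>x. X (max 0 (min T (fst x))) (snd x)) \<in> borel_measurable (borel \<Otimes>\<^sub>M N)"
    and "(\<lambda>(s, \<omega>). X s \<omega>) \<in> borel_measurable (restrict_space lborel {0..T} \<Otimes>\<^sub>M N)"
proof -
  show m: "(\<lambda>x. X (max 0 (min T (fst x))) (snd x)) \<in> borel_measurable (borel \<Otimes>\<^sub>M N)"
  proof (rule borel_measurable_continuous_paths)
    show "X (max 0 (min T s)) \<in> borel_measurable N" for s using T by (intro X) auto
    show "continuous_on UNIV (\<lambda>s. X (max 0 (min T s)) \<omega>)" if "\<omega> \<in> space N" for \<omega>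
      by (rule continuous_on_compose2[OF cont[OF that]]) (use T in \<open>auto intro!: continuous_intros\<close>)
  qed
  have "(\<lambda>x. (fst x, snd x)) \<in> restrict_space lborel {0..T} \<Otimes>\<^sub>M N \<rightarrow>\<^sub>M borel \<Otimes>\<^sub>M N"
  proof (rule measurable_Pair)
    have "(\<lambda>x. x) \<in> restrict_space lborel {0..T} \<rightarrow>\<^sub>M borel"
      by (intro measurable_restrict_space1) simp
    thus "fst \<in> restrict_space lborel {0..T} \<Otimes>\<^sub>M N \<rightarrow>\<^sub>M borel"
      using measurable_compose[OF measurable_fst] by fastforce
  qed simp
  from measurable_compose[OF this m]
  have "(\<lambda>x. X (max 0 (min T (fst x))) (snd x)) \<in> borel_measurable (restrict_space lborel {0..T} \<Otimes>\<^sub>M N)"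
    by simp
  thus "(\<lambda>(s, \<omega>). X s \<omega>) \<in> borel_measurable (restrict_space lborel {0..T} \<Otimes>\<^sub>M N)"
    by (rule measurable_cong[THEN iffD1, rotated]) (auto simp: space_pair_measure space_restrict_space)
qed

lemma interval_lebesgue_integral_continuous:
  fixes f :: "real \<Rightarrow> real"
  assumes "0 \<le> t" "continuous_on {0..t} f"
  shows "(LBINT s=ereal 0..ereal t. f s) = integral {0..t} f"
  by (rule interval_integral_eq_integral[OF assms(1) borel_integrable_atLeastAtMost'[OF assms(2)]])

lemma is_wiener_integral_cong:
  assumes "is_wiener_integral M W A f X" and "\<And>u. u \<in> A \<Longrightarrow> f u = g u"
  shows "is_wiener_integral M W A g X"
proof -
  have sp: "u \<in> A" if "u \<in> space (lebesgue_on A)" for u using that by simp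
  have "f \<in> borel_measurable (lebesgue_on A) \<longleftrightarrow> g \<in> borel_measurable (lebesgue_on A)"
    by (rule measurable_cong) (use assms(2) in simp)
  moreover have "(\<integral>\<^sup>+u. ennreal ((f u - step_function xs u)\<^sup>2) \<partial>lebesgue_on A) =
      (\<integral>\<^sup>+u. ennreal ((g u - step_function xs u)\<^sup>2) \<partial>lebesgue_on A)" for xs
    by (rule nn_integral_cong) (use assms(2) in simp)
  ultimately show ?thesis using assms(1) unfolding is_wiener_integral_def by simp
qed

section \<open>Augmented filtrations and adaptedness\<close>

text \<open>With the sigma-algebra packed into a measure space, adaptedness at time t becomes
  ordinary measurability.\<close>

definition filtration_space :: "'a measure \<Rightarrow> (real \<Rightarrow> 'a \<Rightarrow> real) \<Rightarrow> real \<Rightarrow> 'a measure"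
  where "filtration_space M A t = sigma (space M)
    ({A s -` E \<inter> space M | s E. 0 \<le> s \<and> s \<le> t \<and> E \<in> sets borel} \<union> null_sets M)"

lemma filtration_space:
  shows sets_filtration_space: "sets (filtration_space M A t) = augmented_filtration M A t"
    and space_filtration_space: "space (filtration_space M A t) = space M"
    and null_sets_filtration_space: "null_sets M \<subseteq> sets (filtration_space M A t)"
    and process_filtration_space: "0 \<le> s \<Longrightarrow> s \<le> t \<Longrightarrow> A s \<in> borel_measurable (filtration_space M A t)"
proof -
  have sub: "{A s -` E \<inter> space M | s E. 0 \<le> s \<and> s \<le> t \<and> E \<in> sets borel} \<union> null_sets M \<subseteq> Pow (space M)"
    using sets.sets_into_space by (fastforce simp: null_sets_def)
  show s: "sets (filtration_space M A t) = augmented_filtration M A t"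
    unfolding filtration_space_def augmented_filtration_def by (rule sets_measure_of[OF sub])
  show sp: "space (filtration_space M A t) = space M"
    unfolding filtration_space_def by (rule space_measure_of[OF sub])
  show "null_sets M \<subseteq> sets (filtration_space M A t)"
    unfolding s augmented_filtration_def by (auto intro: sigma_sets.Basic)
  show "A s \<in> borel_measurable (filtration_space M A t)" if "0 \<le> s" "s \<le> t"
  proof (rule measurableI)
    fix E :: "real set" assume "E \<in> sets borel"
    thus "A s -` E \<inter> space (filtration_space M A t) \<in> sets (filtration_space M A t)"
      unfolding s sp augmented_filtration_def using that by (intro sigma_sets.Basic) blast
  qed simp
qed

lemma augmented_filtration_subset:
  assumes "\<And>s. 0 \<le> s \<Longrightarrow> s \<le> t \<Longrightarrow> A s \<in> borel_measurable (filtration_space M C t)"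
  shows "augmented_filtration M A t \<subseteq> augmented_filtration M C t"
proof -
  have "A s -` E \<inter> space M \<in> sets (filtration_space M C t)" if "0 \<le> s" "s \<le> t" "E \<in> sets borel" for s E
    using measurable_sets[OF assms[OF that(1,2)] that(3)] by (simp add: space_filtration_space)
  hence "{A s -` E \<inter> space M | s E. 0 \<le> s \<and> s \<le> t \<and> E \<in> sets borel} \<union> null_sets M \<subseteq> sets (filtration_space M C t)"
    using null_sets_filtration_space by blast
  from sets.sigma_sets_subset[OF this] show ?thesis
    unfolding augmented_filtration_def[of M A] by (simp add: space_filtration_space sets_filtration_space)
qed

text \<open>The functions differ inside a null set, and completeness makes each of its subsets
  measurable, hence null, hence a member of \<open>F\<close>. This lets V and its continuous version
  be exchanged within a filtration.\<close>

lemma borel_measurable_AE_eq_complete: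
  fixes f g :: "'a \<Rightarrow> real"
  assumes M: "complete_measure M" and F: "null_sets M \<subseteq> sets F" "space F = space M"
    and f: "f \<in> borel_measurable F" and fg: "AE \<omega> in M. f \<omega> = g \<omega>"
  shows "g \<in> borel_measurable F"
proof (rule measurableI)
  fix E :: "real set" assume E: "E \<in> sets borel"
  obtain N where N: "N \<in> null_sets M" and eq: "\<And>\<omega>. \<omega> \<in> space M - N \<Longrightarrow> f \<omega> = g \<omega>"
    using fg by (rule AE_E3) (rule that)
  let ?R = "g -` E \<inter> space M \<inter> N"
  have "?R \<in> sets M" using complete_measure.complete[OF M _ N, of ?R] by auto
  hence "?R \<in> null_sets M" by (rule null_sets_subset[OF N]) auto
  hence "?R \<in> sets F" using F by auto
  moreover have "f -` E \<inter> space F - N \<in> sets F" using measurable_sets[OF f E] N F by auto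
  moreover have "g -` E \<inter> space F = (f -` E \<inter> space F - N) \<union> ?R" using eq F by auto
  ultimately show "g -` E \<inter> space F \<in> sets F" by auto
qed simp

context volterra_parameters
begin

lemma kernel_l_kc: "0 \<le> u \<Longrightarrow> kernel_l p q s u = exp (- (p + q) * s) * kc u"
  by (simp add: kernel_l_eq kc_def)

lemma kernel_l_has_deriv:
  assumes "u \<in> {0..s}"
  shows "((\<lambda>u. exp (- (p + q) * s) * kc u) has_real_derivative exp (- (p + q) * s) * kc_deriv u) (at u within {0..s})"
  by (intro DERIV_cmult kc_has_deriv kb_nz) (use assms in auto)

lemma stat_path_measurable:
  assumes s: "0 \<le> s" and y: "y \<in> borel_measurable F"
    and w: "\<And>u. 0 \<le> u \<Longrightarrow> u \<le> s \<Longrightarrow> w u \<in> borel_measurable F"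
    and cont: "\<And>\<omega>. \<omega> \<in> space F \<Longrightarrow> continuous_on {0..s} (\<lambda>u. w u \<omega>)"
  shows "(\<lambda>\<omega>. stat_path (y \<omega>) (\<lambda>u. w u \<omega>) s) \<in> borel_measurable F"
proof -
  have "(\<lambda>\<omega>. integral {0..s} (\<lambda>u. p * (p + q) * exp ((p + q) * u) * w u \<omega>)) \<in> borel_measurable F"
    by (rule borel_measurable_integral_continuous_paths[OF s])
      (auto intro!: w borel_measurable_times continuous_intros cont)
  thus ?thesis unfolding stat_path_def using y w[OF s order_refl] by measurable
qed

text \<open>Here and in the next lemmas \<open>F\<close> is left open and the path enters only up to
  the final time. For \<open>F = M\<close> they provide random variables, for the sigma-algebra of a
  filtration they provide adaptedness.\<close>

lemma filter_path_measurable: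
  assumes s: "0 \<le> s" and v: "\<And>u. 0 \<le> u \<Longrightarrow> u \<le> s \<Longrightarrow> v u \<in> borel_measurable F"
    and cont: "\<And>\<omega>. \<omega> \<in> space F \<Longrightarrow> continuous_on {0..s} (\<lambda>u. v u \<omega>)"
  shows "(\<lambda>\<omega>. filter_path (\<lambda>u. v u \<omega>) s) \<in> borel_measurable F"
proof -
  have "(\<lambda>\<omega>. integral {0..s} (\<lambda>u. ka_deriv u * v u \<omega>)) \<in> borel_measurable F"
    by (rule borel_measurable_integral_continuous_paths[OF s])
      (auto intro!: v borel_measurable_times continuous_intros cont)
  thus ?thesis unfolding filter_path_def using v[OF s order_refl] by measurable
qed

lemma innovation_measurable:
  assumes t: "0 \<le> t" and v: "\<And>u. 0 \<le> u \<Longrightarrow> u \<le> t \<Longrightarrow> v u \<in> borel_measurable F"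
    and cont: "\<And>\<omega>. \<omega> \<in> space F \<Longrightarrow> continuous_on {0..t} (\<lambda>u. v u \<omega>)"
  shows "(\<lambda>\<omega>. innovation (\<lambda>u. v u \<omega>) t) \<in> borel_measurable F"
proof -
  have "(\<lambda>\<omega>. integral {0..t} (\<lambda>s. filter_path (\<lambda>u. v u \<omega>) s)) \<in> borel_measurable F"
  proof (rule borel_measurable_integral_continuous_paths[OF t])
    show "(\<lambda>\<omega>. filter_path (\<lambda>u. v u \<omega>) s) \<in> borel_measurable F" if "0 \<le> s" "s \<le> t" for s
      using that by (intro filter_path_measurable v continuous_on_subset[OF cont]) auto
    show "continuous_on {0..t} (\<lambda>s. filter_path (\<lambda>u. v u \<omega>) s)" if "\<omega> \<in> space F" for \<omega>
      using filter_path_continuous[OF cont[OF that]] .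
  qed
  thus ?thesis unfolding innovation_def using v[OF t order_refl] by simp
qed

lemma volterra_path_measurable:
  assumes s: "0 \<le> s" and b: "\<And>u. 0 \<le> u \<Longrightarrow> u \<le> s \<Longrightarrow> b u \<in> borel_measurable F"
    and cont: "\<And>\<omega>. \<omega> \<in> space F \<Longrightarrow> continuous_on {0..s} (\<lambda>u. b u \<omega>)"
  shows "(\<lambda>\<omega>. volterra_path (\<lambda>u. b u \<omega>) s) \<in> borel_measurable F"
proof -
  have "(\<lambda>\<omega>. integral {0..s} (\<lambda>u. kc_deriv u * b u \<omega>)) \<in> borel_measurable F"
    by (rule borel_measurable_integral_continuous_paths[OF s])
      (auto intro!: b borel_measurable_times continuous_intros kc_deriv_continuous cont)
  thus ?thesis unfolding volterra_path_def using b[OF s order_refl] by measurable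
qed

end

theorem theorem2p1:
  fixes M :: "'a measure" and W V Y :: "real \<Rightarrow> 'a \<Rightarrow> real" and T p q :: real
  assumes "0 < T" and "0 < q" and "- q < p"
    and "complete_measure M"
    and "brownian_motion M UNIV W"
    and "is_wiener_integral_process M W UNIV (\<lambda>s. {..s}) (\<lambda>s u. p * exp (- (q + p) * (s - u))) Y"
    and "\<And>t \<omega>. V t \<omega> = W t \<omega> - (LBINT s=ereal 0..ereal t. Y s \<omega>)"
  shows "is_resolvent T (kernel_k p q) (kernel_l p q) \<and>
    (\<forall>l. is_resolvent T (kernel_k p q) l \<longrightarrow>
      (AE (t, s) in lebesgue_on (volterra_triangle T). l t s = kernel_l p q t s)) \<and>
    (\<exists>B Z. brownian_motion M {0..T} B \<and>
      (\<forall>t\<in>{0..T}. augmented_filtration M B t = augmented_filtration M V t) \<and>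
      is_wiener_integral_process M B {0..T} (\<lambda>s. {0..s}) (kernel_l p q) Z \<and>
      (AE \<omega> in M. \<forall>t\<in>{0..T}. V t \<omega> = B t \<omega> - (LBINT s=ereal 0..ereal t. Z s \<omega>)))"
proof (intro conjI allI impI)
  interpret volterra_parameters p q
    by standard (use assms(2,3) in auto)
  show "is_resolvent T (kernel_k p q) (kernel_l p q)"
    by (rule is_resolvent_kernel_l)
  show "AE (t, s) in lebesgue_on (volterra_triangle T). l t s = kernel_l p q t s"
    if "is_resolvent T (kernel_k p q) l" for l
    using that by (rule resolvent_unique)
  have T: "0 \<le> T" using assms(1) by simp
  interpret W: brownian_motion M UNIV W by (rule assms(5))
  obtain N where N: "N \<in> null_sets M"
    and reg: "\<And>\<omega>. \<omega> \<in> space M - N \<Longrightarrow> continuous_on UNIV (\<lambda>t. W t \<omega>)"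
    using W.paths_continuous by (rule AE_E3) (rule that)
  \<comment> \<open>Paths are set to 0 on the exceptional null set, so that every path is continuous
    and the path functionals apply to all outcomes.\<close>
  define w where "w t \<omega> = (if \<omega> \<in> space M - N then W t \<omega> else 0)" for t \<omega>
  have wm: "w t \<in> borel_measurable M" for t
    unfolding w_def using N W.rv[of t] by (intro measurable_If_set) auto
  have wc: "continuous_on S (\<lambda>t. w t \<omega>)" for S \<omega>
    using reg[of \<omega>] continuous_on_subset[of UNIV _ S] by (cases "\<omega> \<in> space M - N") (auto simp: w_def)
  have w_eq: "AE \<omega> in M. \<forall>t. W t \<omega> = w t \<omega>"
    using AE_not_in[OF N] AE_space by eventually_elim (simp add: w_def)

  \<comment> \<open>The stationary process as a functional of continuous paths\<close>
  have YW: "is_wiener_integral M W {..s} (\<lambda>u. p * exp (- (q + p) * (s - u))) (Y s)" for s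
    using assms(6) by (simp add: is_wiener_integral_process_def)
  have Y_line: "W.full_wiener_integral (\<lambda>u. indicator {..s} u * (p * exp (- (q + p) * (s - u)))) (Y s)" for s
    by (rule W.full_wiener_integral_of_wiener_integral[OF YW]) (auto simp: is_interval_def)
  have Y0m: "Y 0 \<in> borel_measurable M" using W.full_wiener_integral_measurable[OF Y_line[of 0]] by simp
  define y where "y s \<omega> = stat_path (Y 0 \<omega>) (\<lambda>u. w u \<omega>) s" for s \<omega>
  have ym: "y s \<in> borel_measurable M" if "0 \<le> s" for s
    unfolding y_def by (rule stat_path_measurable[OF that Y0m wm wc])
  have yc: "continuous_on {0..t} (\<lambda>s. y s \<omega>)" for t \<omega>
    unfolding y_def by (rule stat_path_continuous[OF wc])
  \<comment> \<open>Splitting the half-line at 0 writes Y(s) as exp(-\<rho> s) times the sum of Y(0)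
    and the integral of p exp(\<rho> u) dW(u) from 0 to s, which is evaluated by parts. The
    exceptional null set still depends on s.\<close>
  have Yy: "AE \<omega> in M. Y s \<omega> = y s \<omega>" if s: "0 \<le> s" for s
  proof -
    define X where "X \<omega> = p * exp ((p + q) * s) * w s \<omega> -
      integral {0..s} (\<lambda>u. p * (p + q) * exp ((p + q) * u) * w u \<omega>)" for \<omega>
    have Xm: "X \<in> borel_measurable M"
      unfolding X_def
      by (intro borel_measurable_diff borel_measurable_times borel_measurable_integral_continuous_paths s wm
          continuous_intros wc) auto
    have "is_wiener_integral M W {0..s} (\<lambda>u. p * exp ((p + q) * u)) X"
    proof (rule W.wiener_integral_by_parts[OF s _ _ _ Xm, where f' = "\<lambda>u. p * (p + q) * exp ((p + q) * u)"])
      show "((\<lambda>u. p * exp ((p + q) * u)) has_real_derivative p * (p + q) * exp ((p + q) * u)) (at u within {0..s})" for u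
        by (auto intro!: derivative_eq_intros)
      show "AE \<omega> in M. X \<omega> = p * exp ((p + q) * s) * W s \<omega> - integral {0..s} (\<lambda>u. p * (p + q) * exp ((p + q) * u) * W u \<omega>)"
        using w_eq by eventually_elim (simp add: X_def)
    qed (auto intro!: continuous_intros)
    hence X_line: "W.full_wiener_integral (\<lambda>u. indicator {0..s} u * (p * exp ((p + q) * u))) X"
      by (rule W.full_wiener_integral_of_wiener_integral) (auto simp: is_interval_def)
    let ?e = "exp (- (p + q) * s)"
    have "AE \<omega> in M. Y s \<omega> = ?e * Y 0 \<omega> + ?e * X \<omega>"
    proof (rule W.full_wiener_integral_unique[OF Y_line W.full_wiener_integral_lincomb[OF Y_line X_line]])
      have "AE u in lebesgue. u \<noteq> (0::real)"
        by (rule AE_completion) (rule AE_lborel_singleton)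
      thus "AE u in lebesgue. indicator {..s} u * (p * exp (- (q + p) * (s - u))) =
        ?e * (indicator {..0} u * (p * exp (- (q + p) * (0 - u)))) + ?e * (indicator {0..s} u * (p * exp ((p + q) * u)))"
      proof eventually_elim
        case (elim u)
        have "exp (- (q + p) * (s - u)) = ?e * exp ((p + q) * u)"
          "exp (- (q + p) * (0 - u)) = exp ((p + q) * u)"
          by (simp_all add: exp_add[symmetric] algebra_simps)
        thus ?case using elim s by (cases "u \<le> 0") (auto simp: indicator_def)
      qed
    qed
    thus ?thesis
      by eventually_elim (simp add: y_def stat_path_def X_def algebra_simps)
  qed
  interpret LM: pair_sigma_finite lborel M
    by (intro pair_sigma_finite.intro lborel.sigma_finite_measure_axioms W.sigma_finite_measure_axioms)
  \<comment> \<open>Clamped time makes the continuous version jointly measurable on the whole line,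
    as needed for exchanging the two almost everywhere quantifiers.\<close>
  define y' where "y' s = y (max 0 (min T s))" for s
  have Ymm[measurable]: "(\<lambda>x. Y (fst x) (snd x)) \<in> borel_measurable (lborel \<Otimes>\<^sub>M M)"
  proof -
    have eq: "sets (restrict_space lborel UNIV \<Otimes>\<^sub>M M) = sets (lborel \<Otimes>\<^sub>M M)"
      by (rule sets_pair_measure_cong) (auto simp: sets_restrict_space)
    show ?thesis
      using assms(6) by (simp add: is_wiener_integral_process_def case_prod_unfold measurable_cong_sets[OF eq refl])
  qed
  have "(\<lambda>x. y' (fst x) (snd x)) \<in> borel_measurable (borel \<Otimes>\<^sub>M M)"
    unfolding y'_def by (rule borel_measurable_continuous_paths_interval(1)[OF T]) (auto intro: ym yc)
  hence ymm[measurable]: "(\<lambda>x. y' (fst x) (snd x)) \<in> borel_measurable (lborel \<Otimes>\<^sub>M M)"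
    by (subst measurable_cong_sets[OF sets_pair_measure_cong[OF sets_lborel refl] refl])
  have "AE s in lborel. AE \<omega> in M. s \<in> {0..T} \<longrightarrow> Y s \<omega> = y' s \<omega>"
  proof (rule AE_I2)
    fix s :: real
    show "AE \<omega> in M. s \<in> {0..T} \<longrightarrow> Y s \<omega> = y' s \<omega>"
    proof (cases "s \<in> {0..T}")
      case True
      hence "y' s = y s" by (simp add: y'_def)
      thus ?thesis using Yy[of s] True by simp
    next
      case False
      thus ?thesis by (intro AE_I2) blast
    qed
  qed
  moreover have "{x \<in> space (lborel \<Otimes>\<^sub>M M). fst x \<in> {0..T} \<longrightarrow> Y (fst x) (snd x) = y' (fst x) (snd x)}
      \<in> sets (lborel \<Otimes>\<^sub>M M)"
    by measurable
  \<comment> \<open>By Fubini, equality at each s off a null set of outcomes becomes, for almost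
    every outcome, equality at almost every s. That suffices for the time integrals, simultaneously
    for all t.\<close>
  ultimately have ae: "AE \<omega> in M. AE s in lborel. s \<in> {0..T} \<longrightarrow> Y s \<omega> = y' s \<omega>"
    using LM.AE_commute[of "\<lambda>s \<omega>. s \<in> {0..T} \<longrightarrow> Y s \<omega> = y' s \<omega>"] by blast
  have intY: "AE \<omega> in M. \<forall>t\<in>{0..T}. (LBINT s=ereal 0..ereal t. Y s \<omega>) = integral {0..t} (\<lambda>s. y s \<omega>)"
    using ae AE_space
  proof eventually_elim
    case (elim \<omega>)
    show ?case
    proof
      fix t assume t: "t \<in> {0..T}"
      have sec: "(\<lambda>s. f (fst (s, \<omega>)) (snd (s, \<omega>))) \<in> borel_measurable borel"
        if "(\<lambda>x. f (fst x) (snd x)) \<in> borel_measurable (lborel \<Otimes>\<^sub>M M)" for f :: "real \<Rightarrow> 'a \<Rightarrow> real"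
        using measurable_compose[OF measurable_Pair2'[OF elim(2)] that] by simp
      have "(LBINT s=ereal 0..ereal t. Y s \<omega>) = (LBINT s=ereal 0..ereal t. y' s \<omega>)"
      proof (rule interval_integral_cong_AE)
        show "(\<lambda>s. Y s \<omega>) \<in> borel_measurable borel" using sec[OF Ymm] by simp
        show "(\<lambda>s. y' s \<omega>) \<in> borel_measurable borel" using sec[OF ymm] by simp
        show "AE s \<in> einterval (min (ereal 0) (ereal t)) (max (ereal 0) (ereal t)) in lborel. Y s \<omega> = y' s \<omega>"
          using elim(1) by eventually_elim (use t in \<open>auto simp: einterval_def min_def max_def split: if_splits\<close>)
      qed
      also have "\<dots> = integral {0..t} (\<lambda>s. y' s \<omega>)"
      proof (rule interval_lebesgue_integral_continuous)
        show "continuous_on {0..t} (\<lambda>s. y' s \<omega>)"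
          by (rule continuous_on_cong[THEN iffD1, OF refl _ yc]) (use t in \<open>auto simp: y'_def\<close>)
      qed (use t in simp)
      also have "\<dots> = integral {0..t} (\<lambda>s. y s \<omega>)"
        by (rule Henstock_Kurzweil_Integration.integral_cong) (use t in \<open>auto simp: y'_def\<close>)
      finally show "(LBINT s=ereal 0..ereal t. Y s \<omega>) = integral {0..t} (\<lambda>s. y s \<omega>)" .
    qed
  qed

  \<comment> \<open>The innovation process is a Brownian motion\<close>
  define v where "v t \<omega> = w t \<omega> - integral {0..t} (\<lambda>s. y s \<omega>)" for t \<omega>
  have Vv: "AE \<omega> in M. \<forall>t\<in>{0..T}. V t \<omega> = v t \<omega>"
    using intY w_eq by eventually_elim (simp add: assms(7) v_def)
  have vm: "v t \<in> borel_measurable M" if "0 \<le> t" for t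
    unfolding v_def using that
    by (intro borel_measurable_diff wm borel_measurable_integral_continuous_paths ym yc) auto
  have vc: "continuous_on {0..t} (\<lambda>s. v s \<omega>)" for t \<omega>
    unfolding v_def by (intro continuous_intros wc indefinite_integral_continuous_on yc)
  define B where "B t \<omega> = innovation (\<lambda>u. v u \<omega>) t" for t \<omega>
  have Bm: "B t \<in> borel_measurable M" if "0 \<le> t" for t
    unfolding B_def using that by (intro innovation_measurable vm vc) auto
  have Bc: "continuous_on {0..t} (\<lambda>s. B s \<omega>)" for t \<omega>
    unfolding B_def by (rule innovation_continuous[OF vc])
  have B_line: "W.full_wiener_integral (innovation_kernel t) (B t)" if t: "t \<in> {0..T}" for t
  proof -
    have t0: "0 \<le> t" using t by simp
    define X where "X \<omega> = weight t t * w t \<omega> - integral {0..t} (\<lambda>u. weight_deriv t u * w u \<omega>)" for \<omega>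
    have Xm: "X \<in> borel_measurable M"
      unfolding X_def
      by (intro borel_measurable_diff borel_measurable_times borel_measurable_integral_continuous_paths t0 wm
          continuous_intros wc weight_deriv_continuous) auto
    have "is_wiener_integral M W {0..t} (weight t) X"
    proof (rule W.wiener_integral_by_parts[OF t0 _ weight_has_deriv weight_deriv_continuous Xm])
      show "AE \<omega> in M. X \<omega> = weight t t * W t \<omega> - integral {0..t} (\<lambda>u. weight_deriv t u * W u \<omega>)"
        using w_eq by eventually_elim (simp add: X_def)
    qed auto
    hence X_line: "W.full_wiener_integral (\<lambda>u. indicator {0..t} u * weight t u) X"
      by (rule W.full_wiener_integral_of_wiener_integral) (auto simp: is_interval_def)
    from W.full_wiener_integral_lincomb[OF Y_line[of 0] this, of "- (kb 0 * kH t)" 1]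
    have "W.full_wiener_integral (\<lambda>u. - (kb 0 * kH t) * (indicator {..0} u * (p * exp (- (q + p) * (0 - u)))) + 1 * (indicator {0..t} u * weight t u))
      (\<lambda>\<omega>. - (kb 0 * kH t) * Y 0 \<omega> + 1 * X \<omega>)" .
    moreover have "(\<lambda>u. - (kb 0 * kH t) * (indicator {..0} u * (p * exp (- (q + p) * (0 - u)))) + 1 * (indicator {0..t} u * weight t u))
      = innovation_kernel t"
    proof
      fix u :: real
      have "- (q + p) * (0 - u) = (p + q) * u" by (simp add: algebra_simps)
      thus "- (kb 0 * kH t) * (indicator {..0} u * (p * exp (- (q + p) * (0 - u)))) + 1 * (indicator {0..t} u * weight t u)
        = innovation_kernel t u" unfolding innovation_kernel_def by (simp only: mult_1)
    qed
    \<comment> \<open>Equality holds for every outcome, not just almost surely, because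
      \<open>v\<close> and \<open>y\<close> were built from the everywhere continuous
      \<open>w\<close>.\<close>
    moreover have "(\<lambda>\<omega>. - (kb 0 * kH t) * Y 0 \<omega> + 1 * X \<omega>) = B t"
    proof
      fix \<omega>
      have "B t \<omega> = - (kb 0 * kH t) * Y 0 \<omega> + (weight t t * w t \<omega> - integral {0..t} (\<lambda>u. weight_deriv t u * w u \<omega>))"
        unfolding B_def by (rule innovation_representation[OF wc t]) (simp add: v_def y_def[abs_def])
      thus "- (kb 0 * kH t) * Y 0 \<omega> + 1 * X \<omega> = B t \<omega>" by (simp add: X_def)
    qed
    ultimately show ?thesis by simp
  qed
  have BM: "brownian_motion M {0..T} B"
    by (rule W.brownian_motion_if_covariance_min[OF B_line innovation_kernel_covariance T])
      (use Bc in auto)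
  interpret B: brownian_motion M "{0..T}" B by (rule BM)

  \<comment> \<open>The representation of V by B\<close>
  define Z where "Z s \<omega> = volterra_path (\<lambda>u. B u \<omega>) s" for s \<omega>
  have Zm: "Z s \<in> borel_measurable M" if "0 \<le> s" for s
    unfolding Z_def using that by (intro volterra_path_measurable Bm Bc) auto
  have Zc: "continuous_on {0..t} (\<lambda>s. Z s \<omega>)" for t \<omega>
    unfolding Z_def by (rule volterra_path_continuous[OF Bc])
  have vBZ: "v t \<omega> = B t \<omega> - integral {0..t} (\<lambda>s. Z s \<omega>)" if "0 \<le> t" for t \<omega>
    using innovation_inverse[OF vc[of t \<omega>], of t] that unfolding B_def Z_def by simp
  have Z: "is_wiener_integral_process M B {0..T} (\<lambda>s. {0..s}) (kernel_l p q) Z"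
    unfolding is_wiener_integral_process_def
  proof (intro conjI ballI)
    show "(\<lambda>(s, \<omega>). Z s \<omega>) \<in> borel_measurable (restrict_space lborel {0..T} \<Otimes>\<^sub>M M)"
      by (rule borel_measurable_continuous_paths_interval(2)[OF T]) (auto intro: Zm Zc)
    fix s assume s: "s \<in> {0..T}"
    show "is_wiener_integral M B {0..s} (kernel_l p q s) (Z s)"
    proof (rule is_wiener_integral_cong)
      show "is_wiener_integral M B {0..s} (\<lambda>u. exp (- (p + q) * s) * kc u) (Z s)"
      \<comment> \<open>\<open>B\<close> is now itself a Brownian motion, so integration by parts
        against \<open>B\<close> identifies the path functional as a Wiener integral.\<close>
      proof (rule B.wiener_integral_by_parts[OF _ _ kernel_l_has_deriv])
        show "continuous_on {0..s} (\<lambda>u. exp (- (p + q) * s) * kc_deriv u)"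
          by (intro continuous_intros kc_deriv_continuous)
        have "integral {0..s} (\<lambda>u. exp (- (p + q) * s) * kc_deriv u * B u \<omega>) =
            exp (- (p + q) * s) * integral {0..s} (\<lambda>u. kc_deriv u * B u \<omega>)" for \<omega>
          unfolding mult.assoc by (rule integral_mult_right)
        thus "AE \<omega> in M. Z s \<omega> = exp (- (p + q) * s) * kc s * B s \<omega> -
            integral {0..s} (\<lambda>u. exp (- (p + q) * s) * kc_deriv u * B u \<omega>)"
          by (simp add: Z_def volterra_path_def right_diff_distrib mult.assoc)
      qed (use s Zm in auto)
    qed (simp add: kernel_l_kc)
  qed
  have decomposition: "AE \<omega> in M. \<forall>t\<in>{0..T}. V t \<omega> = B t \<omega> - (LBINT s=ereal 0..ereal t. Z s \<omega>)"
    using Vv by eventually_elim (simp add: vBZ interval_lebesgue_integral_continuous[OF _ Zc])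

  \<comment> \<open>\<open>B\<close> up to time t is a functional of \<open>v\<close> up to time t,
    and conversely \<open>v\<close> is one of \<open>B\<close> through \<open>Z\<close>. Passing
    between \<open>v\<close> and V costs a null set, which the augmentation absorbs.\<close>
  have filtration: "augmented_filtration M B t = augmented_filtration M V t" if t: "t \<in> {0..T}" for t
  proof
    have v_V: "v s \<in> borel_measurable (filtration_space M V t)" if "0 \<le> s" "s \<le> t" for s
    proof (rule borel_measurable_AE_eq_complete[OF assms(4) null_sets_filtration_space space_filtration_space])
      show "V s \<in> borel_measurable (filtration_space M V t)"
        using that by (rule process_filtration_space)
      show "AE \<omega> in M. V s \<omega> = v s \<omega>" using Vv by eventually_elim (use t that in auto)
    qed
    show "augmented_filtration M B t \<subseteq> augmented_filtration M V t"
    proof (rule augmented_filtration_subset)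
      show "B s \<in> borel_measurable (filtration_space M V t)" if "0 \<le> s" "s \<le> t" for s
        unfolding B_def using that by (intro innovation_measurable v_V vc) auto
    qed
    have Z_B: "Z s \<in> borel_measurable (filtration_space M B t)" if "0 \<le> s" "s \<le> t" for s
      unfolding Z_def using that by (intro volterra_path_measurable process_filtration_space Bc) auto
    show "augmented_filtration M V t \<subseteq> augmented_filtration M B t"
    proof (rule augmented_filtration_subset)
      fix s assume s: "0 \<le> s" "s \<le> t"
      show "V s \<in> borel_measurable (filtration_space M B t)"
      proof (rule borel_measurable_AE_eq_complete[OF assms(4) null_sets_filtration_space space_filtration_space])
        have "(\<lambda>\<omega>. B s \<omega> - integral {0..s} (\<lambda>u. Z u \<omega>)) \<in> borel_measurable (filtration_space M B t)"
          using s by (intro borel_measurable_diff process_filtration_space borel_measurable_integral_continuous_paths Z_B Zc) auto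
        thus "v s \<in> borel_measurable (filtration_space M B t)"
          using vBZ[OF s(1)] by (simp cong: measurable_cong)
        show "AE \<omega> in M. v s \<omega> = V s \<omega>" using Vv by eventually_elim (use t s in auto)
      qed
    qed
  qed
  show "\<exists>B Z. brownian_motion M {0..T} B \<and>
      (\<forall>t\<in>{0..T}. augmented_filtration M B t = augmented_filtration M V t) \<and>
      is_wiener_integral_process M B {0..T} (\<lambda>s. {0..s}) (kernel_l p q) Z \<and>
      (AE \<omega> in M. \<forall>t\<in>{0..T}. V t \<omega> = B t \<omega> - (LBINT s=ereal 0..ereal t. Z s \<omega>))"
    using BM filtration Z decomposition by blast
qed

end
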